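(* Consider the asynchronous communication model with output-sampling constraint described in the context. Under adaptive sampling it is possible to achieve the full-sampling capacity per unit cost: $$\boldsymbol{C}_{\mathrm{a}}(\beta,\rho)=\boldsymbol{C}(\beta,1)\qquad\text{for any }\beta>0,\ \rho>0 .$$ Moreover, for any $\beta>0$ and $\rho>0$ there exist a sequence of codes $\{\mathcal{C}_B\}$ with adaptive sampling and positive numbers $\varepsilon_B\to0$ as $B\to\infty$ that achieve rate per unit cost $\boldsymbol{C}(\beta,1)$ at timing uncertainty per information bit $\beta$ and sampling frequency $\rho$, and such that $$d(\mathcal{C}_B,\varepsilon_B)=n^*_B\,(1+o(1))\qquad(B\to\infty).$$
   Context: **Channel.** A discrete memoryless channel has finite input alphabet $\mathcal{X}\cup\{\star\}$, finite output alphabet $\mathcal{Y}$ and transition probabilities $Q(y|x)$. The symbol $\star$ is the idle symbol; $\mathcal{X}$ may or may not contain $\star$. For every $y\in\mathcal{Y}$ there is $x\in\mathcal{X}\cup\{\star\}$ with $Q(y|x)>0$. The cost function is $k:\mathcal{X}\to[0,\infty]$. Standing assumption: the only possible zero-cost symbol is $\star$; that is, if $\star\in\mathcal{X}$ then $k(\star)=0$ and all other symbols have positive cost, and if $\star\notin\mathcal{X}$ then $k(x)>0$ for all $x\in\mathcal{X}$. **Transmission.** For $B\ge1$ bits, a codebook consists of $M=2^B$ codewords $c^n(m)=(c_1(m),\dots,c_n(m))\in\mathcal{X}^n$ of some length $n\ge1$ (which may depend on $B$). A uniformly chosen message $m$ arrives at a random time $\nu$, independent of $m$ and uniform on $\{1,\dots,A\}$,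 where $A=2^{\beta B}$ is an integer and $\beta\ge0$ is the timing uncertainty per information bit. The transmitter chooses a starting time $\sigma=\sigma(\nu,m)$ with $\nu\le\sigma\le A$ almost surely. Conditioned on $\nu=t$ and $m$, the outputs $Y_1,\dots,Y_{A+n-1}$ are independent, with $Y_i\sim Q(\cdot|c_{i-\sigma+1}(m))$ for $\sigma\le i\le\sigma+n-1$ and $Y_i\sim Q(\cdot|\star)$ otherwise. **Receiver.** A sampling strategy $\mathcal{S}$ is a collection of random times $S_1<S_2<\dots<S_\ell$ in $\{1,\dots,A+n-1\}$ ($\ell$ possibly random). It is *non-adaptive* if it is independent of $Y_1^{A+n-1}$ (all sampling times known before communication starts, possibly randomized). It is *adaptive* if $S_1$ is independent of $Y_1^{A+n-1}$ (possibly random) and, for $j\ge2$, $S_j=g_j(\{Y_{S_i}\}_{i<j})\in\{S_{j-1}+1,\dots,A+n-1\}$ for some possibly randomized function $g_j$. Adaptive strategies include non-adaptive ones. The receiver uses a (possibly randomized) stopping time $\tau$ with respect to $Y_{S_1},Y_{S_2},\dots$ and a decoding function $\phi$ mapping the observed samples $\mathcal{O}=\{Y_{S_1},\dots,Y_{S_\tau}\}$ to $\{1,\dots,M\}$; decoding occurs at time $S_\tau$, based on $\tau$ samples. A *code* $\mathcal{C}$ consists of the codebook (with the transmitter's rule $\sigma$), the sampling strategy and the decoder $(\tau,\phi)$. **Performance.** Let $\mathbb{P}_{m,t}$ be the law given message $m$ and $\nu=t$, and $\mathbb{P}_m=\frac1A\sum_{t=1}^A\mathbb{P}_{m,t}$.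 - Error probability: $\mathbb{P}(\mathcal{E}|\mathcal{C})=\max_m\mathbb{P}_m(\phi(\mathcal{O})\neq m)$. - Cost: $K(\mathcal{C})=\max_m\sum_{i=1}^n k(c_i(m))$. - Sampling frequency $\rho(\mathcal{C},\varepsilon)$: the smallest $r\ge0$ with $\min_m\mathbb{P}_m(\tau/S_\tau\le r)\ge1-\varepsilon$. - Delay $d(\mathcal{C},\varepsilon)$: the smallest integer $l$ with $\min_m\mathbb{P}_m(S_\tau-\nu\le l-1)\ge1-\varepsilon$. **Achievability and capacity.** Codes $\{\mathcal{C}_B\}$ together with positive numbers $\varepsilon_B\to0$ *achieve rate per unit cost $\boldsymbol{R}$ at timing uncertainty $\beta$ and sampling frequency $\rho$* if for all $B$ large enough: (1) $\mathcal{C}_B$ carries $B$ bits and operates at timing uncertainty per bit $\beta$; (2) $\mathbb{P}(\mathcal{E}|\mathcal{C}_B)\le\varepsilon_B$; (3) $B/K(\mathcal{C}_B)\ge\boldsymbol{R}-\varepsilon_B$; (4) $\rho(\mathcal{C}_B,\varepsilon_B)\le\rho+\varepsilon_B$; (5) $\frac1B\log_2 d(\mathcal{C}_B,\varepsilon_B)\le\varepsilon_B$. The capacity per unit cost $\boldsymbol{C}(\beta,\rho)$ is the supremum of achievable $\boldsymbol{R}$; $\boldsymbol{C}_{\mathrm{na}}(\beta,\rho)$ and $\boldsymbol{C}_{\mathrm{a}}(\beta,\rho)$ denote the same supremum restricted to non-adaptive, respectively adaptive, sampling strategies. $\boldsymbol{C}(\beta,1)$ is the full-sampling capacity per unit cost.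 **The reference length $n^*_B$.** It is known from earlier work that $$\boldsymbol{C}(\beta,1)=\max_X\min\left\{\frac{I(X;Y)}{\mathbb{E}[k(X)]},\ \frac{I(X;Y)+D(Y\|Y_\star)}{\mathbb{E}[k(X)](1+\beta)}\right\},$$ the maximum being over input distributions $P_X$ on $\mathcal{X}$, with $(X,Y)\sim P_X(\cdot)Q(\cdot|\cdot)$, $Y_\star\sim Q(\cdot|\star)$, $I$ mutual information and $D(Y\|Y_\star)$ the Kullback–Leibler divergence between the laws of $Y$ and $Y_\star$. Let $\mathcal{P}$ be the set of $X$ attaining this maximum and $$n^*_B=\min_{X\in\mathcal{P}}\frac{B}{\boldsymbol{C}(\beta,1)\,\mathbb{E}[k(X)]}.$$ It is understood that $n_B^*$ is well defined (the maximum and minimum are attained, and $\boldsymbol{C}(\beta,1)$ is positive and finite). *)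

theory Defs
  imports "HOL-Probability.Probability" "HOL-Library.Landau_Symbols"
begin

text \<open>
  Asynchronous communication with an output-sampling constraint. \<open>inputs\<close> is the set of
  codeword symbols; the idle symbol may or may not belong to it. All logarithms are binary.
\<close>

record ('a, 'y) channel =
  inputs :: "'a set"
  idle :: 'a
  trans :: "'a \<Rightarrow> 'y pmf"
  symbol_cost :: "'a \<Rightarrow> ennreal"

definition async_channel :: "('a::finite, 'y::finite) channel \<Rightarrow> bool" where
  "async_channel W \<longleftrightarrow>
     (\<forall>y. \<exists>x\<in>insert (idle W) (inputs W). pmf (trans W x) y > 0) \<and>
     (idle W \<in> inputs W \<longrightarrow> symbol_cost W (idle W) = 0) \<and>
     (\<forall>x\<in>inputs W. x \<noteq> idle W \<longrightarrow> symbol_cost W x > 0)"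

text \<open>
  A sampling strategy, for a fixed outcome of the receiver's private randomness, maps the output
  sequence \<open>y 1, y 2, \<dots>\<close> to the list \<open>[S\<^sub>1, \<dots>, S\<^sub>\<ell>]\<close> of sampling times.
  A stopping rule says, from the list of samples seen so far, whether to stop.
\<close>

type_synonym 'y sampler = "(nat \<Rightarrow> 'y) \<Rightarrow> nat list"
type_synonym 'y stopping_rule = "'y list \<Rightarrow> bool"

definition nonadaptive_sampler :: "'y sampler \<Rightarrow> bool" where
  "nonadaptive_sampler S \<longleftrightarrow> (\<forall>y y'. S y = S y')"

text \<open>
  One function \<open>g\<close> on lists represents the whole family \<open>g\<^sub>j\<close>, since the length of its
  argument is \<open>j - 1\<close>; the first time \<open>g []\<close> does not depend on the outputs.
\<close>

definition adaptive_sampler :: "'y sampler \<Rightarrow> bool" where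
  "adaptive_sampler S \<longleftrightarrow>
     (\<exists>g. \<forall>y. \<forall>j<length (S y). S y ! j = g (map y (take j (S y))))"

lemma nonadaptive_imp_adaptive:
  assumes "nonadaptive_sampler S"
  shows "adaptive_sampler S"
proof -
  have "S y ! j = S undefined ! length (map y (take j (S y)))" if "j < length (S y)" for y j
    using assms that unfolding nonadaptive_sampler_def by (metis length_map length_take less_imp_le min.absorb2)
  then show ?thesis
    unfolding adaptive_sampler_def by (intro exI[of _ "\<lambda>h. S undefined ! length h"]) blast
qed

text \<open>
  The private randomness of the receiver is a distribution on pairs of a (deterministic) sampling
  strategy and a (deterministic) stopping rule, drawn independently of message, arrival time and
  channel. Horizon and alphabets being finite, discrete distributions lose no generality.
  The field \<open>arrivals\<close> is the size \<open>A\<close> of the arrival window.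
\<close>

record ('a, 'y) code =
  bits :: nat
  arrivals :: nat
  blocklength :: nat
  codeword :: "nat \<Rightarrow> nat \<Rightarrow> 'a"
  start_time :: "nat \<Rightarrow> nat \<Rightarrow> nat"
  receiver :: "('y sampler \<times> 'y stopping_rule) pmf"
  decoder :: "'y list \<Rightarrow> nat"

abbreviation messages :: "('a, 'y) code \<Rightarrow> nat set" where
  "messages C \<equiv> {1..2 ^ bits C}"

definition horizon :: "('a, 'y) code \<Rightarrow> nat" where
  "horizon C = arrivals C + blocklength C - 1"

definition adaptive_code :: "('a, 'y) code \<Rightarrow> bool" where
  "adaptive_code C \<longleftrightarrow> (\<forall>(S, stp)\<in>set_pmf (receiver C). adaptive_sampler S)"

definition nonadaptive_code :: "('a, 'y) code \<Rightarrow> bool" where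
  "nonadaptive_code C \<longleftrightarrow> (\<forall>(S, stp)\<in>set_pmf (receiver C). nonadaptive_sampler S)"

fun num_samples :: "'y sampler \<times> 'y stopping_rule \<Rightarrow> (nat \<Rightarrow> 'y) \<Rightarrow> nat" where
  "num_samples (S, stp) y = (LEAST j. 1 \<le> j \<and> stp (map y (take j (S y))))"

fun decision_time :: "'y sampler \<times> 'y stopping_rule \<Rightarrow> (nat \<Rightarrow> 'y) \<Rightarrow> nat" where
  "decision_time (S, stp) y = S y ! (num_samples (S, stp) y - 1)"

fun observed :: "'y sampler \<times> 'y stopping_rule \<Rightarrow> (nat \<Rightarrow> 'y) \<Rightarrow> 'y list" where
  "observed (S, stp) y = map y (take (num_samples (S, stp) y) (S y))"

definition valid_receiver :: "nat \<Rightarrow> 'y sampler \<times> 'y stopping_rule \<Rightarrow> bool" where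
  "valid_receiver N = (\<lambda>(S, stp). \<forall>y.
     sorted_wrt (<) (S y) \<and> set (S y) \<subseteq> {1..N} \<and>
     (\<exists>j\<in>{1..length (S y)}. stp (map y (take j (S y)))))"

definition valid_code :: "('a, 'y) channel \<Rightarrow> ('a, 'y) code \<Rightarrow> bool" where
  "valid_code W C \<longleftrightarrow>
     bits C \<ge> 1 \<and> arrivals C \<ge> 1 \<and> blocklength C \<ge> 1 \<and>
     (\<forall>m\<in>messages C. \<forall>i\<in>{1..blocklength C}. codeword C m i \<in> inputs W) \<and>
     (\<forall>m\<in>messages C. \<forall>t\<in>{1..arrivals C}. start_time C t m \<in> {t..arrivals C}) \<and>
     (\<forall>r\<in>set_pmf (receiver C). valid_receiver (horizon C) r) \<and>
     range (decoder C) \<subseteq> messages C"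

definition channel_input :: "('a, 'y) channel \<Rightarrow> ('a, 'y) code \<Rightarrow> nat \<Rightarrow> nat \<Rightarrow> nat \<Rightarrow> 'a" where
  "channel_input W C m t i = (let s = start_time C t m in
     if s \<le> i \<and> i \<le> s + blocklength C - 1 then codeword C m (i - s + 1) else idle W)"

definition output_pmf :: "('a, 'y) channel \<Rightarrow> ('a, 'y) code \<Rightarrow> nat \<Rightarrow> nat \<Rightarrow> (nat \<Rightarrow> 'y) pmf" where
  "output_pmf W C m t =
     Pi_pmf {1..horizon C} undefined (\<lambda>i. trans W (channel_input W C m t i))"

text \<open>
  The probability, given the message \<open>m\<close>, of an event that may depend on the arrival time
  \<open>t\<close>, the outputs \<open>y\<close> and the private randomness \<open>r\<close>.
\<close>

definition msg_prob :: "('a, 'y) channel \<Rightarrow> ('a, 'y) code \<Rightarrow> nat \<Rightarrow>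
    (nat \<Rightarrow> (nat \<Rightarrow> 'y) \<Rightarrow> 'y sampler \<times> 'y stopping_rule \<Rightarrow> bool) \<Rightarrow> real" where
  "msg_prob W C m E =
     (\<Sum>t=1..arrivals C.
        measure_pmf.prob (pair_pmf (output_pmf W C m t) (receiver C)) {(y, r). E t y r})
     / real (arrivals C)"

definition error_prob :: "('a, 'y) channel \<Rightarrow> ('a, 'y) code \<Rightarrow> real" where
  "error_prob W C =
     (MAX m\<in>messages C. msg_prob W C m (\<lambda>t y r. decoder C (observed r y) \<noteq> m))"

definition code_cost :: "('a, 'y) channel \<Rightarrow> ('a, 'y) code \<Rightarrow> ennreal" where
  "code_cost W C =
     (MAX m\<in>messages C. \<Sum>i=1..blocklength C. symbol_cost W (codeword C m i))"

definition sampling_frequency :: "('a, 'y) channel \<Rightarrow> ('a, 'y) code \<Rightarrow> real \<Rightarrow> real" where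
  "sampling_frequency W C \<epsilon> = Inf {q. q \<ge> 0 \<and>
     (MIN m\<in>messages C. msg_prob W C m
        (\<lambda>t y r. real (num_samples r y) / real (decision_time r y) \<le> q)) \<ge> 1 - \<epsilon>}"

text \<open>The integers below have a least element as soon as \<open>\<epsilon> < 1\<close>.\<close>

definition delay :: "('a, 'y) channel \<Rightarrow> ('a, 'y) code \<Rightarrow> real \<Rightarrow> int" where
  "delay W C \<epsilon> = (LEAST l.
     (MIN m\<in>messages C. msg_prob W C m
        (\<lambda>t y r. int (decision_time r y) - int t \<le> l - 1)) \<ge> 1 - \<epsilon>)"

text \<open>
  \<open>2 powr (\<beta> * B)\<close> need not be an integer, so the window size is rounded up.
\<close>

definition achieves :: "('a, 'y) channel \<Rightarrow> real \<Rightarrow> real \<Rightarrow> ennreal \<Rightarrow>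
    (nat \<Rightarrow> ('a, 'y) code) \<Rightarrow> (nat \<Rightarrow> real) \<Rightarrow> bool" where
  "achieves W \<beta> \<rho> R \<C> \<epsilon> \<longleftrightarrow>
     (\<forall>B. \<epsilon> B > 0) \<and> \<epsilon> \<longlonglongrightarrow> 0 \<and>
     (\<forall>\<^sub>F B in sequentially.
        valid_code W (\<C> B) \<and> bits (\<C> B) = B \<and>
        arrivals (\<C> B) = nat \<lceil>2 powr (\<beta> * real B)\<rceil> \<and>
        error_prob W (\<C> B) \<le> \<epsilon> B \<and>
        of_nat B / code_cost W (\<C> B) \<ge> R - ennreal (\<epsilon> B) \<and>
        sampling_frequency W (\<C> B) (\<epsilon> B) \<le> \<rho> + \<epsilon> B \<and>
        log 2 (real_of_int (delay W (\<C> B) (\<epsilon> B))) / real B \<le> \<epsilon> B)"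

definition restricted_capacity :: "(('a, 'y) code \<Rightarrow> bool) \<Rightarrow> ('a, 'y) channel \<Rightarrow>
    real \<Rightarrow> real \<Rightarrow> ennreal" where
  "restricted_capacity cls W \<beta> \<rho> =
     Sup {R. \<exists>\<C> \<epsilon>. (\<forall>B. cls (\<C> B)) \<and> achieves W \<beta> \<rho> R \<C> \<epsilon>}"

definition adaptive_capacity :: "('a, 'y) channel \<Rightarrow> real \<Rightarrow> real \<Rightarrow> ennreal" where
  "adaptive_capacity = restricted_capacity adaptive_code"

text \<open>
  Without restriction the sampling strategy may be of either kind; samplers that look at outputs
  they have not sampled are never admissible.
\<close>

definition capacity :: "('a, 'y) channel \<Rightarrow> real \<Rightarrow> real \<Rightarrow> ennreal" where
  "capacity = restricted_capacity (\<lambda>C. nonadaptive_code C \<or> adaptive_code C)"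

definition joint_pmf :: "('a, 'y) channel \<Rightarrow> 'a pmf \<Rightarrow> ('a \<times> 'y) pmf" where
  "joint_pmf W P = bind_pmf P (\<lambda>x. map_pmf (Pair x) (trans W x))"

definition mutual_info :: "('a, 'y) channel \<Rightarrow> 'a pmf \<Rightarrow> real" where
  "mutual_info W P = prob_space.mutual_information (measure_pmf (joint_pmf W P)) 2
     (count_space UNIV) (count_space UNIV) fst snd"

text \<open>
  The divergence \<open>D(p \<parallel> q)\<close>. The library's \<open>KL_divergence b M N\<close> is the divergence of
  \<open>N\<close> from the reference measure \<open>M\<close>, meaningful only if \<open>N\<close> is absolutely continuous
  with respect to \<open>M\<close>.
\<close>

definition divergence :: "'y pmf \<Rightarrow> 'y pmf \<Rightarrow> ennreal" where
  "divergence p q =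
     (if set_pmf p \<subseteq> set_pmf q
      then ennreal (KL_divergence 2 (measure_pmf q) (measure_pmf p)) else \<infinity>)"

definition expected_cost :: "('a, 'y) channel \<Rightarrow> 'a pmf \<Rightarrow> ennreal" where
  "expected_cost W P = (\<integral>\<^sup>+ x. symbol_cost W x \<partial>measure_pmf P)"

text \<open>
  In \<^typ>\<open>ennreal\<close> the degenerate quotients \<open>0 / 0\<close> and \<open>\<infinity> / \<infinity>\<close> are \<open>0\<close>.
  The former arises only for the input that is constantly idle.
\<close>

definition rate_bound :: "('a, 'y) channel \<Rightarrow> real \<Rightarrow> 'a pmf \<Rightarrow> ennreal" where
  "rate_bound W \<beta> P = min
     (ennreal (mutual_info W P) / expected_cost W P)
     ((ennreal (mutual_info W P) + divergence (map_pmf snd (joint_pmf W P)) (trans W (idle W)))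
        / (expected_cost W P * ennreal (1 + \<beta>)))"

definition optimal_inputs :: "('a, 'y) channel \<Rightarrow> real \<Rightarrow> 'a pmf set" where
  "optimal_inputs W \<beta> =
     {P. is_arg_max (rate_bound W \<beta>) (\<lambda>P. set_pmf P \<subseteq> inputs W) P}"

definition ref_length_at :: "('a, 'y) channel \<Rightarrow> real \<Rightarrow> nat \<Rightarrow> 'a pmf \<Rightarrow> ennreal" where
  "ref_length_at W \<beta> B P = of_nat B / (capacity W \<beta> 1 * expected_cost W P)"

definition ref_length :: "('a, 'y) channel \<Rightarrow> real \<Rightarrow> nat \<Rightarrow> ennreal" where
  "ref_length W \<beta> B = (INF P\<in>optimal_inputs W \<beta>. ref_length_at W \<beta> B P)"

text \<open>
  Both extrema defining the reference length are attained (an attained minimum over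
  \<open>optimal_inputs\<close> makes that set nonempty), and the capacity is positive and finite.
\<close>

definition ref_length_well_defined :: "('a, 'y) channel \<Rightarrow> real \<Rightarrow> bool" where
  "ref_length_well_defined W \<beta> \<longleftrightarrow>
     0 < capacity W \<beta> 1 \<and> capacity W \<beta> 1 < \<infinity> \<and>
     (\<forall>B\<ge>1. \<exists>P\<in>optimal_inputs W \<beta>. ref_length W \<beta> B = ref_length_at W \<beta> B P)"

end

(* Both capacities equal the largest single-letter rate, the maximum over input laws P of
   min (I / E k, (I + D) / ((1 + beta) E k)).

   Converse: let P be the average letter of the codebook. Given message m and arrival time t, compare
   the law of the outputs with a product law that ignores m (output law of P on the transmission
   window) or ignores both m and t (pure noise). The events "m is decoded within the delay d of t"
   are almost certain under the true laws, but their probabilities under the reference laws add up to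
   at most d + 1 (over m) and d (over m and t). A change of measure turns this into lower bounds
   B (1 - o(1)) and (1 + beta) B (1 - o(1)) for n I and n (I + D). Letting the transmitter choose the
   starting time costs only log (d + 1) bits.

   Achievability: put a short preamble of a letter x0 that is distinguishable from noise in front of
   random codewords of length about B / (R E k). The receiver probes a vanishing fraction of the
   outputs for the preamble and samples densely only after a positive probe. False alarms are so rare
   that dense sampling does not count, and missing the preamble is unlikely, so after a further slack
   that is linear in B with arbitrarily small slope the full-sampling decoder applies. *)

theory Submission
  imports Defs "HOL-Probability.Hoeffding" "HOL-Real_Asymp.Real_Asymp"
begin

section \<open>Product distributions\<close>

text \<open>In the converse the logarithm of the Donsker-Varadhan inequality is replaced by its
  tangent at 2. The bound is then linear in the reference probability, so it can be summed over
  messages and arrival times without Jensen's inequality; with the exponent chosen so that the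
  reference term averages to at most 1, the loss is exactly one bit. No limit of letter laws is
  taken: each code is compared with the supremum at its own average letter.

  In the direct part the delay is controlled from both sides, so an early decision counts as a
  failure even if the message is right. Shifts of the sent codeword by fewer than \<open>n2\<close>
  letters are tolerated, because they move the delay by less than \<open>n2\<close>; larger shifts
  are refused because the last \<open>n2\<close> letters are independent of the letters that
  produced the outputs compared with them. Probes of width about sqrt B at distance about \<eta> B
  make both the probed fraction and the false alarm probability vanish. Since error and cost are
  maxima over messages, an average over random codebooks is not enough and the codebook is
  expurgated.\<close>

abbreviation mean :: "'b pmf \<Rightarrow> ('b \<Rightarrow> real) \<Rightarrow> real" where
  "mean p \<equiv> lebesgue_integral (measure_pmf p)"

abbreviation Pr :: "'b pmf \<Rightarrow> 'b set \<Rightarrow> real" where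
  "Pr p \<equiv> measure (measure_pmf p)"

lemma prob_Un_le: "Pr p (A \<union> B) \<le> Pr p A + Pr p B"
  by (rule measure_Un_le) auto

lemma finite_set_Pi_pmf:
  assumes "finite A" "\<And>i. i \<in> A \<Longrightarrow> finite (set_pmf (p i))"
  shows "finite (set_pmf (Pi_pmf A d p))"
  using assms by (auto simp: set_Pi_pmf intro!: finite_PiE_dflt)

lemma pmf_markov:
  assumes "finite (set_pmf p)" "\<And>x. x \<in> set_pmf p \<Longrightarrow> 0 \<le> f x" "0 < (a::real)"
  shows "Pr p {x. a \<le> f x} \<le> mean p f / a"
  using integral_Markov_inequality_measure[of "measure_pmf p" f UNIV a] assms
  by (auto simp: AE_measure_pmf_iff integrable_measure_pmf_finite)

text \<open>Independence turns the mean of the product into a product of means. The false acceptance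
  bounds below use it with factors of mean at most 1, possibly after averaging over the
  codebook.\<close>

lemma Pi_pmf_markov_prod:
  assumes "finite A" "J \<subseteq> A" "\<And>i. i \<in> A \<Longrightarrow> finite (set_pmf (p i))"
    and nonneg: "\<And>i x. i \<in> J \<Longrightarrow> 0 \<le> f i x" and a: "0 < (a::real)"
  shows "Pr (Pi_pmf A d p) {y. a \<le> (\<Prod>i\<in>J. f i (y i))}
           \<le> (\<Prod>i\<in>J. mean (p i) (f i)) / a"
proof -
  have eq: "(\<Prod>i\<in>A. if i \<in> J then f i (y i) else 1) = (\<Prod>i\<in>J. f i (y i))" for y
    using assms(1,2) by (simp add: prod.If_cases Int_absorb1)
  have "mean (Pi_pmf A d p) (\<lambda>y. \<Prod>i\<in>A. (if i \<in> J then f i (y i) else 1))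
      = (\<Prod>i\<in>A. mean (p i) (\<lambda>x. if i \<in> J then f i x else 1))"
    using assms by (intro expectation_prod_Pi_pmf integrable_measure_pmf_finite) auto
  also have "\<dots> = (\<Prod>i\<in>A. if i \<in> J then mean (p i) (f i) else 1)"
    by (intro prod.cong) auto
  also have "\<dots> = (\<Prod>i\<in>J. mean (p i) (f i))"
    using assms(1,2) by (simp add: prod.If_cases Int_absorb1)
  finally have "mean (Pi_pmf A d p) (\<lambda>y. \<Prod>i\<in>J. f i (y i))
      = (\<Prod>i\<in>J. mean (p i) (f i))"
    by (simp add: eq)
  moreover have "Pr (Pi_pmf A d p) {y. a \<le> (\<Prod>i\<in>J. f i (y i))}
     \<le> mean (Pi_pmf A d p) (\<lambda>y. \<Prod>i\<in>J. f i (y i)) / a"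
    using assms by (intro pmf_markov finite_set_Pi_pmf prod_nonneg) auto
  ultimately show ?thesis by simp
qed

lemma expectation_Pi_pmf_restrict:
  assumes "finite A" "A' \<subseteq> A" "\<And>y y'. (\<And>i. i \<in> A' \<Longrightarrow> y i = y' i) \<Longrightarrow> e y = e y'"
  shows "mean (Pi_pmf A d p) e = (mean (Pi_pmf A' d p) e :: real)"
proof -
  have "mean (Pi_pmf A' d p) e
      = mean (Pi_pmf A d p) (\<lambda>f. e (\<lambda>x. if x \<in> A' then f x else d))"
    using assms(1,2) by (subst Pi_pmf_subset[of A A']) auto
  also have "(\<lambda>f. e (\<lambda>x. if x \<in> A' then f x else d)) = e"
    by (intro ext assms(3)) auto
  finally show ?thesis by simp
qed

lemma expectation_Pi_pmf_local:
  assumes "finite A" "A' \<subseteq> A" "\<And>y y'. (\<And>i. i \<in> A' \<Longrightarrow> y i = y' i) \<Longrightarrow> e y = e y'"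
    and "\<And>i. i \<in> A' \<Longrightarrow> p i = q i"
  shows "mean (Pi_pmf A d p) e = (mean (Pi_pmf A d q) e :: real)"
proof -
  have "Pi_pmf A' d p = Pi_pmf A' d q"
    using assms finite_subset by (intro Pi_pmf_cong) auto
  then show ?thesis
    using expectation_Pi_pmf_restrict[OF assms(1-3), where d = d and p = p]
      expectation_Pi_pmf_restrict[OF assms(1-3), where d = d and p = q] by simp
qed

lemma expectation_Pi_pmf_component:
  assumes "finite A" "i \<in> A"
  shows "mean (Pi_pmf A d p) (\<lambda>y. f (y i)) = (mean (p i) f :: real)"
proof -
  have "mean (map_pmf (\<lambda>y. y i) (Pi_pmf A d p)) f = mean (p i) f"
    using assms by (simp only: Pi_pmf_component if_True)
  then show ?thesis by simp
qed

lemma Pi_pmf_tails: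
  fixes f :: "'i \<Rightarrow> 'b \<Rightarrow> real"
  assumes A: "finite A" "J \<subseteq> A" "J \<noteq> {}" and c: "0 < c" "0 \<le> a"
    and bd: "\<And>i x. i \<in> J \<Longrightarrow> x \<in> set_pmf (p i) \<Longrightarrow> \<bar>f i x\<bar> \<le> c"
  shows "Pr (Pi_pmf A d p)
           {y. (\<Sum>i\<in>J. f i (y i)) \<le> (\<Sum>i\<in>J. mean (p i) (f i)) - a}
         \<le> exp (- (a\<^sup>2 / (2 * c\<^sup>2 * card J)))" (is ?le)
    and "Pr (Pi_pmf A d p)
           {y. (\<Sum>i\<in>J. f i (y i)) \<ge> (\<Sum>i\<in>J. mean (p i) (f i)) + a}
         \<le> exp (- (a\<^sup>2 / (2 * c\<^sup>2 * card J)))" (is ?ge)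
proof -
  have fJ: "finite J" using A finite_subset by blast
  let ?M = "measure_pmf (Pi_pmf A d p)"
  have ind: "prob_space.indep_vars ?M (\<lambda>_. count_space UNIV) (\<lambda>x f. f x) J"
    using prob_space.indep_vars_subset[OF measure_pmf.prob_space_axioms indep_vars_Pi_pmf[OF A(1)] A(2)] .
  interpret H: Hoeffding_ineq ?M J "\<lambda>i y. f i (y i)" "\<lambda>_. -c" "\<lambda>_. c"
    "\<Sum>i\<in>J. mean (Pi_pmf A d p) (\<lambda>y. f i (y i))"
  proof (unfold_locales, rule fJ)
    show "prob_space.indep_vars ?M (\<lambda>_. borel) (\<lambda>i y. f i (y i)) J"
      using prob_space.indep_vars_compose2[OF measure_pmf.prob_space_axioms ind, of f "\<lambda>_. borel"] by simp
    fix i assume i: "i \<in> J"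
    have "f i (y i) \<in> {-c..c}" if "y \<in> set_pmf (Pi_pmf A d p)" for y
    proof -
      have "y i \<in> set_pmf (p i)"
        using that A i by (auto simp: set_Pi_pmf PiE_dflt_def)
      from bd[OF i this] show ?thesis by auto
    qed
    then show "AE x in ?M. f i (x i) \<in> {-c..c}"
      by (simp add: AE_measure_pmf_iff)
  qed
  have mu: "(\<Sum>i\<in>J. mean (Pi_pmf A d p) (\<lambda>y. f i (y i)))
      = (\<Sum>i\<in>J. mean (p i) (f i))"
    using A by (intro sum.cong refl expectation_Pi_pmf_component) auto
  have sq: "(\<Sum>i\<in>J. (c - - c)\<^sup>2) = 4 * c\<^sup>2 * card J"
    by (simp add: power2_eq_square algebra_simps)
  have pos: "(\<Sum>i\<in>J. (c - - c)\<^sup>2) > 0"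
    unfolding sq using fJ A(3) c by (simp add: card_gt_0_iff)
  have e: "- 2 * a\<^sup>2 / (4 * c\<^sup>2 * card J) = - (a\<^sup>2 / (2 * c\<^sup>2 * card J))"
    by (simp add: field_simps)
  show ?le using H.Hoeffding_ineq_le[OF c(2) pos] unfolding mu sq e by simp
  show ?ge using H.Hoeffding_ineq_ge[OF c(2) pos] unfolding mu sq e by simp
qed

text \<open>This is the divergence only if the support of \<open>p\<close> lies in that of
  \<open>q\<close>: elsewhere division by zero and \<open>log 2 0 = 0\<close> silently drop the
  infinite terms. Hence the support hypotheses throughout.\<close>

definition kl :: "'b pmf \<Rightarrow> 'b pmf \<Rightarrow> real" where
  "kl p q = mean p (\<lambda>y. log 2 (pmf p y / pmf q y))"

lemma kl_same [simp]: "kl p p = 0"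
proof -
  have "kl p p = mean p (\<lambda>y. 0)"
    unfolding kl_def by (intro integral_cong_AE) (auto simp: AE_measure_pmf_iff set_pmf_eq)
  then show ?thesis by simp
qed

lemma kl_Pi_pmf:
  assumes A: "finite A" "\<And>i. i \<in> A \<Longrightarrow> finite (set_pmf (p i))"
    and ac: "\<And>i. i \<in> A \<Longrightarrow> set_pmf (p i) \<subseteq> set_pmf (q i)"
  shows "kl (Pi_pmf A d p) (Pi_pmf A d q) = (\<Sum>i\<in>A. kl (p i) (q i))"
proof -
  let ?f = "\<lambda>i y. log 2 (pmf (p i) y / pmf (q i) y)"
  have "log 2 (pmf (Pi_pmf A d p) y / pmf (Pi_pmf A d q) y) = (\<Sum>i\<in>A. ?f i (y i))"
    if y: "y \<in> set_pmf (Pi_pmf A d p)" for y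
  proof -
    have 1: "\<forall>x. x \<notin> A \<longrightarrow> y x = d" and 2: "\<And>i. i \<in> A \<Longrightarrow> y i \<in> set_pmf (p i)"
      using y A(1) by (auto simp: set_Pi_pmf PiE_dflt_def)
    have pos: "pmf (p i) (y i) > 0 \<and> pmf (q i) (y i) > 0" if "i \<in> A" for i
      using 2[OF that] ac[OF that] by (auto simp: pmf_positive)
    have "log 2 (\<Prod>i\<in>A. pmf (p i) (y i) / pmf (q i) (y i)) = (\<Sum>i\<in>A. ?f i (y i))"
      using pos A(1) by (subst log_def, subst ln_prod) (fastforce simp: log_def sum_divide_distrib)+
    then show ?thesis
      using 1 A(1) by (simp add: pmf_Pi prod_dividef)
  qed
  then have "kl (Pi_pmf A d p) (Pi_pmf A d q) = mean (Pi_pmf A d p) (\<lambda>y. \<Sum>i\<in>A. ?f i (y i))"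
    unfolding kl_def by (intro integral_cong_AE) (auto simp: AE_measure_pmf_iff)
  also have "\<dots> = (\<Sum>i\<in>A. mean (Pi_pmf A d p) (\<lambda>y. ?f i (y i)))"
    using assms by (intro Bochner_Integration.integral_sum integrable_measure_pmf_finite finite_set_Pi_pmf) auto
  also have "\<dots> = (\<Sum>i\<in>A. kl (p i) (q i))"
    unfolding kl_def using A by (intro sum.cong refl expectation_Pi_pmf_component) auto
  finally show ?thesis .
qed

text \<open>
  A linearised form of the Donsker--Varadhan inequality: \<open>ln z \<le> z / 2 + ln 2 - 1\<close> replaces the
  logarithm of the exponential moment.
\<close>

lemma change_of_measure:
  fixes e :: "'b \<Rightarrow> real"
  assumes fin: "finite (set_pmf q)" and ac: "set_pmf p \<subseteq> set_pmf q"
    and e: "\<And>y. 0 \<le> e y" "\<And>y. e y \<le> 1"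
  shows "L * mean p e
     \<le> kl p q + ((1 + 2 powr L * mean q e) / 2 + ln 2 - 1) / ln 2"
proof -
  let ?S = "set_pmf q"
  have Ep: "mean p f = (\<Sum>y\<in>?S. f y * pmf p y)" for f :: "'b \<Rightarrow> real"
    using ac fin by (intro integral_measure_pmf_real) auto
  have Eq: "mean q f = (\<Sum>y\<in>?S. f y * pmf q y)" for f :: "'b \<Rightarrow> real"
    using fin by (intro integral_measure_pmf_real) auto
  have sp: "(\<Sum>y\<in>?S. pmf p y) = 1"
    using ac fin by (simp add: sum_pmf_eq_1)
  have sq: "(\<Sum>y\<in>?S. pmf q y) = 1"
    using fin by (simp add: sum_pmf_eq_1)
  have pt: "pmf p y * (ln 2 * (L * e y)) - pmf p y * ln (pmf p y / pmf q y)
       \<le> pmf q y * (1 + (2 powr L) * e y) / 2 + pmf p y * (ln 2 - 1)" if y: "y \<in> ?S" for y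
  proof (cases "pmf p y = 0")
    case True
    then show ?thesis using e[of y] by simp
  next
    case False
    then have pp: "pmf p y > 0" by (simp add: pmf_pos)
    have qp: "pmf q y > 0" using y by (simp add: pmf_positive)
    define z where "z = pmf q y * (2 powr (L * e y)) / pmf p y"
    have zp: "z > 0" unfolding z_def using pp qp by simp
    \<comment> \<open>Tangent of \<open>ln\<close> at 2: the mean of \<open>z\<close> is at most 1
      plus the reference term, and \<open>averaged_bound\<close> makes that term average to at most
      1.\<close>
    have "ln (z / 2) \<le> z / 2 - 1" using zp by (intro ln_le_minus_one) auto
    then have lz: "ln z \<le> z / 2 + ln 2 - 1" using zp by (simp add: ln_div)
    have "ln z = ln 2 * (L * e y) - ln (pmf p y / pmf q y)"
      unfolding z_def using pp qp by (simp add: ln_mult ln_div powr_def)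
    then have "pmf p y * (ln 2 * (L * e y)) - pmf p y * ln (pmf p y / pmf q y) = pmf p y * ln z"
      by (simp only: right_diff_distrib)
    also have "\<dots> \<le> pmf p y * (z / 2 + ln 2 - 1)"
      using lz pp by simp
    also have "\<dots> = pmf q y * (2 powr (L * e y)) / 2 + pmf p y * (ln 2 - 1)"
      unfolding z_def using pp by (simp add: field_simps)
    \<comment> \<open>Chord of a convex function over [0, 1], loosened by
      \<open>1 - e y \<le> 1\<close>. It makes the bound depend on the test only through its mean
      under \<open>q\<close>.\<close>
    also have "2 powr (L * e y) \<le> 1 + (2 powr L) * e y"
    proof -
      have "convex_on UNIV (\<lambda>x::real. exp (1 * x))" by (rule convex_on_exp) simp
      then have "exp ((1 - e y) *\<^sub>R 0 + e y *\<^sub>R (L * ln 2)) \<le> (1 - e y) * exp 0 + e y * exp (L * ln 2)"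
        using e[of y] convex_onD[of UNIV "\<lambda>x::real. exp (1 * x)" "e y" 0 "L * ln 2"] by simp
      then have "2 powr (L * e y) \<le> (1 - e y) + e y * 2 powr L"
        by (simp add: powr_def algebra_simps)
      also have "\<dots> \<le> 1 + (2 powr L) * e y" using e[of y] by (simp add: algebra_simps)
      finally show ?thesis .
    qed
    finally show ?thesis using qp by (simp add: mult_left_mono)
  qed
  have "ln 2 * (L * mean p e) - ln 2 * kl p q
      = (\<Sum>y\<in>?S. pmf p y * (ln 2 * (L * e y)) - pmf p y * ln (pmf p y / pmf q y))"
    unfolding kl_def Ep by (simp add: sum_subtractf sum_distrib_left log_def algebra_simps)
  also have "\<dots> \<le> (\<Sum>y\<in>?S. pmf q y * (1 + (2 powr L) * e y) / 2 + pmf p y * (ln 2 - 1))"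
    by (intro sum_mono pt)
  also have "\<dots> = (\<Sum>y\<in>?S. pmf q y * (1 + (2 powr L) * e y)) / 2 + (\<Sum>y\<in>?S. pmf p y) * (ln 2 - 1)"
    by (simp add: sum.distrib sum_divide_distrib sum_distrib_right)
  also have "(\<Sum>y\<in>?S. pmf q y * (1 + (2 powr L) * e y)) = 1 + 2 powr L * mean q e"
    unfolding Eq by (simp add: sum.distrib sum_distrib_left sq distrib_left mult_ac)
  finally have "ln 2 * (L * mean p e - kl p q)
     \<le> (1 + 2 powr L * mean q e) / 2 + ln 2 - 1"
    using sp by (simp add: algebra_simps)
  then have "L * mean p e - kl p q
     \<le> ((1 + 2 powr L * mean q e) / 2 + ln 2 - 1) / ln 2"
    by (subst pos_le_divide_eq) (simp_all add: mult.commute)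
  then show ?thesis by simp
qed

lemma prob_pair_pmf:
  "Pr (pair_pmf p q) {(y, r). E y r}
     = mean p (\<lambda>y. Pr q {r. E y r})"
proof -
  have "emeasure (pair_pmf p q) {(y, r). E y r} = (\<integral>\<^sup>+y. \<integral>\<^sup>+r. indicator {(y, r). E y r} (y, r) \<partial>q \<partial>p)"
    by (subst nn_integral_pair_pmf'[symmetric]) simp
  also have "(\<lambda>y. \<integral>\<^sup>+r. indicator {(y, r). E y r} (y, r) \<partial>q) = (\<lambda>y. emeasure q {r. E y r})"
    by (intro ext, subst nn_integral_indicator[symmetric])
       (auto intro!: nn_integral_cong simp: indicator_def simp del: nn_integral_indicator)
  also have "(\<integral>\<^sup>+y. emeasure q {r. E y r} \<partial>p) = ennreal (mean p (\<lambda>y. Pr q {r. E y r}))"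
    by (simp add: measure_pmf.emeasure_eq_measure)
       (intro nn_integral_eq_integral measure_pmf.integrable_const_bound[where B = 1]; auto)
  finally show ?thesis
    by (simp add: measure_pmf.emeasure_eq_measure)
qed

section \<open>Divergence and mutual information\<close>

lemma kl_nonneg:
  assumes fin: "finite (set_pmf p)" and ac: "set_pmf p \<subseteq> set_pmf q"
  shows "0 \<le> kl p q"
proof -
  have "(\<Sum>y\<in>set_pmf p. pmf p y * (1 - pmf q y / pmf p y))
      \<le> (\<Sum>y\<in>set_pmf p. pmf p y * ln (pmf p y / pmf q y))"
  proof (rule sum_mono, rule mult_left_mono)
    fix y assume y: "y \<in> set_pmf p"
    then have pos: "pmf p y > 0" "pmf q y > 0" using ac by (auto simp: pmf_positive)
    then have "ln (pmf q y / pmf p y) \<le> pmf q y / pmf p y - 1"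
      by (intro ln_le_minus_one) auto
    then show "1 - pmf q y / pmf p y \<le> ln (pmf p y / pmf q y)"
      using pos by (simp add: ln_div)
  qed simp
  moreover have "(\<Sum>y\<in>set_pmf p. pmf p y * (1 - pmf q y / pmf p y))
      = (\<Sum>y\<in>set_pmf p. pmf p y - pmf q y)"
    by (intro sum.cong) (auto simp: set_pmf_eq algebra_simps)
  moreover have "\<dots> = 1 - Pr q (set_pmf p)"
    using fin by (simp add: sum_subtractf sum_pmf_eq_1 measure_measure_pmf_finite)
  moreover have "\<dots> \<ge> 0" by simp
  ultimately have "0 \<le> (\<Sum>y\<in>set_pmf p. pmf p y * ln (pmf p y / pmf q y))" by linarith
  also have "\<dots> = ln 2 * kl p q"
    unfolding kl_def using fin
    by (subst integral_measure_pmf_real[of "set_pmf p"]) (auto simp: log_def sum_distrib_left mult_ac)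
  finally show ?thesis by (simp add: zero_le_mult_iff)
qed

definition output_law :: "('a, 'y) channel \<Rightarrow> 'a pmf \<Rightarrow> 'y pmf" where
  "output_law W P = bind_pmf P (trans W)"

lemma map_fst_joint [simp]: "map_pmf fst (joint_pmf W P) = P"
  by (simp add: joint_pmf_def map_bind_pmf pmf.map_comp o_def bind_return_pmf' map_pmf_const)

lemma map_snd_joint [simp]: "map_pmf snd (joint_pmf W P) = output_law W P"
  by (simp add: joint_pmf_def output_law_def map_bind_pmf pmf.map_comp o_def)

lemma pmf_joint:
  fixes W :: "('a::finite, 'y::finite) channel"
  shows "pmf (joint_pmf W P) (x, y) = pmf P x * pmf (trans W x) y"
proof -
  have "pmf (joint_pmf W P) (x, y) = (\<Sum>x'\<in>UNIV. pmf (map_pmf (Pair x') (trans W x')) (x, y) * pmf P x')"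
    unfolding joint_pmf_def pmf_bind by (subst integral_measure_pmf_real[of UNIV]) auto
  also have "\<dots> = (\<Sum>x'\<in>UNIV. if x' = x then pmf (trans W x) y * pmf P x else 0)"
  proof (intro sum.cong refl)
    fix x'
    show "pmf (map_pmf (Pair x') (trans W x')) (x, y) * pmf P x' = (if x' = x then pmf (trans W x) y * pmf P x else 0)"
    proof (cases "x' = x")
      case True
      then show ?thesis by (simp add: pmf_map_inj' inj_def)
    next
      case False
      then have "(x, y) \<notin> set_pmf (map_pmf (Pair x') (trans W x'))" by auto
      then show ?thesis using False by (simp only: set_pmf_iff) simp
    qed
  qed
  also have "\<dots> = pmf P x * pmf (trans W x) y" by simp
  finally show ?thesis .
qed

lemma pmf_output_law:
  fixes W :: "('a::finite, 'y::finite) channel"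
  shows "pmf (output_law W P) y = (\<Sum>x\<in>UNIV. pmf P x * pmf (trans W x) y)"
  unfolding output_law_def pmf_bind by (subst integral_measure_pmf_real[of UNIV]) (auto simp: mult.commute)

lemma set_output_law: "x \<in> set_pmf P \<Longrightarrow> set_pmf (trans W x) \<subseteq> set_pmf (output_law W P)"
  by (auto simp: output_law_def)

text \<open>The form in which the change of measure delivers the mutual information: one divergence
  per transmitted letter, averaged over the letter law.\<close>

lemma mutual_info_eq:
  fixes W :: "('a::finite, 'y::finite) channel"
  shows "mutual_info W P = mean P (\<lambda>x. kl (trans W x) (output_law W P))"
proof -
  let ?J = "joint_pmf W P"
  interpret information_space "measure_pmf ?J" 2
    by unfold_locales auto
  have sd: "simple_distributed (measure_pmf ?J) f (pmf (map_pmf f ?J))" for f :: "'a \<times> 'y \<Rightarrow> 'c::finite"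
    by (rule prob_space.simple_distributedI[OF measure_pmf.prob_space_axioms]) (auto simp: simple_function_def pmf_map vimage_def intro!: arg_cong2[where f = measure])
  have ran: "fst ` UNIV = (UNIV :: 'a set)" "snd ` UNIV = (UNIV :: 'y set)" by auto
  have "mutual_info W P = (\<Sum>(x, y)\<in>UNIV. pmf ?J (x, y) * log 2 (pmf ?J (x, y) / (pmf P x * pmf (output_law W P) y)))"
    using mutual_information_simple_distributed[OF sd[of fst] sd[of snd] sd[of "\<lambda>x. (fst x, snd x)"]]
    by (simp add: mutual_info_def ran)
  also have "\<dots> = (\<Sum>x\<in>UNIV. \<Sum>y\<in>UNIV. pmf ?J (x, y) * log 2 (pmf ?J (x, y) / (pmf P x * pmf (output_law W P) y)))"
    by (subst sum.cartesian_product) auto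
  also have "\<dots> = (\<Sum>x\<in>UNIV. pmf P x * (\<Sum>y\<in>UNIV. pmf (trans W x) y * log 2 (pmf (trans W x) y / pmf (output_law W P) y)))"
  proof (intro sum.cong refl)
    fix x
    show "(\<Sum>y\<in>UNIV. pmf ?J (x, y) * log 2 (pmf ?J (x, y) / (pmf P x * pmf (output_law W P) y))) =
         pmf P x * (\<Sum>y\<in>UNIV. pmf (trans W x) y * log 2 (pmf (trans W x) y / pmf (output_law W P) y))"
      by (cases "pmf P x = 0") (auto simp: pmf_joint sum_distrib_left mult.assoc)
  qed
  also have "\<dots> = mean P (\<lambda>x. kl (trans W x) (output_law W P))"
    unfolding kl_def
    by (subst integral_measure_pmf_real[of UNIV], simp, simp, rule sum.cong, simp,
        subst integral_measure_pmf_real[of UNIV]) (auto simp: mult.commute sum_distrib_left)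
  finally show ?thesis .
qed

lemma KL_divergence_pmf:
  fixes p q :: "'y::finite pmf"
  assumes ac: "set_pmf p \<subseteq> set_pmf q"
  shows "KL_divergence 2 (measure_pmf q) (measure_pmf p) = kl p q"
proof -
  interpret sigma_finite_measure "count_space (UNIV :: 'y set)"
    by (rule sigma_finite_measure_count_space)
  have "KL_divergence 2 (density (count_space UNIV) (\<lambda>x. ennreal (pmf q x))) (density (count_space UNIV) (\<lambda>x. ennreal (pmf p x)))
      = (\<integral>x. pmf p x * log 2 (pmf p x / pmf q x) \<partial>count_space UNIV)"
    using ac by (intro KL_density_density) (auto simp: AE_count_space pmf_eq_0_set_pmf)
  also have "\<dots> = kl p q"
    unfolding kl_def by (subst integral_measure_pmf_real[of UNIV]) (auto simp: lebesgue_integral_count_space_finite mult.commute)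
  finally show ?thesis by (simp flip: measure_pmf_eq_density)
qed

lemma divergence_eq:
  fixes p q :: "'y::finite pmf"
  shows "divergence p q = (if set_pmf p \<subseteq> set_pmf q then ennreal (kl p q) else \<infinity>)"
  by (simp add: divergence_def KL_divergence_pmf)

lemma expectation_finite:
  fixes P :: "'a::finite pmf" and f :: "'a \<Rightarrow> real"
  shows "mean P f = (\<Sum>x\<in>UNIV. pmf P x * f x)"
  by (subst integral_measure_pmf_real[of UNIV]) (auto simp: mult.commute)

text \<open>Split the log ratio at the output law. With the idle law as \<open>q\<close> this
  identifies I + D, the numerator of the second constraint, with the mean divergence of a letter
  from noise.\<close>

lemma compensation_identity:
  fixes W :: "('a::finite, 'y::finite) channel"
  assumes ac: "set_pmf (output_law W P) \<subseteq> set_pmf q"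
  shows "mean P (\<lambda>x. kl (trans W x) q) = mutual_info W P + kl (output_law W P) q"
proof -
  let ?o = "output_law W P"
  have "pmf P x * kl (trans W x) q - pmf P x * kl (trans W x) ?o
      = (\<Sum>y\<in>UNIV. pmf P x * pmf (trans W x) y * log 2 (pmf ?o y / pmf q y))" for x
  proof (cases "x \<in> set_pmf P")
    case True
    have "pmf (trans W x) y * log 2 (pmf (trans W x) y / pmf q y) - pmf (trans W x) y * log 2 (pmf (trans W x) y / pmf ?o y)
        = pmf (trans W x) y * log 2 (pmf ?o y / pmf q y)" for y
    proof (cases "y \<in> set_pmf (trans W x)")
      case yt: True
      then have "pmf (trans W x) y > 0" "pmf ?o y > 0" "pmf q y > 0"
        using set_output_law[OF True, of W] ac by (auto simp: pmf_positive)
      then show ?thesis by (simp add: log_divide algebra_simps)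
    qed (simp add: set_pmf_iff)
    then have *: "kl (trans W x) q - kl (trans W x) ?o = (\<Sum>y\<in>UNIV. pmf (trans W x) y * log 2 (pmf ?o y / pmf q y))"
      unfolding kl_def expectation_finite by (simp flip: sum_subtractf)
    show ?thesis
      unfolding right_diff_distrib[symmetric] * by (simp add: sum_distrib_left mult.assoc)
  qed (simp add: set_pmf_iff)
  then have "mean P (\<lambda>x. kl (trans W x) q) - mutual_info W P
     = (\<Sum>x\<in>UNIV. \<Sum>y\<in>UNIV. pmf P x * pmf (trans W x) y * log 2 (pmf ?o y / pmf q y))"
    unfolding mutual_info_eq expectation_finite by (simp flip: sum_subtractf)
  also have "\<dots> = (\<Sum>y\<in>UNIV. \<Sum>x\<in>UNIV. pmf P x * pmf (trans W x) y * log 2 (pmf ?o y / pmf q y))"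
    by (rule sum.swap)
  also have "\<dots> = kl ?o q"
    unfolding kl_def expectation_finite by (intro sum.cong refl) (simp add: pmf_output_law sum_distrib_right)
  finally show ?thesis by simp
qed

section \<open>The converse\<close>

abbreviation decided_within :: "int \<Rightarrow> nat \<Rightarrow> (nat \<Rightarrow> 'y) \<Rightarrow> 'y sampler \<times> 'y stopping_rule \<Rightarrow> bool" where
  "decided_within l \<equiv> \<lambda>t y r. int (decision_time r y) - int t \<le> l - 1"

lemma num_samples_props:
  assumes "valid_receiver N (S, stp)"
  shows "1 \<le> num_samples (S, stp) y" "num_samples (S, stp) y \<le> length (S y)"
    "stp (observed (S, stp) y)"
    "\<And>j. 1 \<le> j \<Longrightarrow> stp (map y (take j (S y))) \<Longrightarrow> num_samples (S, stp) y \<le> j"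
proof -
  obtain j where j: "1 \<le> j" "j \<le> length (S y)" "stp (map y (take j (S y)))"
    using assms unfolding valid_receiver_def by fastforce
  have "1 \<le> (LEAST j. 1 \<le> j \<and> stp (map y (take j (S y)))) \<and>
      stp (map y (take (LEAST j. 1 \<le> j \<and> stp (map y (take j (S y)))) (S y)))"
    by (rule LeastI[of "\<lambda>j. 1 \<le> j \<and> stp (map y (take j (S y)))" j]) (use j in auto)
  then show "1 \<le> num_samples (S, stp) y" "stp (observed (S, stp) y)" by auto
  show *: "num_samples (S, stp) y \<le> j" if "1 \<le> j" "stp (map y (take j (S y)))" for j
    using that by (auto intro!: Least_le)
  show "num_samples (S, stp) y \<le> length (S y)" using *[OF j(1,3)] j(2) by linarith
qed

lemma decision_time_range:
  assumes "valid_receiver N r"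
  shows "decision_time r y \<in> {1..N}"
proof (cases r)
  case (Pair S stp)
  have "S y ! (num_samples r y - 1) \<in> set (S y)"
    using num_samples_props(1,2)[of N S stp y] assms Pair by (intro nth_mem) simp
  moreover have "set (S y) \<subseteq> {1..N}" using assms Pair by (auto simp: valid_receiver_def)
  ultimately show ?thesis using Pair by (metis decision_time.simps subsetD)
qed

lemma receiver_causal:
  assumes v: "valid_receiver N (S, stp)" and a: "adaptive_sampler S"
    and agree: "\<And>i. 1 \<le> i \<Longrightarrow> i \<le> decision_time (S, stp) y \<Longrightarrow> y i = y' i"
  shows "decision_time (S, stp) y' = decision_time (S, stp) y"
    and "observed (S, stp) y' = observed (S, stp) y"
proof -
  obtain g where g: "\<And>y j. j < length (S y) \<Longrightarrow> S y ! j = g (map y (take j (S y)))"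
    using a unfolding adaptive_sampler_def by blast
  define k where "k = num_samples (S, stp) y"
  note np = num_samples_props[OF v, where y = y, folded k_def]
  have srt: "sorted_wrt (<) (S y)" and rng: "set (S y) \<subseteq> {1..N}"
    using v unfolding valid_receiver_def by auto
  have vals: "map y' (take j (S y)) = map y (take j (S y))" if "j \<le> k" for j
  proof (rule map_cong[OF refl])
    fix x assume "x \<in> set (take j (S y))"
    then obtain i where i: "i < j" "i < length (S y)" "x = S y ! i"
      by (auto simp: in_set_conv_nth)
    have "S y ! i \<le> S y ! (k - 1)"
    proof (cases "i = k - 1")
      case False
      then have "i < k - 1" "k - 1 < length (S y)" using i that np(1,2) by linarith+
      then show ?thesis using sorted_wrt_nth_less[OF srt, of i "k - 1"] by simp
    qed simp
    moreover have "1 \<le> x" using i rng by (metis atLeastAtMost_iff nth_mem subsetD)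
    ultimately show "y' x = y x" using agree[of x] i by (simp add: k_def)
  qed
  have pre: "j \<le> length (S y') \<and> take j (S y') = take j (S y)" if "j \<le> k" for j
    using that
  proof (induction j)
    case (Suc j)
    then have IH: "j \<le> length (S y')" "take j (S y') = take j (S y)" by auto
    \<comment> \<open>If the list of times for \<open>y'\<close> ended here, validity would give a
      stop within it; the shared observations would then stop the receiver on \<open>y\<close>
      before its \<open>k\<close>-th sample.\<close>
    have lt: "j < length (S y')"
    proof (rule ccontr)
      assume "\<not> j < length (S y')"
      then have jl: "length (S y') = j" using IH by simp
      obtain i where i: "1 \<le> i" "i \<le> j" "stp (map y' (take i (S y')))"
        using v jl unfolding valid_receiver_def by fastforce
      have "take i (S y') = take i (S y)"
        using arg_cong[OF IH(2), of "take i"] i by (simp add: min_def)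
      then have "stp (map y (take i (S y)))" using i vals[of i] Suc.prems by simp
      then have "k \<le> i" using np(4) i by blast
      then show False using i Suc.prems by linarith
    qed
    moreover have "S y' ! j = S y ! j"
      using g[OF lt] g[of j y] IH(2) vals[of j] Suc.prems np(2) by simp
    ultimately show ?case
      using IH(2) Suc.prems np(2) by (simp add: take_Suc_conv_app_nth)
  qed simp
  have obs: "map y' (take j (S y')) = map y (take j (S y))" if "j \<le> k" for j
    using pre[OF that] vals[OF that] by simp
  have k': "num_samples (S, stp) y' = k"
  proof (rule antisym)
    show "num_samples (S, stp) y' \<le> k"
      using num_samples_props(4)[OF v, where j = k and y = y'] obs[of k] np by (simp add: k_def)
    show "k \<le> num_samples (S, stp) y'"
    proof (rule ccontr)
      assume *: "\<not> k \<le> num_samples (S, stp) y'"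
      then have "stp (map y (take (num_samples (S, stp) y') (S y)))"
        using num_samples_props(3)[OF v, where y = y'] obs[of "num_samples (S, stp) y'"] by simp
      then show False using np(4) num_samples_props(1)[OF v, where y = y'] * by blast
    qed
  qed
  show "observed (S, stp) y' = observed (S, stp) y"
    using k' obs[of k] unfolding observed.simps k_def by simp
  have "take k (S y') ! (k - 1) = take k (S y) ! (k - 1)" using pre[of k] by simp
  then show "decision_time (S, stp) y' = decision_time (S, stp) y"
    using k' np(1) unfolding decision_time.simps k_def by simp
qed

text \<open>The sum of the probabilities is the mean number of events that occur.\<close>

lemma sum_prob_le_card:
  assumes "finite I" "\<And>x. card {i \<in> I. x \<in> E i} \<le> K"
  shows "(\<Sum>i\<in>I. Pr p (E i)) \<le> real K"
proof -
  have "(\<Sum>i\<in>I. Pr p (E i)) = (\<Sum>i\<in>I. mean p (indicator (E i)))"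
    by simp
  also have "\<dots> = mean p (\<lambda>x. \<Sum>i\<in>I. indicator (E i) x)"
    by (rule Bochner_Integration.integral_sum[symmetric])
       (auto intro!: measure_pmf.integrable_const_bound[where B = 1])
  also have "\<dots> \<le> mean p (\<lambda>x. real K)"
  proof (rule integral_mono)
    show "integrable p (\<lambda>x. \<Sum>i\<in>I. indicator (E i) x :: real)"
      by (intro Bochner_Integration.integrable_sum measure_pmf.integrable_const_bound[where B = 1]) auto
    fix x
    have "(\<Sum>i\<in>I. indicator (E i) x :: real) = real (card {i \<in> I. x \<in> E i})"
      using assms(1) by (simp add: indicator_def sum.If_cases Int_def)
    then show "(\<Sum>i\<in>I. indicator (E i) x :: real) \<le> real K" using assms(2)[of x] by simp
  qed auto
  also have "\<dots> = K" by simp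
  finally show ?thesis .
qed

lemma sum_shift_window:
  assumes "1 \<le> s" "s + n \<le> N + 1" "1 \<le> n"
  shows "(\<Sum>i=1..N::nat. if s \<le> i \<and> i \<le> s + n - 1 then f (i - s + 1) else (0::real)) = (\<Sum>j=1..n. f j)"
proof -
  have "(\<Sum>i=1..N. if s \<le> i \<and> i \<le> s + n - 1 then f (i - s + 1) else 0)
      = (\<Sum>i\<in>{s..s + n - 1}. f (i - s + 1))"
    using assms by (intro sum.mono_neutral_cong_right) auto
  also have "\<dots> = (\<Sum>j=1..n. f j)"
    by (rule sum.reindex_bij_witness[where i = "\<lambda>j. j + s - 1" and j = "\<lambda>i. i - s + 1"]) (use assms in auto)
  finally show ?thesis .
qed

section \<open>One code compared with a reference law\<close>

definition letter_law :: "('a, 'y) code \<Rightarrow> 'a pmf" where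
  "letter_law C = map_pmf (\<lambda>(m, j). codeword C m j) (pmf_of_set (messages C \<times> {1..blocklength C}))"

text \<open>Unlike in \<open>channel_input\<close> the start is a free argument, since
  \<open>message_bound\<close> replaces the transmitter's start by a truncated one.\<close>

definition shifted_input :: "('a, 'y) channel \<Rightarrow> ('a, 'y) code \<Rightarrow> nat \<Rightarrow> nat \<Rightarrow> nat \<Rightarrow> 'a" where
  "shifted_input W C m s i = (if s \<le> i \<and> i \<le> s + blocklength C - 1 then codeword C m (i - s + 1) else idle W)"

locale converse_setting =
  fixes W :: "('a::finite, 'y::finite) channel" and C :: "('a, 'y) code" and d :: nat and \<epsilon> :: real
  assumes valid: "valid_code W C" and adaptive: "adaptive_code C" and d: "1 \<le> d"
    and err: "error_prob W C \<le> \<epsilon>"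
    and del: "(MIN m\<in>messages C. msg_prob W C m (decided_within (int d))) \<ge> 1 - \<epsilon>"
begin

abbreviation "n \<equiv> blocklength C"
abbreviation "A \<equiv> arrivals C"
abbreviation "N \<equiv> horizon C"
abbreviation "M \<equiv> (2::nat) ^ bits C"
abbreviation "P \<equiv> letter_law C"
abbreviation "Qi \<equiv> trans W (idle W)"
abbreviation "law \<equiv> output_pmf W C"
abbreviation "rc \<equiv> receiver C"

text \<open>One \<open>\<epsilon>\<close> for wrong decoding, one for lateness, and
  \<open>1 / real M\<close> for correct decisions made before the arrival, see
  \<open>sum_early\<close>.\<close>

definition "\<delta> = 2 * \<epsilon> + 1 / real M"

text \<open>The delay criterion bounds the decision time only from above. The lower bound added here
  makes one outcome a hit for at most \<open>d\<close> arrival times.\<close>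

definition hit :: "nat \<Rightarrow> nat \<Rightarrow> (nat \<Rightarrow> 'y) \<Rightarrow> 'y sampler \<times> 'y stopping_rule \<Rightarrow> bool" where
  "hit m t y r \<longleftrightarrow> decoder C (observed r y) = m \<and> t \<le> decision_time r y \<and> decision_time r y \<le> t + d - 1"

text \<open>Averaging out the receiver's randomness leaves a test function of the outputs with
  values in [0, 1], as \<open>change_of_measure\<close> requires.\<close>

definition e :: "nat \<Rightarrow> nat \<Rightarrow> (nat \<Rightarrow> 'y) \<Rightarrow> real" where
  "e m t y = Pr rc {r. hit m t y r}"

lemma basic: "1 \<le> n" "1 \<le> A" "1 \<le> bits C" "N = A + n - 1"
  using valid by (auto simp: valid_code_def horizon_def)

lemma start: "m \<in> messages C \<Longrightarrow> t \<in> {1..A} \<Longrightarrow> t \<le> start_time C t m \<and> start_time C t m \<le> A"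
  using valid by (auto simp: valid_code_def)

lemma rc_valid: "r \<in> set_pmf rc \<Longrightarrow> valid_receiver N r"
  using valid by (auto simp: valid_code_def)

lemma rc_causal:
  assumes "r \<in> set_pmf rc" "\<And>i. 1 \<le> i \<Longrightarrow> i \<le> decision_time r y \<Longrightarrow> y i = y' i"
  shows "decision_time r y' = decision_time r y \<and> observed r y' = observed r y"
proof (cases r)
  case (Pair S stp)
  then have "adaptive_sampler S" using adaptive assms(1) by (auto simp: adaptive_code_def)
  then show ?thesis
    using receiver_causal[of N S stp y y'] rc_valid[OF assms(1)] assms(2) Pair by blast
qed

text \<open>Causality can be started from either output sequence, so it suffices that one of the two
  decisions falls by time \<open>k\<close>.\<close>

lemma event_local:
  assumes "\<And>i. i \<in> {1..k} \<Longrightarrow> y i = y' i"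
  shows "Pr rc {r. decision_time r y \<le> k \<and> F r (decision_time r y) (observed r y)}
       = Pr rc {r. decision_time r y' \<le> k \<and> F r (decision_time r y') (observed r y')}"
proof -
  have "decision_time r y \<le> k \<and> F r (decision_time r y) (observed r y) \<longleftrightarrow>
      decision_time r y' \<le> k \<and> F r (decision_time r y') (observed r y')" if r: "r \<in> set_pmf rc" for r
  proof (cases "decision_time r y \<le> k \<or> decision_time r y' \<le> k")
    case True
    then have "decision_time r y' = decision_time r y \<and> observed r y' = observed r y"
    proof
      assume *: "decision_time r y \<le> k"
      show ?thesis by (rule rc_causal[OF r]) (use assms * in auto)
    next
      assume *: "decision_time r y' \<le> k"
      have "decision_time r y = decision_time r y' \<and> observed r y = observed r y'"
        by (rule rc_causal[OF r]) (use assms * in \<open>auto intro!: sym[OF assms]\<close>)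
      then show ?thesis by simp
    qed
    then show ?thesis by simp
  qed auto
  then have "{r. decision_time r y \<le> k \<and> F r (decision_time r y) (observed r y)} \<inter> set_pmf rc
     = {r. decision_time r y' \<le> k \<and> F r (decision_time r y') (observed r y')} \<inter> set_pmf rc" by blast
  then show ?thesis by (subst (1 2) measure_Int_set_pmf[symmetric]) simp
qed

lemma e_bounds: "0 \<le> e m t y" "e m t y \<le> 1"
  by (auto simp: e_def)

lemma e_local:
  assumes "\<And>i. i \<in> {1..t + d - 1} \<Longrightarrow> y i = y' i"
  shows "e m t y = e m t y'"
proof -
  have *: "{r. hit m t z r} = {r. decision_time r z \<le> t + d - 1 \<and>
      (decoder C (observed r z) = m \<and> t \<le> decision_time r z)}" for z
    by (auto simp: hit_def)
  show ?thesis unfolding e_def *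
    by (rule event_local[where F = "\<lambda>r u v. decoder C v = m \<and> t \<le> u"]) (use assms in auto)
qed

lemma law_eq: "law m t = Pi_pmf {1..N} undefined (\<lambda>i. trans W (shifted_input W C m (start_time C t m) i))"
  unfolding output_pmf_def
  by (intro Pi_pmf_cong refl arg_cong[of _ _ "trans W"]) (simp add: channel_input_def shifted_input_def Let_def)

lemma expectation_e: "mean q (e m t) = Pr (pair_pmf q rc) {(y, r). hit m t y r}"
  by (simp add: prob_pair_pmf e_def[abs_def])

abbreviation early :: "nat \<Rightarrow> nat \<Rightarrow> ((nat \<Rightarrow> 'y) \<times> ('y sampler \<times> 'y stopping_rule)) set" where
  "early m t \<equiv> {(y, r). decision_time r y \<le> t - 1 \<and> decoder C (observed r y) = m}"

lemma early_idle:
  assumes "m \<in> messages C" "t \<in> {1..A}"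
  shows "Pr (pair_pmf (law m t) rc) (early m t)
       = Pr (pair_pmf (Pi_pmf {1..N} undefined (\<lambda>_. Qi)) rc) (early m t)"
  unfolding prob_pair_pmf law_eq
proof (rule expectation_Pi_pmf_local[where A' = "{1..t - 1}"])
  show "{1..t - 1} \<subseteq> {1..N}" using assms basic by auto
  show "trans W (shifted_input W C m (start_time C t m) i) = Qi" if "i \<in> {1..t - 1}" for i
    using start[OF assms] that by (auto simp: shifted_input_def)
  show "Pr rc {r. decision_time r y \<le> t - 1 \<and> decoder C (observed r y) = m}
      = Pr rc {r. decision_time r y' \<le> t - 1 \<and> decoder C (observed r y') = m}"
    if "\<And>i. i \<in> {1..t - 1} \<Longrightarrow> y i = y' i" for y y'
    by (rule event_local[where F = "\<lambda>r u v. decoder C v = m"]) (use that in auto)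
qed simp

text \<open>Before the arrival the outputs are noise whatever the message, so all these events may
  be measured under one law; there they are disjoint, as only one message is decoded. On average
  over messages a premature correct decision has probability at most
  \<open>1 / real M\<close>.\<close>

lemma sum_early:
  assumes "t \<in> {1..A}"
  shows "(\<Sum>m\<in>messages C. Pr (pair_pmf (law m t) rc) (early m t)) \<le> 1"
proof -
  have "(\<Sum>m\<in>messages C. Pr (pair_pmf (law m t) rc) (early m t))
    = (\<Sum>m\<in>messages C. Pr (pair_pmf (Pi_pmf {1..N} undefined (\<lambda>_. Qi)) rc) (early m t))"
    using assms by (intro sum.cong refl early_idle)
  also have "\<dots> \<le> real 1"
  proof (rule sum_prob_le_card)
    fix x :: "(nat \<Rightarrow> 'y) \<times> ('y sampler \<times> 'y stopping_rule)"
    have "{m \<in> messages C. x \<in> early m t} \<subseteq> {decoder C (observed (snd x) (fst x))}" by auto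
    from card_mono[OF _ this] show "card {m \<in> messages C. x \<in> early m t} \<le> 1" by simp
  qed simp
  finally show ?thesis by simp
qed

lemma hit_lower:
  "(1 - \<delta>) * (real M * real A) \<le> (\<Sum>m\<in>messages C. \<Sum>t=1..A. mean (law m t) (e m t))"
proof -
  let ?pr = "\<lambda>m t E. Pr (pair_pmf (law m t) rc) {(y, r). E t y r}"
  let ?bad = "\<lambda>m t. ?pr m t (\<lambda>t y r. decoder C (observed r y) \<noteq> m)"
  let ?ok = "\<lambda>m t. ?pr m t (decided_within (int d))"
  have pt: "mean (law m t) (e m t) \<ge>
      ?ok m t - ?bad m t - Pr (pair_pmf (law m t) rc) (early m t)" if t: "t \<in> {1..A}" for m t
  proof -
    have "{(y, r). int (decision_time r y) - int t \<le> int d - 1} \<subseteq>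
       ({(y, r). hit m t y r} \<union> {(y, r). decoder C (observed r y) \<noteq> m}) \<union> early m t"
      using t d by (auto simp: hit_def)
    then have "?ok m t \<le> Pr (pair_pmf (law m t) rc)
       (({(y, r). hit m t y r} \<union> {(y, r). decoder C (observed r y) \<noteq> m}) \<union> early m t)"
      by (intro measure_pmf.finite_measure_mono) auto
    also have "\<dots> \<le> Pr (pair_pmf (law m t) rc) {(y, r). hit m t y r} + ?bad m t
        + Pr (pair_pmf (law m t) rc) (early m t)"
      by (intro order.trans[OF prob_Un_le] add_right_mono prob_Un_le)
    finally show ?thesis by (simp add: expectation_e)
  qed
  have ne: "finite (messages C)" "messages C \<noteq> {}" by auto
  have A0: "real A > 0" using basic by simp
  have "(\<Sum>t=1..A. ?bad m t) \<le> \<epsilon> * A" if m: "m \<in> messages C" for m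
  proof -
    have "msg_prob W C m (\<lambda>t y r. decoder C (observed r y) \<noteq> m) \<le> error_prob W C"
      unfolding error_prob_def using m by (intro Max_ge) auto
    then have "msg_prob W C m (\<lambda>t y r. decoder C (observed r y) \<noteq> m) \<le> \<epsilon>" using err by linarith
    then show ?thesis using A0 unfolding msg_prob_def by (simp add: divide_le_eq)
  qed
  moreover have "(\<Sum>t=1..A. ?ok m t) \<ge> (1 - \<epsilon>) * A" if m: "m \<in> messages C" for m
  proof -
    have "1 - \<epsilon> \<le> msg_prob W C m (decided_within (int d))"
      by (rule order.trans[OF del Min_le]) (use m in auto)
    then show ?thesis using A0 unfolding msg_prob_def by (simp add: le_divide_eq)
  qed
  ultimately have "(\<Sum>m\<in>messages C. (1 - \<epsilon>) * A - \<epsilon> * A) \<le> (\<Sum>m\<in>messages C. (\<Sum>t=1..A. ?ok m t) - (\<Sum>t=1..A. ?bad m t))"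
    by (intro sum_mono diff_mono) auto
  then have "(1 - 2 * \<epsilon>) * (real M * A) \<le> (\<Sum>m\<in>messages C. \<Sum>t=1..A. ?ok m t - ?bad m t)"
    by (simp add: sum_subtractf algebra_simps)
  moreover have "(\<Sum>m\<in>messages C. \<Sum>t=1..A. Pr (pair_pmf (law m t) rc) (early m t)) \<le> A"
  proof -
    have "(\<Sum>t=1..A. \<Sum>m\<in>messages C. Pr (pair_pmf (law m t) rc) (early m t)) \<le> (\<Sum>t=1..A. 1)"
      by (intro sum_mono sum_early)
    then show ?thesis by (subst sum.swap) simp
  qed
  moreover have "(\<Sum>m\<in>messages C. \<Sum>t=1..A. ?ok m t - ?bad m t - Pr (pair_pmf (law m t) rc) (early m t))
     \<le> (\<Sum>m\<in>messages C. \<Sum>t=1..A. mean (law m t) (e m t))"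
    by (intro sum_mono pt)
  moreover have "(1 - \<delta>) * (real M * A) = (1 - 2 * \<epsilon>) * (real M * A) - A"
    by (simp add: \<delta>_def algebra_simps)
  ultimately show ?thesis by (simp add: sum_subtractf)
qed

lemma set_P: "set_pmf P = (\<lambda>(m, j). codeword C m j) ` (messages C \<times> {1..n})"
  unfolding letter_law_def using basic by (subst set_map_pmf, subst set_pmf_of_set) auto

lemma set_P_inputs: "set_pmf P \<subseteq> inputs W"
  using valid unfolding set_P valid_code_def by auto

lemma sum_letters:
  fixes F :: "'a \<Rightarrow> real"
  shows "(\<Sum>m\<in>messages C. \<Sum>j=1..n. F (codeword C m j)) = real M * real n * mean P F"
proof -
  have "mean P F = (\<Sum>(m, j)\<in>messages C \<times> {1..n}. F (codeword C m j)) / real (M * n)"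
    unfolding letter_law_def using basic
    by (simp add: integral_pmf_of_set split_beta card_cartesian_product)
  then show ?thesis using basic by (simp add: sum.cartesian_product)
qed

definition ref_law :: "nat \<Rightarrow> 'y pmf \<Rightarrow> (nat \<Rightarrow> 'y) pmf" where
  "ref_law s q = Pi_pmf {1..N} undefined (\<lambda>i. if s \<le> i \<and> i \<le> s + n - 1 then q else Qi)"

definition sent_law :: "nat \<Rightarrow> nat \<Rightarrow> (nat \<Rightarrow> 'y) pmf" where
  "sent_law m s = Pi_pmf {1..N} undefined (\<lambda>i. trans W (shifted_input W C m s i))"

lemma law_eq_sent_law: "law m t = sent_law m (start_time C t m)"
  by (simp add: law_eq sent_law_def)

text \<open>Outside the transmission window both product laws are idle, so their divergence is the
  sum over the \<open>n\<close> letters, wherever the window starts.\<close>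

lemma sent_law_bound:
  assumes s: "1 \<le> s" "s \<le> A" and m: "m \<in> messages C"
    and ac: "\<And>x. x \<in> set_pmf P \<Longrightarrow> set_pmf (trans W x) \<subseteq> set_pmf q"
  shows "L * mean (sent_law m s) (e m t) \<le> (\<Sum>j=1..n. kl (trans W (codeword C m j)) q)
      + ((1 + 2 powr L * mean (ref_law s q) (e m t)) / 2 + ln 2 - 1) / ln 2"
proof -
  have ac': "set_pmf (trans W (shifted_input W C m s i)) \<subseteq> set_pmf (if s \<le> i \<and> i \<le> s + n - 1 then q else Qi)" for i
  proof (cases "s \<le> i \<and> i \<le> s + n - 1")
    case True
    then have "i - s + 1 \<in> {1..n}" using basic by auto
    then have "codeword C m (i - s + 1) \<in> set_pmf P" unfolding set_P using m by auto
    then show ?thesis using ac True by (simp add: shifted_input_def)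
  qed (auto simp: shifted_input_def)
  have "kl (sent_law m s) (ref_law s q)
      = (\<Sum>i=1..N. kl (trans W (shifted_input W C m s i)) (if s \<le> i \<and> i \<le> s + n - 1 then q else Qi))"
    unfolding sent_law_def ref_law_def using ac' by (intro kl_Pi_pmf) auto
  also have "\<dots> = (\<Sum>i=1..N. if s \<le> i \<and> i \<le> s + n - 1 then kl (trans W (codeword C m (i - s + 1))) q else 0)"
    by (intro sum.cong refl) (simp add: shifted_input_def)
  also have "\<dots> = (\<Sum>j=1..n. kl (trans W (codeword C m j)) q)"
    using s basic by (intro sum_shift_window) auto
  finally have "kl (sent_law m s) (ref_law s q) = (\<Sum>j=1..n. kl (trans W (codeword C m j)) q)" .
  moreover have "set_pmf (sent_law m s) \<subseteq> set_pmf (ref_law s q)"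
    using ac' unfolding sent_law_def ref_law_def set_Pi_pmf[OF finite_atLeastAtMost] PiE_dflt_def o_def by blast
  moreover have "finite (set_pmf (ref_law s q))" by (simp add: ref_law_def finite_set_Pi_pmf)
  ultimately show ?thesis using change_of_measure[of "ref_law s q" "sent_law m s" "e m t" L] e_bounds by simp
qed

text \<open>Sum \<open>step\<close> over all messages and arrival times. The choice of
  \<open>L\<close> makes the reference term average to at most 1, and the remaining constant is
  exactly one bit: ((1 + 1) / 2 + ln 2 - 1) / ln 2 = 1.\<close>

lemma averaged_bound:
  assumes L: "0 \<le> L"
    and step: "\<And>m t. m \<in> messages C \<Longrightarrow> t \<in> {1..A} \<Longrightarrow> L * mean (law m t) (e m t)
      \<le> (\<Sum>j=1..n. F (codeword C m j)) + ((1 + 2 powr L * q m t) / 2 + ln 2 - 1) / ln 2"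
    and q: "(\<Sum>t=1..A. \<Sum>m\<in>messages C. q m t) \<le> Z" "2 powr L * Z = real M * real A"
  shows "(1 - \<delta>) * L - 1 \<le> real n * mean P F"
proof -
  let ?u = "2 powr L / (2 * ln 2)" and ?v = "(ln 2 - 1 / 2) / ln 2 :: real"
  have "L * ((1 - \<delta>) * (real M * real A)) \<le> L * (\<Sum>m\<in>messages C. \<Sum>t=1..A. mean (law m t) (e m t))"
    using hit_lower L by (intro mult_left_mono)
  also have "\<dots> = (\<Sum>t=1..A. \<Sum>m\<in>messages C. L * mean (law m t) (e m t))"
    by (subst sum.swap) (simp add: sum_distrib_left)
  also have "\<dots> \<le> (\<Sum>t=1..A. \<Sum>m\<in>messages C. (\<Sum>j=1..n. F (codeword C m j)) + ?u * q m t + ?v)"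
  proof (intro sum_mono)
    fix t m assume "t \<in> {1..A}" "m \<in> messages C"
    moreover have "((1 + 2 powr L * q m t) / 2 + ln 2 - 1) / ln 2 = ?u * q m t + ?v" by (simp add: field_simps)
    ultimately show "L * mean (law m t) (e m t) \<le> (\<Sum>j=1..n. F (codeword C m j)) + ?u * q m t + ?v"
      using step[of m t] by simp
  qed
  also have "\<dots> = A * (\<Sum>m\<in>messages C. \<Sum>j=1..n. F (codeword C m j)) + ?u * (\<Sum>t=1..A. \<Sum>m\<in>messages C. q m t) + real M * real A * ?v"
    by (simp add: sum.distrib sum_distrib_left)
  also have "\<dots> \<le> A * (\<Sum>m\<in>messages C. \<Sum>j=1..n. F (codeword C m j)) + ?u * Z + real M * real A * ?v"
    using q(1) by (intro add_mono mult_left_mono) auto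
  also have "?u * Z = real M * real A * (1 / (2 * ln 2))" using q(2) by simp
  finally have "L * ((1 - \<delta>) * (real M * real A))
      \<le> A * (\<Sum>m\<in>messages C. \<Sum>j=1..n. F (codeword C m j)) + real M * real A * (1 / (2 * ln 2) + ?v)"
    by (simp only: distrib_left add.assoc)
  also have "1 / (2 * ln 2) + ?v = (1 :: real)" by (simp add: field_simps)
  finally have "real M * real A * ((1 - \<delta>) * L) \<le> real M * real A * (real n * mean P F + 1)"
    unfolding sum_letters by (simp add: algebra_simps)
  then have "(1 - \<delta>) * L \<le> real n * mean P F + 1"
    using basic by (subst (asm) mult_le_cancel_left_pos) auto
  then show ?thesis by simp
qed

lemma sum_hit_le:
  assumes "finite I" "\<And>x i. i \<in> I \<Longrightarrow> hit (fst i) (snd i) (fst x) (snd x) \<Longrightarrow> i \<in> J x"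
    and "\<And>x. finite (J x)" "\<And>x. card (J x) \<le> K"
  shows "(\<Sum>i\<in>I. mean q (e (fst i) (snd i))) \<le> real K"
  unfolding expectation_e
proof (rule sum_prob_le_card[OF assms(1)])
  fix x
  have "card {i \<in> I. x \<in> {(y, r). hit (fst i) (snd i) y r}} \<le> card (J x)"
    using assms(2)[of _ x] by (intro card_mono assms(3)) auto
  then show "card {i \<in> I. x \<in> {(y, r). hit (fst i) (snd i) y r}} \<le> K" using assms(4)[of x] by linarith
qed

text \<open>Under pure noise an outcome hits at most \<open>d\<close> of the \<open>M * A\<close>
  pairs: the decoded message with the \<open>d\<close> arrival times up to the decision. Message and
  arrival time together are thus identified up to a factor \<open>d\<close>.\<close>

lemma timing_bound:
  assumes ac: "set_pmf (output_law W P) \<subseteq> set_pmf Qi" and dM: "real d \<le> real M * real A"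
  shows "(1 - \<delta>) * log 2 (real M * real A / real d) - 1 \<le> real n * mean P (\<lambda>x. kl (trans W x) Qi)"
proof (rule averaged_bound)
  let ?L = "log 2 (real M * real A / real d)" and ?q = "Pi_pmf {1..N} undefined (\<lambda>i. Qi)"
  show "0 \<le> ?L" using dM d by simp
  show "2 powr ?L * real d = real M * real A" using basic d by (subst powr_log_cancel) auto
  show "?L * mean (law m t) (e m t) \<le> (\<Sum>j=1..n. kl (trans W (codeword C m j)) Qi)
      + ((1 + 2 powr ?L * mean ?q (e m t)) / 2 + ln 2 - 1) / ln 2" if mt: "m \<in> messages C" "t \<in> {1..A}" for m t
  proof -
    have "set_pmf (trans W x) \<subseteq> set_pmf Qi" if "x \<in> set_pmf P" for x
      using set_output_law[OF that, of W] ac by blast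
    then show ?thesis
      using sent_law_bound[of "start_time C t m" m Qi ?L t] start[OF mt] mt by (simp add: law_eq_sent_law ref_law_def)
  qed
  have "(\<Sum>t=1..A. \<Sum>m\<in>messages C. mean ?q (e m t)) = (\<Sum>i\<in>messages C \<times> {1..A}. mean ?q (e (fst i) (snd i)))"
    by (subst sum.swap) (simp add: sum.cartesian_product split_beta)
  also have "\<dots> \<le> real d"
    by (rule sum_hit_le[where J = "\<lambda>(y, r). {decoder C (observed r y)} \<times> {decision_time r y + 1 - d..decision_time r y}"])
       (use d in \<open>auto simp: hit_def card_cartesian_product\<close>)
  finally show "(\<Sum>t=1..A. \<Sum>m\<in>messages C. mean ?q (e m t)) \<le> real d" .
qed

text \<open>
  Truncating the starting time at \<open>t + d\<close> leaves the event of deciding within the delay unaffected,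
  and makes the starting time carry at most \<open>log (d + 1)\<close> bits.
\<close>

lemma message_bound:
  assumes dM: "real d + 1 \<le> real M"
  shows "(1 - \<delta>) * log 2 (real M / (real d + 1)) - 1 \<le> real n * mutual_info W P"
  unfolding mutual_info_eq
proof (rule averaged_bound)
  let ?L = "log 2 (real M / (real d + 1))" and ?o = "output_law W P"
  define s where "s m t = min (start_time C t m) (t + d)" for m t
  show "0 \<le> ?L" using dM d by simp
  show "2 powr ?L * (A * (real d + 1)) = real M * real A"
    using d by (subst powr_log_cancel) (auto simp: add_eq_0_iff)
  have s: "1 \<le> s m t" "s m t \<le> A" "s m t \<in> {t..t + d}" if "m \<in> messages C" "t \<in> {1..A}" for m t
    using start[OF that] that by (auto simp: s_def)
  show "?L * mean (law m t) (e m t) \<le> (\<Sum>j=1..n. kl (trans W (codeword C m j)) ?o)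
      + ((1 + 2 powr ?L * mean (ref_law (s m t) ?o) (e m t)) / 2 + ln 2 - 1) / ln 2"
    if mt: "m \<in> messages C" "t \<in> {1..A}" for m t
  proof -
    have "mean (law m t) (e m t) = mean (sent_law m (s m t)) (e m t)"
    proof (cases "t + d - 1 \<le> N")
      case True
      show ?thesis unfolding law_eq sent_law_def
      proof (rule expectation_Pi_pmf_local[where A' = "{1..t + d - 1}"])
        show "{1..t + d - 1} \<subseteq> {1..N}" using True by auto
        show "trans W (shifted_input W C m (start_time C t m) i) = trans W (shifted_input W C m (s m t) i)"
          if "i \<in> {1..t + d - 1}" for i
          using that mt by (auto simp: shifted_input_def s_def min_def)
      qed (auto intro: e_local)
    next
      \<comment> \<open>Here \<open>t + d\<close> lies beyond the horizon, hence beyond every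
        admissible start, and the truncation changes nothing.\<close>
      case False
      then have "s m t = start_time C t m" using start[OF mt] basic by (auto simp: s_def)
      then show ?thesis by (simp add: law_eq_sent_law)
    qed
    then show ?thesis
      using sent_law_bound[of "s m t" m ?o ?L t] s[OF mt] mt set_output_law[of _ P W] by simp
  qed
  have "(\<Sum>m\<in>messages C. mean (ref_law (s m t) ?o) (e m t)) \<le> real d + 1" if t: "t \<in> {1..A}" for t
  proof -
    \<comment> \<open>The reference law still depends on the message through the truncated start.
      Summing over all \<open>d + 1\<close> possible starts removes this dependence, so that for
      each start the hits of different messages are disjoint.\<close>
    have "(\<Sum>m\<in>messages C. mean (ref_law (s m t) ?o) (e m t))
       \<le> (\<Sum>m\<in>messages C. \<Sum>u=t..t + d. mean (ref_law u ?o) (e m t))"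
    proof (rule sum_mono)
      fix m assume "m \<in> messages C"
      then show "mean (ref_law (s m t) ?o) (e m t) \<le> (\<Sum>u=t..t + d. mean (ref_law u ?o) (e m t))"
        using s(3) t by (intro member_le_sum[of "s m t" _ "\<lambda>u. mean (ref_law u ?o) (e m t)"]
          Bochner_Integration.integral_nonneg e_bounds) auto
    qed
    also have "\<dots> = (\<Sum>u=t..t + d. \<Sum>m\<in>messages C. mean (ref_law u ?o) (e m t))"
      by (rule sum.swap)
    also have "\<dots> \<le> (\<Sum>u=t..t + d. real 1)"
    proof (rule sum_mono)
      fix u
      have "(\<Sum>m\<in>messages C. mean (ref_law u ?o) (e m t))
          = (\<Sum>i\<in>messages C \<times> {t}. mean (ref_law u ?o) (e (fst i) (snd i)))"
        by (rule sum.reindex_bij_witness[where i = fst and j = "\<lambda>m. (m, t)"]) auto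
      also have "\<dots> \<le> real 1"
        by (rule sum_hit_le[where J = "\<lambda>(y, r). {decoder C (observed r y)} \<times> {t}"]) (auto simp: hit_def)
      finally show "(\<Sum>m\<in>messages C. mean (ref_law u ?o) (e m t)) \<le> real 1" .
    qed
    finally show ?thesis by simp
  qed
  then have "(\<Sum>t=1..A. \<Sum>m\<in>messages C. mean (ref_law (s m t) ?o) (e m t)) \<le> (\<Sum>t=1..A. real d + 1)"
    by (rule sum_mono)
  then show "(\<Sum>t=1..A. \<Sum>m\<in>messages C. mean (ref_law (s m t) ?o) (e m t)) \<le> A * (real d + 1)" by simp
qed

lemma cost_bound: "of_nat n * expected_cost W P \<le> code_cost W C"
proof -
  let ?k = "\<lambda>m j. symbol_cost W (codeword C m j)"
  have ne: "finite (messages C \<times> {1..n})" "messages C \<times> {1..n} \<noteq> {}" using basic by auto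
  have "expected_cost W P = (\<integral>\<^sup>+ x. symbol_cost W (case x of (m, j) \<Rightarrow> codeword C m j) \<partial>pmf_of_set (messages C \<times> {1..n}))"
    unfolding expected_cost_def letter_law_def by simp
  also have "\<dots> = (\<Sum>x\<in>messages C \<times> {1..n}. symbol_cost W (case x of (m, j) \<Rightarrow> codeword C m j)) / card (messages C \<times> {1..n})"
    using ne by (simp add: nn_integral_pmf_of_set)
  also have "\<dots> = (\<Sum>m\<in>messages C. \<Sum>j=1..n. ?k m j) / of_nat (M * n)"
    by (simp add: sum.cartesian_product card_cartesian_product split_beta ennreal_of_nat_eq_real_of_nat)
  also have "\<dots> \<le> (\<Sum>m\<in>messages C. code_cost W C) / of_nat (M * n)"
    unfolding code_cost_def by (intro divide_right_mono_ennreal sum_mono Max_ge) auto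
  finally have "of_nat n * expected_cost W P \<le> of_nat n * ((of_nat M * code_cost W C) / of_nat (M * n))"
    by (intro mult_left_mono) (auto)
  also have "\<dots> = code_cost W C"
  proof -
    have "of_nat n * ((of_nat M * code_cost W C) / of_nat (M * n)) = (of_nat (M * n) * code_cost W C) / (of_nat (M * n) :: ennreal)"
      by (simp add: ennreal_times_divide mult_ac)
    also have "\<dots> = code_cost W C"
      using basic by (subst mult.commute, intro ennreal_mult_divide_eq)
        (simp_all only: of_nat_eq_0_iff ennreal_of_nat_neq_top, auto)
    finally show ?thesis .
  qed
  finally show ?thesis .
qed

end

lemma divide_left_mono_ennreal:
  fixes a b c :: ennreal
  assumes "a \<le> b"
  shows "c / b \<le> c / a"
proof -
  have "inverse b \<le> inverse a"
  proof (cases "a = 0 \<or> b = \<top>")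
    case False
    then obtain r s where "a = ennreal r" "b = ennreal s" "0 < r" "r \<le> s"
      using assms by (cases a; cases b) (auto simp: top_unique less_le)
    then show ?thesis by (simp add: inverse_ennreal ennreal_leI)
  qed auto
  then show ?thesis by (simp add: divide_ennreal_def mult_left_mono)
qed

lemma num_samples_le_decision_time:
  assumes "valid_receiver N r"
  shows "num_samples r y \<le> decision_time r y"
proof (cases r)
  case (Pair S stp)
  have srt: "sorted_wrt (<) (S y)" and rng: "set (S y) \<subseteq> {1..N}"
    using assms unfolding valid_receiver_def Pair by auto
  have "j < length (S y) \<Longrightarrow> j + 1 \<le> S y ! j" for j
  proof (induction j)
    case 0
    then have "S y ! 0 \<in> {1..N}" using rng nth_mem by blast
    then show ?case by simp
  next
    case (Suc j)
    then show ?case using sorted_wrt_nth_less[OF srt, of j "Suc j"] by simp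
  qed
  from this[of "num_samples r y - 1"] show ?thesis
    using num_samples_props(1,2)[of N S stp y] assms unfolding Pair decision_time.simps by simp
qed

section \<open>Sampling frequency and delay of a valid code\<close>

context
  fixes W :: "('a::finite, 'y::finite) channel" and C :: "('a, 'y) code"
  assumes valid: "valid_code W C"
begin

lemma arrivals_pos: "1 \<le> arrivals C"
  using valid by (simp add: valid_code_def)

lemma msg_prob_mono:
  assumes "\<And>t y r. t \<in> {1..arrivals C} \<Longrightarrow> r \<in> set_pmf (receiver C) \<Longrightarrow> E t y r \<Longrightarrow> E' t y r"
  shows "msg_prob W C m E \<le> msg_prob W C m E'"
  unfolding msg_prob_def
proof (intro divide_right_mono sum_mono)
  fix t assume t: "t \<in> {1..arrivals C}"
  let ?p = "pair_pmf (output_pmf W C m t) (receiver C)"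
  have "Pr ?p {(y, r). E t y r} = Pr ?p ({(y, r). E t y r} \<inter> set_pmf ?p)"
    by (simp only: measure_Int_set_pmf)
  also have "\<dots> \<le> Pr ?p {(y, r). E' t y r}"
    using assms[OF t] by (intro measure_pmf.finite_measure_mono) auto
  finally show "Pr ?p {(y, r). E t y r} \<le> Pr ?p {(y, r). E' t y r}" .
qed simp

lemma msg_prob_True: "msg_prob W C m (\<lambda>t y r. True) = 1"
proof -
  have "{(y, r). True} = (UNIV :: ((nat \<Rightarrow> 'y) \<times> ('y sampler \<times> 'y stopping_rule)) set)" by auto
  then show ?thesis using arrivals_pos by (simp add: msg_prob_def)
qed

lemma msg_prob_False: "msg_prob W C m (\<lambda>t y r. False) = 0"
  by (simp add: msg_prob_def)

lemma receiver_valid: "r \<in> set_pmf (receiver C) \<Longrightarrow> valid_receiver (horizon C) r"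
  using valid by (auto simp: valid_code_def)

lemma sampling_frequency_le_1:
  assumes "0 \<le> \<epsilon>"
  shows "sampling_frequency W C \<epsilon> \<le> 1"
  unfolding sampling_frequency_def
proof (rule cInf_lower)
  have "1 \<le> msg_prob W C m (\<lambda>t y r. real (num_samples r y) / real (decision_time r y) \<le> 1)" for m
  proof -
    have "msg_prob W C m (\<lambda>t y r. True) \<le> msg_prob W C m (\<lambda>t y r. real (num_samples r y) / real (decision_time r y) \<le> 1)"
    proof (rule msg_prob_mono)
      fix t y r assume "r \<in> set_pmf (receiver C)"
      then show "real (num_samples r y) / real (decision_time r y) \<le> 1"
        using num_samples_le_decision_time[OF receiver_valid, of r y] by (simp add: divide_le_eq)
    qed
    then show ?thesis by (simp add: msg_prob_True)
  qed
  then have "1 - \<epsilon> \<le> msg_prob W C m (\<lambda>t y r. real (num_samples r y) / real (decision_time r y) \<le> 1)" for m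
    using assms by (meson diff_le_eq le_add_same_cancel1 order_trans)
  then show "1 \<in> {q. 0 \<le> q \<and> 1 - \<epsilon> \<le> (MIN m\<in>messages C. msg_prob W C m
      (\<lambda>t y r. real (num_samples r y) / real (decision_time r y) \<le> q))}"
    by auto
qed (auto intro!: bdd_belowI[of _ 0])

abbreviation in_time :: "real \<Rightarrow> int \<Rightarrow> bool" where
  "in_time \<epsilon> l \<equiv> (MIN m\<in>messages C. msg_prob W C m
     (decided_within l)) \<ge> 1 - \<epsilon>"

lemma in_time_mono: "in_time \<epsilon> l \<Longrightarrow> l \<le> l' \<Longrightarrow> in_time \<epsilon> l'"
proof -
  assume a: "in_time \<epsilon> l" "l \<le> l'"
  have "1 - \<epsilon> \<le> msg_prob W C m (decided_within l')" if "m \<in> messages C" for m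
  proof -
    have "1 - \<epsilon> \<le> msg_prob W C m (decided_within l)"
      using a(1) that by auto
    also have "\<dots> \<le> msg_prob W C m (decided_within l')"
      using a(2) by (intro msg_prob_mono) auto
    finally show ?thesis .
  qed
  then show ?thesis by auto
qed

text \<open>A set of integers need not have a least element, so \<open>LEAST\<close> must be
  justified. At \<open>- int (arrivals C)\<close> and below the event is impossible; shifting by the
  window size therefore reduces the minimum to one over the naturals.\<close>

lemma delay_props:
  assumes "0 < \<epsilon>" "\<epsilon> < 1"
  shows "in_time \<epsilon> (delay W C \<epsilon>)" "\<And>l. in_time \<epsilon> l \<Longrightarrow> delay W C \<epsilon> \<le> l"
proof -
  have low: "- int (arrivals C) < l" if l: "in_time \<epsilon> l" for l
  proof (rule ccontr)
    assume *: "\<not> ?thesis"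
    have 1: "1 \<in> messages C" by auto
    have "1 - \<epsilon> \<le> msg_prob W C 1 (decided_within l)"
      using l 1 by auto
    also have "\<dots> \<le> msg_prob W C 1 (\<lambda>t y r. False)"
    proof (rule msg_prob_mono)
      fix t y r assume "t \<in> {1..arrivals C}" "int (decision_time r y) - int t \<le> l - 1"
      then show False using * by auto
    qed
    finally show False using assms msg_prob_False by simp
  qed
  have ex: "in_time \<epsilon> (int (horizon C) + 1)"
  proof -
    have "1 - \<epsilon> \<le> msg_prob W C m (decided_within (int (horizon C) + 1))" for m
    proof -
      have "msg_prob W C m (\<lambda>t y r. True) \<le> msg_prob W C m (decided_within (int (horizon C) + 1))"
      proof (rule msg_prob_mono)
        fix t y r assume "r \<in> set_pmf (receiver C)"
        then show "int (decision_time r y) - int t \<le> int (horizon C) + 1 - 1"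
          using decision_time_range[OF receiver_valid, of r y] by auto
      qed
      then show ?thesis using assms msg_prob_True[of m] by simp
    qed
    then show ?thesis by auto
  qed
  define k where "k = (LEAST k. in_time \<epsilon> (int k - int (arrivals C)))"
  have ex': "in_time \<epsilon> (int (horizon C + 1 + arrivals C) - int (arrivals C))" using ex by simp
  have k: "in_time \<epsilon> (int k - int (arrivals C))"
    unfolding k_def by (rule LeastI[of "\<lambda>k. in_time \<epsilon> (int k - int (arrivals C))", OF ex'])
  have least: "int k - int (arrivals C) \<le> l" if l: "in_time \<epsilon> l" for l
  proof -
    have "in_time \<epsilon> (int (nat (l + arrivals C)) - int (arrivals C))" using l low[OF l] by simp
    then have "k \<le> nat (l + arrivals C)" unfolding k_def by (rule Least_le)
    then show ?thesis using low[OF l] by simp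
  qed
  have "delay W C \<epsilon> = int k - int (arrivals C)"
    unfolding delay_def by (rule Least_equality) (fact k, fact least)
  then show "in_time \<epsilon> (delay W C \<epsilon>)" "\<And>l. in_time \<epsilon> l \<Longrightarrow> delay W C \<epsilon> \<le> l"
    using k least by simp_all
qed

end

text \<open>The sampling times are distinct and positive, so the frequency never exceeds 1 and the
  same codes qualify at frequency 1.\<close>

lemma adaptive_capacity_le:
  fixes W :: "('a::finite, 'y::finite) channel"
  shows "adaptive_capacity W \<beta> \<rho> \<le> capacity W \<beta> 1"
  unfolding adaptive_capacity_def capacity_def restricted_capacity_def
proof (rule Sup_subset_mono, safe)
  fix R :: ennreal and \<C> :: "nat \<Rightarrow> ('a, 'y) code" and \<epsilon> :: "nat \<Rightarrow> real"
  assume a: "\<forall>B. adaptive_code (\<C> B)" "achieves W \<beta> \<rho> R \<C> \<epsilon>"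
  have "achieves W \<beta> 1 R \<C> \<epsilon>"
    unfolding achieves_def
  proof (intro conjI)
    show "\<forall>B. \<epsilon> B > 0" "\<epsilon> \<longlonglongrightarrow> 0" using a by (auto simp: achieves_def)
    have pos: "\<epsilon> B > 0" for B using a by (simp add: achieves_def)
    have "\<forall>\<^sub>F B in sequentially. valid_code W (\<C> B) \<and> bits (\<C> B) = B \<and>
        arrivals (\<C> B) = nat \<lceil>2 powr (\<beta> * real B)\<rceil> \<and>
        error_prob W (\<C> B) \<le> \<epsilon> B \<and>
        of_nat B / code_cost W (\<C> B) \<ge> R - ennreal (\<epsilon> B) \<and>
        sampling_frequency W (\<C> B) (\<epsilon> B) \<le> \<rho> + \<epsilon> B \<and>
        log 2 (real_of_int (delay W (\<C> B) (\<epsilon> B))) / real B \<le> \<epsilon> B"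
      using a(2) by (simp only: achieves_def)
    then show "\<forall>\<^sub>F B in sequentially. valid_code W (\<C> B) \<and> bits (\<C> B) = B \<and>
        arrivals (\<C> B) = nat \<lceil>2 powr (\<beta> * real B)\<rceil> \<and>
        error_prob W (\<C> B) \<le> \<epsilon> B \<and>
        of_nat B / code_cost W (\<C> B) \<ge> R - ennreal (\<epsilon> B) \<and>
        sampling_frequency W (\<C> B) (\<epsilon> B) \<le> 1 + \<epsilon> B \<and>
        log 2 (real_of_int (delay W (\<C> B) (\<epsilon> B))) / real B \<le> \<epsilon> B"
    proof eventually_elim
      case (elim B)
      then show ?case using sampling_frequency_le_1[of W "\<C> B" "\<epsilon> B"] pos[of B] by simp
    qed
  qed
  then show "\<exists>\<C> \<epsilon>. (\<forall>B. nonadaptive_code (\<C> B) \<or> adaptive_code (\<C> B)) \<and> achieves W \<beta> 1 R \<C> \<epsilon>"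
    using a by blast
qed

section \<open>From a single code to the capacity\<close>

lemma nonadaptive_code_imp_adaptive_code: "nonadaptive_code C \<Longrightarrow> adaptive_code C"
  using nonadaptive_imp_adaptive by (fastforce simp: nonadaptive_code_def adaptive_code_def)

text \<open>Only the idle symbol can be free, and a constant input carries no information.\<close>

lemma expected_cost_pos:
  fixes W :: "('a::finite, 'y::finite) channel"
  assumes ch: "async_channel W" and P: "set_pmf P \<subseteq> inputs W" and I: "mutual_info W P > 0"
  shows "expected_cost W P > 0"
proof (rule ccontr)
  assume "\<not> expected_cost W P > 0"
  then have "\<forall>x\<in>set_pmf P. symbol_cost W x = 0"
    by (simp add: expected_cost_def nn_integral_0_iff_AE AE_measure_pmf_iff)
  then have "set_pmf P \<subseteq> {idle W}"
    using ch P unfolding async_channel_def by force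
  then have "P = return_pmf (idle W)" by (simp add: set_pmf_subset_singleton)
  then show False using I by (simp add: mutual_info_eq output_law_def bind_return_pmf)
qed

text \<open>After division by \<open>n\<close> the hypotheses bound I and I + D per letter, while
  \<open>cost_bound\<close> bounds the cost per letter by the code cost. An infinite expected cost
  forces an infinite code cost, and an output impossible under the idle law makes the second
  quotient infinite.\<close>

lemma (in converse_setting) rate_bound_ge:
  fixes a \<beta> :: real
  assumes ch: "async_channel W" and \<beta>: "\<beta> > 0" and a: "0 < a"
    and I: "a * bits C \<le> real n * mutual_info W P"
    and J: "set_pmf (output_law W P) \<subseteq> set_pmf Qi \<Longrightarrow>
        (1 + \<beta>) * (a * bits C) \<le> real n * mean P (\<lambda>x. kl (trans W x) Qi)"
  shows "ennreal a * (of_nat (bits C) / code_cost W C) \<le> rate_bound W \<beta> P"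
proof (cases "expected_cost W P = \<top>")
  case True
  then have "code_cost W C = \<top>"
    using cost_bound basic by (simp add: ennreal_mult_top ennreal_mult_eq_top_iff top_unique)
  then show ?thesis by simp
next
  case False
  have n0: "real n > 0" and B0: "real (bits C) > 0" using basic by auto
  have I0: "mutual_info W P > 0"
    using I a B0 n0 by (meson less_le_trans mult_pos_pos zero_less_mult_pos)
  obtain e where e: "expected_cost W P = ennreal e" "e > 0"
    using False expected_cost_pos[OF ch set_P_inputs I0] by (cases "expected_cost W P") auto
  define b where "b = a * bits C / n"
  have bI: "b \<le> mutual_info W P" using I n0 by (simp add: b_def divide_le_eq mult.commute)
  have b0: "b > 0" using a B0 n0 by (simp add: b_def)
  have "ennreal a * (of_nat (bits C) / code_cost W C) \<le> ennreal a * (of_nat (bits C) / (of_nat n * expected_cost W P))"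
    using cost_bound by (intro mult_left_mono divide_left_mono_ennreal) auto
  also have "\<dots> = ennreal (b / e)"
    using a e n0 B0 by (simp add: b_def divide_ennreal ennreal_mult'[symmetric] ennreal_of_nat_eq_real_of_nat)
  also have "\<dots> \<le> rate_bound W \<beta> P"
    unfolding rate_bound_def
  proof (rule min.boundedI)
    have "ennreal (b / e) \<le> ennreal (mutual_info W P / e)"
      using bI e by (intro ennreal_leI divide_right_mono) auto
    then show "ennreal (b / e) \<le> ennreal (mutual_info W P) / expected_cost W P"
      using e I0 by (simp add: divide_ennreal)
    show "ennreal (b / e) \<le> (ennreal (mutual_info W P) + divergence (map_pmf snd (joint_pmf W P)) Qi) / (expected_cost W P * ennreal (1 + \<beta>))"
    proof (cases "set_pmf (output_law W P) \<subseteq> set_pmf Qi")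
      case True
      let ?D = "kl (output_law W P) Qi"
      have D0: "?D \<ge> 0" by (rule kl_nonneg[OF _ True]) simp
      have "(1 + \<beta>) * (a * bits C) \<le> real n * (mutual_info W P + ?D)"
        using J[OF True] compensation_identity[OF True] by simp
      then have "(1 + \<beta>) * b \<le> mutual_info W P + ?D"
        using n0 by (simp add: b_def field_simps)
      then have "(1 + \<beta>) * b / (e * (1 + \<beta>)) \<le> (mutual_info W P + ?D) / (e * (1 + \<beta>))"
        using e \<beta> by (intro divide_right_mono) auto
      then have "b / e \<le> (mutual_info W P + ?D) / (e * (1 + \<beta>))"
        using \<beta> by simp
      then have "ennreal (b / e) \<le> ennreal ((mutual_info W P + ?D) / (e * (1 + \<beta>)))" by (rule ennreal_leI)
      also have "\<dots> = (ennreal (mutual_info W P) + ennreal ?D) / (ennreal e * ennreal (1 + \<beta>))"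
        using e \<beta> I0 D0 by (simp add: divide_ennreal[symmetric] ennreal_mult' ennreal_plus)
      finally show ?thesis using True by (simp add: divergence_eq e)
    next
      case False
      then have "(ennreal (mutual_info W P) + divergence (map_pmf snd (joint_pmf W P)) Qi) / (expected_cost W P * ennreal (1 + \<beta>)) = \<top>"
        using e \<beta> by (simp add: divergence_eq ennreal_top_divide ennreal_mult'[symmetric] del: ennreal_plus)
      then show ?thesis by simp
    qed
  qed
  finally show ?thesis .
qed

definition max_rate :: "('a::finite, 'y::finite) channel \<Rightarrow> real \<Rightarrow> ennreal" where
  "max_rate W \<beta> = (SUP P\<in>{P. set_pmf P \<subseteq> inputs W}. rate_bound W \<beta> P)"

text \<open>\<open>a\<close> is the fraction of the \<open>B\<close> bits that survives:
  \<open>\<epsilon> * B + 1\<close> bits are lost to log (d + 1), a factor 1 - \<delta> to failures,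
  and one last bit to \<open>averaged_bound\<close>.\<close>

lemma converse_one_code:
  fixes W :: "('a::finite, 'y::finite) channel"
  assumes ch: "async_channel W" and \<beta>: "\<beta> > 0"
    and v: "valid_code W C" and ad: "adaptive_code C" and B: "bits C = B"
    and A: "arrivals C = nat \<lceil>2 powr (\<beta> * real B)\<rceil>" and err: "error_prob W C \<le> \<epsilon>"
    and dly: "log 2 (real_of_int (delay W C \<epsilon>)) / real B \<le> \<epsilon>"
    and \<epsilon>: "0 < \<epsilon>" "\<epsilon> < 1 / 4" and B4: "B \<ge> 4"
    and a: "a = (1 - (2 * \<epsilon> + 1 / 2 ^ B)) * (1 - \<epsilon> - 1 / B) - 1 / B" "a > 0"
  shows "ennreal a * (of_nat B / code_cost W C) \<le> max_rate W \<beta>"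
proof -
  \<comment> \<open>The delay is an integer that may be nonpositive, as a receiver may decide before
    the arrival; the counting arguments need a window of at least one time unit.\<close>
  define d where "d = nat (max 1 (delay W C \<epsilon>))"
  have B0: "real B > 0" using B4 by simp
  interpret converse_setting W C d \<epsilon>
  proof
    show "valid_code W C" "adaptive_code C" "error_prob W C \<le> \<epsilon>" by fact+
    show "1 \<le> d" by (simp add: d_def)
    show "1 - \<epsilon> \<le> (MIN m\<in>messages C. msg_prob W C m (decided_within (int d)))"
      by (rule in_time_mono[OF v delay_props(1)[OF v]]) (use \<epsilon> in \<open>auto simp: d_def\<close>)
  qed
  have d1: "real d \<ge> 1" using d by simp
  have ld: "log 2 (real d) \<le> \<epsilon> * B"
  proof (cases "delay W C \<epsilon> \<ge> 1")
    case True
    then have "real d = real_of_int (delay W C \<epsilon>)" by (simp add: d_def)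
    then show ?thesis using dly B0 by (simp add: divide_le_eq)
  next
    case False
    then have "d = 1" by (simp add: d_def)
    then show ?thesis using \<epsilon> B0 by simp
  qed
  have ld1: "log 2 (real d + 1) \<le> \<epsilon> * B + 1"
  proof -
    have "log 2 (real d + 1) \<le> log 2 (2 * real d)" using d1 by simp
    also have "\<dots> = 1 + log 2 (real d)" using d1 by (subst log_mult) auto
    finally show ?thesis using ld by simp
  qed
  have dM: "real d + 1 \<le> real M"
  proof -
    have "\<epsilon> * B + 1 \<le> real B"
    proof -
      have "\<epsilon> * B \<le> 1 / 4 * B" using \<epsilon> by (intro mult_right_mono) auto
      then show ?thesis using B4 by linarith
    qed
    then have "log 2 (real d + 1) \<le> B" using ld1 by linarith
    then have "real d + 1 \<le> 2 powr B" using d1 by (subst (asm) log_le_iff) auto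
    then show ?thesis by (simp add: B powr_realpow)
  qed
  have lM: "log 2 (real M) = B" by (simp add: B log_nat_power)
  have lA: "log 2 (real A) \<ge> \<beta> * B"
  proof -
    have "2 powr (\<beta> * B) \<le> real A" unfolding A by (simp add: of_nat_ceiling)
    then show ?thesis using basic(2) by (subst le_log_iff) auto
  qed
  have \<delta>1: "0 \<le> 1 - \<delta>" and \<delta>B: "\<delta> = 2 * \<epsilon> + 1 / 2 ^ B"
  proof -
    show *: "\<delta> = 2 * \<epsilon> + 1 / 2 ^ B" by (simp add: \<delta>_def B)
    have "(2::real) ^ 1 \<le> 2 ^ B" using B4 by (intro power_increasing) auto
    then have "1 / (2::real) ^ B \<le> 1 / 2" by (simp add: field_simps)
    then show "0 \<le> 1 - \<delta>" unfolding * using \<epsilon> by linarith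
  qed
  have aB: "a * B = (1 - \<delta>) * (B - \<epsilon> * B - 1) - 1"
    unfolding a(1) \<delta>B using B0 by (simp add: field_simps)
  have I: "a * bits C \<le> real n * mutual_info W P"
  proof -
    have "(1 - \<delta>) * (B - \<epsilon> * B - 1) \<le> (1 - \<delta>) * log 2 (real M / (real d + 1))"
      using ld1 \<delta>1 d1 by (intro mult_left_mono) (auto simp: log_divide lM simp del: of_nat_power)
    then show ?thesis using message_bound[OF dM] by (simp add: B aB)
  qed
  have J: "(1 + \<beta>) * (a * bits C) \<le> real n * mean P (\<lambda>x. kl (trans W x) Qi)"
    if ac: "set_pmf (output_law W P) \<subseteq> set_pmf Qi"
  proof -
    have A1: "real A \<ge> 1" using basic by simp
    have "real d \<le> real M * 1" using dM by linarith
    also have "\<dots> \<le> real M * real A" using A1 by (intro mult_left_mono) auto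
    finally have dMA: "real d \<le> real M * real A" .
    have "(1 + \<beta>) * (a * B) \<le> (1 - \<delta>) * ((1 + \<beta>) * (B - \<epsilon> * B - 1)) - 1"
      unfolding aB using \<beta> by (simp add: algebra_simps)
    also have "\<dots> \<le> (1 - \<delta>) * log 2 (real M * real A / real d) - 1"
    proof -
      have "log 2 (real M * real A / real d) = B + log 2 (real A) - log 2 (real d)"
        using d1 A1 by (simp add: log_divide log_mult lM del: of_nat_power)
      moreover have "(1 + \<beta>) * (B - \<epsilon> * B - 1) \<le> B + \<beta> * B - \<epsilon> * B"
        using \<beta> \<epsilon> B0 by (simp add: algebra_simps)
      ultimately have "(1 + \<beta>) * (B - \<epsilon> * B - 1) \<le> log 2 (real M * real A / real d)"
        using lA ld by linarith
      then show ?thesis using \<delta>1 by (intro diff_right_mono mult_left_mono)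
    qed
    also have "\<dots> \<le> real n * mean P (\<lambda>x. kl (trans W x) Qi)"
      by (rule timing_bound[OF ac dMA])
    finally show ?thesis by (simp add: B)
  qed
  have "ennreal a * (of_nat B / code_cost W C) \<le> rate_bound W \<beta> P"
    using rate_bound_ge[OF ch \<beta> a(2) I J] B by simp
  also have "\<dots> \<le> max_rate W \<beta>"
    unfolding max_rate_def using set_P_inputs by (intro SUP_upper) auto
  finally show ?thesis .
qed

theorem capacity_le_max_rate:
  fixes W :: "('a::finite, 'y::finite) channel"
  assumes ch: "async_channel W" and \<beta>: "\<beta> > 0"
  shows "capacity W \<beta> 1 \<le> max_rate W \<beta>"
  unfolding capacity_def restricted_capacity_def
proof (rule Sup_least, clarify)
  fix R :: ennreal and \<C> :: "nat \<Rightarrow> ('a, 'y) code" and \<epsilon> :: "nat \<Rightarrow> real"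
  assume cls: "\<forall>B. nonadaptive_code (\<C> B) \<or> adaptive_code (\<C> B)" and ach: "achieves W \<beta> 1 R \<C> \<epsilon>"
  define a where "a B = (1 - (2 * \<epsilon> B + 1 / 2 ^ B)) * (1 - \<epsilon> B - 1 / real B) - 1 / real B" for B
  have eps: "\<epsilon> \<longlonglongrightarrow> 0" "\<And>B. \<epsilon> B > 0" using ach by (auto simp: achieves_def)
  have p2: "(\<lambda>B. 1 / 2 ^ B :: real) \<longlonglongrightarrow> 0"
    using LIMSEQ_power_zero[of "1 / 2 :: real"] by (simp add: power_one_over)
  have "a \<longlonglongrightarrow> (1 - (2 * 0 + 0)) * (1 - 0 - 0) - 0"
    unfolding a_def by (intro tendsto_intros eps p2 lim_1_over_n)
  then have al: "a \<longlonglongrightarrow> 1" by simp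
  have ev: "\<forall>\<^sub>F B in sequentially. ennreal (a B) * (R - ennreal (\<epsilon> B)) \<le> max_rate W \<beta>"
  proof -
    have "\<forall>\<^sub>F B in sequentially. \<epsilon> B < 1 / 4" using eps by (intro order_tendstoD(2)[OF eps(1)]) auto
    moreover have "\<forall>\<^sub>F B in sequentially. a B > 0" by (intro order_tendstoD(1)[OF al]) auto
    moreover have "\<forall>\<^sub>F B in sequentially. (4::nat) \<le> B" by (rule eventually_ge_at_top)
    moreover note ach[unfolded achieves_def, THEN conjunct2, THEN conjunct2]
    ultimately show ?thesis
    proof eventually_elim
      case (elim B)
      then have "ennreal (a B) * (R - ennreal (\<epsilon> B)) \<le> ennreal (a B) * (of_nat B / code_cost W (\<C> B))"
        by (intro mult_left_mono) auto
      also have "\<dots> \<le> max_rate W \<beta>"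
        using elim eps(2)[of B] cls nonadaptive_code_imp_adaptive_code
        by (intro converse_one_code[OF ch \<beta>, of "\<C> B" B "\<epsilon> B"]) (auto simp: a_def)
      finally show ?case .
    qed
  qed
  have "(\<lambda>B. ennreal (\<epsilon> B)) \<longlonglongrightarrow> ennreal 0" by (intro tendsto_ennrealI eps)
  then have "(\<lambda>B. R - ennreal (\<epsilon> B)) \<longlonglongrightarrow> R - ennreal 0"
    by (cases "R = \<top>") (use tendsto_diff_ennreal[OF tendsto_const, of _ 0 sequentially R] in auto)
  moreover have "(\<lambda>B. ennreal (a B)) \<longlonglongrightarrow> ennreal 1" by (intro tendsto_ennrealI al)
  ultimately have "(\<lambda>B. ennreal (a B) * (R - ennreal (\<epsilon> B))) \<longlonglongrightarrow> ennreal 1 * (R - ennreal 0)"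
    by (intro tendsto_mult_ennreal) auto
  then have "ennreal 1 * (R - ennreal 0) \<le> max_rate W \<beta>"
    by (rule tendsto_upperbound) (use ev in auto)
  then show "R \<le> max_rate W \<beta>" by simp
qed

section \<open>Receivers from causal sampling sets\<close>

lemma set_take_sorted:
  assumes "sorted_wrt (<) (xs :: nat list)" "j < length xs"
  shows "set (take j xs) = {x \<in> set xs. x < xs ! j}"
proof (intro equalityI subsetI)
  fix x assume "x \<in> set (take j xs)"
  then obtain i where "i < j" "i < length xs" "x = xs ! i" by (auto simp: in_set_conv_nth)
  then show "x \<in> {x \<in> set xs. x < xs ! j}" using sorted_wrt_nth_less[OF assms(1), of i j] assms(2) by simp
next
  fix x assume "x \<in> {x \<in> set xs. x < xs ! j}"
  then obtain i where i: "i < length xs" "x = xs ! i" "xs ! i < xs ! j" by (auto simp: in_set_conv_nth)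
  have "i < j"
  proof (rule ccontr)
    assume "\<not> i < j"
    then show False using sorted_wrt_nth_less[OF assms(1), of j i] i by (cases "i = j") auto
  qed
  then show "x \<in> set (take j xs)" using i by (auto simp: in_set_conv_nth intro!: exI[of _ i])
qed

text \<open>A receiver given by the set \<open>T y\<close> of times it samples and the sets
  \<open>K y i\<close> of messages it accepts at time \<open>i\<close>, both as functions of the
  whole output sequence. The causality assumptions allow sampler, stopping rule and decoder to be
  recovered as functions of the list of samples. Time \<open>N\<close> is always sampled, so that a
  last time to stop exists.\<close>

locale sampling_scheme =
  fixes N :: nat and T :: "(nat \<Rightarrow> 'y) \<Rightarrow> nat set" and K :: "(nat \<Rightarrow> 'y) \<Rightarrow> nat \<Rightarrow> nat set"
  assumes N1: "1 \<le> N" and T_sub: "\<And>y. T y \<subseteq> {1..N}" and N_in: "\<And>y. N \<in> T y"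
    and T_causal: "\<And>y y' i. (\<And>j. j \<in> T y \<Longrightarrow> j < i \<Longrightarrow> y j = y' j) \<Longrightarrow> i \<in> T y \<Longrightarrow> i \<in> T y'"
    and K_causal: "\<And>y y' i. (\<And>j. j \<in> T y \<Longrightarrow> j \<le> i \<Longrightarrow> y j = y' j) \<Longrightarrow>
        T y \<inter> {..i} = T y' \<inter> {..i} \<Longrightarrow> K y i = K y' i"
begin

definition times :: "'y sampler" where
  "times y = sorted_list_of_set (T y)"

lemma finite_T: "finite (T y)"
  using T_sub finite_subset by blast

lemma times_props: "sorted_wrt (<) (times y)" "set (times y) = T y" "length (times y) = card (T y)"
  using finite_T[of y] by (simp_all add: times_def)

text \<open>If the next time for \<open>y\<close> came first, causality would put it into
  \<open>T y'\<close> below the next time for \<open>y'\<close>, hence into the common prefix; but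
  all times of that prefix are smaller. Stated in one direction and applied with the roles
  exchanged.\<close>

lemma next_time_eq:
  assumes "take j (times y) = take j (times y')" "map y (take j (times y)) = map y' (take j (times y))"
    "j < length (times y)" "j < length (times y')"
  shows "\<not> times y ! j < times y' ! j"
proof
  assume lt: "times y ! j < times y' ! j"
  note set_y = set_take_sorted[OF times_props(1) assms(3), unfolded times_props(2)]
  note set_y' = set_take_sorted[OF times_props(1) assms(4), unfolded times_props(2)]
  have "times y ! j \<in> T y'"
  proof (rule T_causal)
    show "times y ! j \<in> T y" using assms(3) times_props(2) nth_mem by blast
    show "y i = y' i" if "i \<in> T y" "i < times y ! j" for i
      using assms(2) that set_y by (simp add: map_eq_conv)
  qed
  then have "times y ! j \<in> set (take j (times y'))" using lt set_y' by simp
  then show False using assms(1) set_y by simp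
qed

text \<open>A stopping rule sees values without their times. By induction the values already
  determine the times, which makes the rules below well defined.\<close>

lemma prefix_eq:
  assumes "map y (take j (times y)) = map y' (take j (times y'))" "j \<le> length (times y)" "j \<le> length (times y')"
  shows "take j (times y) = take j (times y')"
  using assms
proof (induction j)
  case (Suc j)
  have l: "j < length (times y)" "j < length (times y')" using Suc.prems by auto
  then have "map y (take j (times y)) = map y' (take j (times y'))"
    using Suc.prems(1) by (simp add: take_Suc_conv_app_nth)
  then have IH: "take j (times y) = take j (times y')" using Suc l by simp
  have v: "map y (take j (times y)) = map y' (take j (times y))"
    using \<open>map y (take j (times y)) = map y' (take j (times y'))\<close> IH by simp
  have "\<not> times y ! j < times y' ! j" by (rule next_time_eq[OF IH v l])
  moreover have "\<not> times y' ! j < times y ! j"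
    by (rule next_time_eq[OF IH[symmetric] _ l(2,1)]) (use v IH in simp)
  ultimately show ?case using IH l by (simp add: take_Suc_conv_app_nth)
qed simp

text \<open>Both rules are read off from any output sequence that produces the list
  \<open>h\<close>; by \<open>K_prefix\<close> the choice is immaterial.\<close>

definition stop :: "'y stopping_rule" where
  "stop h \<longleftrightarrow> (\<exists>y j. 1 \<le> j \<and> j \<le> length (times y) \<and> h = map y (take j (times y)) \<and>
     (K y (times y ! (j - 1)) \<noteq> {} \<or> times y ! (j - 1) = N))"

definition decode :: "'y list \<Rightarrow> nat" where
  "decode h = (let X = (SOME X. \<exists>y j. 1 \<le> j \<and> j \<le> length (times y) \<and> h = map y (take j (times y)) \<and>
     X = K y (times y ! (j - 1))) in if X = {} then 1 else LEAST m. m \<in> X)"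

lemma K_prefix:
  assumes j: "1 \<le> j" "j \<le> length (times y)" and j': "j' \<le> length (times y')"
    and eq: "map y (take j (times y)) = map y' (take j' (times y'))"
  shows "j' = j" "times y ! (j - 1) = times y' ! (j - 1)" "K y (times y ! (j - 1)) = K y' (times y ! (j - 1))"
proof -
  show jj: "j' = j" using arg_cong[OF eq, of length] j j' by simp
  have pre: "take j (times y) = take j (times y')"
    using prefix_eq[of y j y'] eq j j' jj by simp
  show t: "times y ! (j - 1) = times y' ! (j - 1)"
    using arg_cong[OF pre, of "\<lambda>xs. xs ! (j - 1)"] j by simp
  have st: "set (take j (times z)) = T z \<inter> {..times z ! (j - 1)}" if "j \<le> length (times z)" for z
  proof -
    have l: "j - 1 < length (times z)" using j that by simp
    have "take j (times z) = take (j - 1) (times z) @ [times z ! (j - 1)]"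
      using take_Suc_conv_app_nth[OF l] j by simp
    then have "set (take j (times z)) = insert (times z ! (j - 1)) {x \<in> T z. x < times z ! (j - 1)}"
      using set_take_sorted[OF times_props(1) l] by (simp add: times_props(2))
    moreover have "times z ! (j - 1) \<in> T z" using nth_mem[OF l] times_props(2) by simp
    from this have "insert (times z ! (j - 1)) {x \<in> T z. x < times z ! (j - 1)} = T z \<inter> {..times z ! (j - 1)}"
      by auto
    ultimately show ?thesis by (simp only:)
  qed
  have Teq: "T y \<inter> {..times y ! (j - 1)} = T y' \<inter> {..times y ! (j - 1)}"
    using st[of y] st[of y'] j j' jj pre t by simp
  show "K y (times y ! (j - 1)) = K y' (times y ! (j - 1))"
  proof (rule K_causal[OF _ Teq])
    fix i assume "i \<in> T y" "i \<le> times y ! (j - 1)"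
    then have "i \<in> set (take j (times y))" using st[of y] j by auto
    then show "y i = y' i" using eq pre jj by (simp add: map_eq_conv)
  qed
qed

lemma stop_iff:
  assumes "1 \<le> j" "j \<le> length (times y)"
  shows "stop (map y (take j (times y))) \<longleftrightarrow> K y (times y ! (j - 1)) \<noteq> {} \<or> times y ! (j - 1) = N"
proof
  assume "stop (map y (take j (times y)))"
  then obtain y' j' where "1 \<le> j'" "j' \<le> length (times y')" "map y (take j (times y)) = map y' (take j' (times y'))"
    "K y' (times y' ! (j' - 1)) \<noteq> {} \<or> times y' ! (j' - 1) = N"
    unfolding stop_def by blast
  then show "K y (times y ! (j - 1)) \<noteq> {} \<or> times y ! (j - 1) = N"
    using K_prefix[OF assms, of j' y'] by metis
qed (use assms in \<open>auto simp: stop_def\<close>)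

lemma decode_eq:
  assumes "1 \<le> j" "j \<le> length (times y)"
  shows "decode (map y (take j (times y))) =
    (if K y (times y ! (j - 1)) = {} then 1 else LEAST m. m \<in> K y (times y ! (j - 1)))"
proof -
  have "(SOME X. \<exists>y' j'. 1 \<le> j' \<and> j' \<le> length (times y') \<and> map y (take j (times y)) = map y' (take j' (times y')) \<and>
     X = K y' (times y' ! (j' - 1))) = K y (times y ! (j - 1))"
  proof (rule some_equality)
    fix X assume "\<exists>y' j'. 1 \<le> j' \<and> j' \<le> length (times y') \<and> map y (take j (times y)) = map y' (take j' (times y')) \<and>
      X = K y' (times y' ! (j' - 1))"
    then obtain y' j' where *: "j' \<le> length (times y')" "map y (take j (times y)) = map y' (take j' (times y'))"
      "X = K y' (times y' ! (j' - 1))" by blast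
    then show "X = K y (times y ! (j - 1))" using K_prefix[OF assms *(1,2)] by metis
  qed (use assms in blast)
  then show ?thesis by (simp add: decode_def Let_def)
qed

lemma adaptive_times: "adaptive_sampler times"
proof -
  define g where "g h = (SOME x. \<exists>y j. j < length (times y) \<and> h = map y (take j (times y)) \<and> x = times y ! j)" for h
  have "times y ! j = g (map y (take j (times y)))" if j: "j < length (times y)" for y j
    unfolding g_def
  proof (rule some_equality[symmetric])
    fix x assume "\<exists>y' j'. j' < length (times y') \<and> map y (take j (times y)) = map y' (take j' (times y')) \<and> x = times y' ! j'"
    then obtain y' j' where *: "j' < length (times y')" "map y (take j (times y)) = map y' (take j' (times y'))" "x = times y' ! j'"
      by blast
    have jj: "j' = j" using arg_cong[OF *(2), of length] *(1) j by (simp add: min_absorb2)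
    have pre: "take j (times y) = take j (times y')"
      using prefix_eq[of y j y'] * j jj by simp
    have v: "map y (take j (times y)) = map y' (take j (times y))" using * jj pre by simp
    have "\<not> times y ! j < times y' ! j" by (rule next_time_eq[OF pre v j]) (use * jj in simp)
    moreover have "\<not> times y' ! j < times y ! j"
      by (rule next_time_eq[OF pre[symmetric]]) (use * jj v pre j in simp_all)
    ultimately show "x = times y ! j" using * jj by simp
  qed (use j in blast)
  then show ?thesis unfolding adaptive_sampler_def by blast
qed

lemma valid: "valid_receiver N (times, stop)"
  unfolding valid_receiver_def prod.case
proof (intro allI conjI)
  fix y
  show "sorted_wrt (<) (times y)" "set (times y) \<subseteq> {1..N}"
    using T_sub by (simp_all add: times_props)
  obtain i where i: "i < length (times y)" "times y ! i = N"
    using N_in[of y] times_props(2)[of y] by (metis in_set_conv_nth)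
  then have "stop (map y (take (i + 1) (times y)))" by (subst stop_iff) auto
  then show "\<exists>j\<in>{1..length (times y)}. stop (map y (take j (times y)))"
    using i by (intro bexI[of _ "i + 1"]) auto
qed

lemma num_samples_le: "num_samples (times, stop) y \<le> card (T y)"
  using num_samples_props(2)[OF valid, where y = y] by (simp add: times_props)

lemma decision_props:
  defines "i y \<equiv> decision_time (times, stop) y"
  shows "i y \<in> T y" "K y (i y) \<noteq> {} \<or> i y = N"
    "\<And>i'. i' \<in> T y \<Longrightarrow> i' < i y \<Longrightarrow> K y i' = {}"
    "decode (observed (times, stop) y) = (if K y (i y) = {} then 1 else LEAST m. m \<in> K y (i y))"
proof -
  define k where "k = num_samples (times, stop) y"
  note np = num_samples_props[OF valid, where y = y, folded k_def]
  have iy: "i y = times y ! (k - 1)" by (simp only: i_def decision_time.simps k_def)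
  have obs: "observed (times, stop) y = map y (take k (times y))" by (simp only: observed.simps k_def)
  show "i y \<in> T y" using nth_mem[of "k - 1" "times y"] np(1,2) times_props(2)[of y] iy by simp
  show "K y (i y) \<noteq> {} \<or> i y = N"
    using np(3) unfolding obs stop_iff[OF np(1,2)] iy .
  show "decode (observed (times, stop) y) = (if K y (i y) = {} then 1 else LEAST m. m \<in> K y (i y))"
    unfolding obs iy by (rule decode_eq[OF np(1,2)])
  fix i' assume i': "i' \<in> T y" "i' < i y"
  obtain j where j: "j < length (times y)" "times y ! j = i'"
    using i'(1) times_props(2)[of y] by (metis in_set_conv_nth)
  have "j + 1 < k"
  proof (rule ccontr)
    assume "\<not> j + 1 < k"
    then consider "j = k - 1" | "k - 1 < j" using np(1) by linarith
    then show False
      using sorted_wrt_nth_less[OF times_props(1), of "k - 1" j y] i' j iy by cases auto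
  qed
  show "K y i' = {}"
  proof (rule ccontr)
    assume "K y i' \<noteq> {}"
    then have "stop (map y (take (j + 1) (times y)))" using j by (subst stop_iff) auto
    then show False using np(4)[of "j + 1"] \<open>j + 1 < k\<close> by simp
  qed
qed

end

section \<open>Expurgated random codebooks\<close>

lemma expectation_pair_finite:
  fixes F :: "'b \<Rightarrow> 'c \<Rightarrow> real"
  assumes "finite (set_pmf p)" "finite (set_pmf q)"
  shows "mean (pair_pmf p q) (\<lambda>(x, y). F x y)
       = mean p (\<lambda>x. mean q (F x))"
proof -
  have "mean (pair_pmf p q) (\<lambda>(x, y). F x y)
      = (\<Sum>(x, y)\<in>set_pmf p \<times> set_pmf q. F x y * (pmf p x * pmf q y))"
    using assms by (subst integral_measure_pmf_real[of "set_pmf p \<times> set_pmf q"]) (auto simp: pmf_pair intro!: sum.cong)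
  also have "\<dots> = (\<Sum>x\<in>set_pmf p. \<Sum>y\<in>set_pmf q. F x y * (pmf p x * pmf q y))"
    by (rule sum.cartesian_product[symmetric])
  also have "\<dots> = mean p (\<lambda>x. mean q (F x))"
  proof -
    have q: "mean q (F x) = (\<Sum>y\<in>set_pmf q. F x y * pmf q y)" for x
      using assms by (intro integral_measure_pmf_real) auto
    have p: "mean p g = (\<Sum>x\<in>set_pmf p. g x * pmf p x)" for g :: "'b \<Rightarrow> real"
      using assms by (intro integral_measure_pmf_real) auto
    show ?thesis unfolding p q by (simp add: sum_distrib_left sum_distrib_right mult_ac)
  qed
  finally show ?thesis .
qed

lemma expectation_mono_finite:
  fixes f g :: "'b \<Rightarrow> real"
  assumes "finite (set_pmf p)" "\<And>x. x \<in> set_pmf p \<Longrightarrow> f x \<le> g x"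
  shows "mean p f \<le> mean p g"
  using assms by (intro integral_mono_AE integrable_measure_pmf_finite) (auto simp: AE_measure_pmf_iff)

lemma expectation_attained:
  fixes f :: "'b \<Rightarrow> real"
  assumes "finite (set_pmf p)"
  obtains x where "x \<in> set_pmf p" "f x \<le> mean p f"
proof -
  define x where "x = arg_min_on f (set_pmf p)"
  have x: "x \<in> set_pmf p" "\<And>y. y \<in> set_pmf p \<Longrightarrow> f x \<le> f y"
    using arg_min_if_finite[OF assms set_pmf_not_empty, of f] by (auto simp: x_def not_less)
  have "mean p (\<lambda>_. f x) \<le> mean p f"
    using assms x by (intro expectation_mono_finite) auto
  then show ?thesis using that[OF x(1)] by simp
qed

lemma expectation_Pi_pmf_two:
  fixes F :: "'c \<Rightarrow> 'c \<Rightarrow> real"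
  assumes "finite A" "i \<in> A" "j \<in> A" "i \<noteq> j" "finite (set_pmf p)"
  shows "mean (Pi_pmf A d (\<lambda>_. p)) (\<lambda>f. F (f i) (f j))
       = mean p (\<lambda>x. mean p (F x))"
proof -
  let ?P = "Pi_pmf {j} d (\<lambda>_. p)"
  have "mean (Pi_pmf A d (\<lambda>_. p)) (\<lambda>f. F (f i) (f j))
      = mean (Pi_pmf {i, j} d (\<lambda>_. p)) (\<lambda>f. F (f i) (f j))"
    using assms by (intro expectation_Pi_pmf_restrict) auto
  also have "Pi_pmf {i, j} d (\<lambda>_. p) = map_pmf (\<lambda>(x, f). f(i := x)) (pair_pmf p ?P)"
    using assms by (subst Pi_pmf_insert) auto
  also have "mean \<dots> (\<lambda>f. F (f i) (f j))
      = mean (pair_pmf p ?P) (\<lambda>(x, f). F x (f j))"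
    using assms by (subst integral_map_pmf) (auto intro!: arg_cong2[where f = "lebesgue_integral"])
  also have "\<dots> = mean p (\<lambda>x. mean ?P (\<lambda>f. F x (f j)))"
    using assms by (intro expectation_pair_finite finite_set_Pi_pmf) auto
  also have "\<dots> = mean p (\<lambda>x. mean p (F x))"
    by (simp add: expectation_Pi_pmf_component)
  finally show ?thesis .
qed

text \<open>Draw twice as many codewords as needed. Each has mean badness at most \<delta>, so some
  draw has total at most 2 M \<delta>, and at most \<open>M\<close> of its words exceed twice the
  mean. The other words are kept; deleting words only removes confusions. This turns the average
  guarantee into one for every message.\<close>

lemma expurgation:
  fixes p :: "'c pmf" and s :: "'c \<Rightarrow> real" and conf :: "'c \<Rightarrow> 'c \<Rightarrow> real"
  assumes fin: "finite (set_pmf p)"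
    and nn: "\<And>c. 0 \<le> s c" "\<And>c c'. 0 \<le> conf c c'"
    and good: "Pr p {c. \<not> good c} \<le> \<delta>\<^sub>0"
    and self: "mean p s \<le> \<delta>\<^sub>1"
    and conf: "\<And>c. c \<in> set_pmf p \<Longrightarrow> mean p (conf c) \<le> \<kappa>"
    and \<delta>: "\<delta>\<^sub>0 + \<delta>\<^sub>1 + 2 * real M * \<kappa> \<le> \<delta>" "0 < \<delta>" "\<delta> < 1 / 2" and M: "1 \<le> M"
  obtains c where "\<And>m. m \<in> {1..M} \<Longrightarrow> c m \<in> set_pmf p" "\<And>m. m \<in> {1..M} \<Longrightarrow> good (c m)"
    "\<And>m. m \<in> {1..M} \<Longrightarrow> s (c m) + (\<Sum>m'\<in>{1..M} - {m}. conf (c m) (c m')) \<le> 2 * \<delta>"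
proof -
  let ?I = "{1..2 * M}"
  let ?P = "Pi_pmf ?I undefined (\<lambda>_. p)"
  have finP: "finite (set_pmf ?P)" using fin by (intro finite_set_Pi_pmf) auto
  have intg: "integrable (measure_pmf ?P) g" for g :: "(nat \<Rightarrow> 'c) \<Rightarrow> real"
    using finP by (rule integrable_measure_pmf_finite)
  \<comment> \<open>A word that is not good counts 1, which is more than
    \<open>2 * \<delta>\<close>, so every kept word is good.\<close>
  define b where "b f m = indicator {c. \<not> good c} (f m) + s (f m) + (\<Sum>m'\<in>?I - {m}. conf (f m) (f m'))"
    for f :: "nat \<Rightarrow> 'c" and m
  obtain c0 where c0: "c0 \<in> set_pmf p" using set_pmf_not_empty by fast
  have \<kappa>0: "0 \<le> \<kappa>"
    using conf[OF c0] nn by (meson Bochner_Integration.integral_nonneg order_trans)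
  have Eb: "mean ?P (\<lambda>f. b f m) \<le> \<delta>" if m: "m \<in> ?I" for m
  proof -
    have "mean ?P (\<lambda>f. b f m) =
       mean ?P (\<lambda>f. indicator {c. \<not> good c} (f m)) + mean ?P (\<lambda>f. s (f m))
       + (\<Sum>m'\<in>?I - {m}. mean ?P (\<lambda>f. conf (f m) (f m')))"
      unfolding b_def using intg
      by (subst Bochner_Integration.integral_add, simp, simp, subst Bochner_Integration.integral_add, simp, simp,
          subst Bochner_Integration.integral_sum) auto
    also have "mean ?P (\<lambda>f. indicator {c. \<not> good c} (f m)) = Pr p {c. \<not> good c}"
      using m by (subst expectation_Pi_pmf_component) auto
    also have "mean ?P (\<lambda>f. s (f m)) = mean p s"
      using m by (subst expectation_Pi_pmf_component) auto
    also have "(\<Sum>m'\<in>?I - {m}. mean ?P (\<lambda>f. conf (f m) (f m'))) \<le> (\<Sum>m'\<in>?I - {m}. \<kappa>)"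
    proof (rule sum_mono)
      fix m' assume "m' \<in> ?I - {m}"
      then have "mean ?P (\<lambda>f. conf (f m) (f m')) = mean p (\<lambda>x. mean p (conf x))"
        using m fin by (intro expectation_Pi_pmf_two) auto
      also have "\<dots> \<le> mean p (\<lambda>x. \<kappa>)"
        using fin conf by (intro expectation_mono_finite) auto
      finally show "mean ?P (\<lambda>f. conf (f m) (f m')) \<le> \<kappa>" by simp
    qed
    also have "(\<Sum>m'\<in>?I - {m}. \<kappa>) \<le> 2 * real M * \<kappa>"
      using m \<kappa>0 by (simp add: mult_right_mono)
    finally show ?thesis using good self \<delta>(1) by linarith
  qed
  have "mean ?P (\<lambda>f. \<Sum>m\<in>?I. b f m) = (\<Sum>m\<in>?I. mean ?P (\<lambda>f. b f m))"
    by (intro Bochner_Integration.integral_sum intg)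
  also have "\<dots> \<le> (\<Sum>m\<in>?I. \<delta>)" by (intro sum_mono Eb)
  finally have "mean ?P (\<lambda>f. \<Sum>m\<in>?I. b f m) \<le> 2 * real M * \<delta>" by simp
  moreover obtain f where f1: "f \<in> set_pmf ?P"
    "(\<Sum>m\<in>?I. b f m) \<le> mean ?P (\<lambda>f. \<Sum>m\<in>?I. b f m)"
    by (rule expectation_attained[OF finP])
  ultimately have f: "f \<in> set_pmf ?P" "(\<Sum>m\<in>?I. b f m) \<le> 2 * real M * \<delta>"
    by auto
  have b0: "0 \<le> b f m" for m unfolding b_def using nn by (intro add_nonneg_nonneg sum_nonneg) auto
  define G where "G = {m \<in> ?I. b f m \<le> 2 * \<delta>}"
  have "card (?I - G) \<le> M"
  proof (rule ccontr)
    assume "\<not> card (?I - G) \<le> M"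
    then have "(real M + 1) * (2 * \<delta>) \<le> card (?I - G) * (2 * \<delta>)"
      using \<delta> by (intro mult_right_mono) auto
    also have "\<dots> = (\<Sum>m\<in>?I - G. 2 * \<delta>)" by simp
    also have "\<dots> \<le> (\<Sum>m\<in>?I - G. b f m)" by (intro sum_mono) (auto simp: G_def)
    also have "\<dots> \<le> (\<Sum>m\<in>?I. b f m)" by (intro sum_mono2 b0) auto
    also have "\<dots> \<le> 2 * real M * \<delta>" by (rule f)
    finally show False using \<delta> by (simp add: algebra_simps)
  qed
  moreover have "card (?I - G) = 2 * M - card G" by (subst card_Diff_subset) (auto simp: G_def)
  ultimately have "M \<le> card G" by simp
  then obtain G' where G': "G' \<subseteq> G" "card G' = M" by (meson obtain_subset_with_card_n)
  moreover have "finite G" by (simp add: G_def)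
  ultimately have "finite G'" "card {1..M} = card G'" using finite_subset by auto
  then obtain h where h: "bij_betw h {1..M} G'" using finite_same_card_bij[of "{1..M}" G'] by auto
  have hG: "h m \<in> G" if "m \<in> {1..M}" for m using h G' that bij_betwE by blast
  show ?thesis
  proof (rule that[of "\<lambda>m. f (h m)"])
    fix m assume m: "m \<in> {1..M}"
    have hI: "h m \<in> ?I" using hG[OF m] by (simp add: G_def)
    have bm: "b f (h m) \<le> 2 * \<delta>" using hG[OF m] by (simp add: G_def)
    show "f (h m) \<in> set_pmf p" using f(1) hI by (auto simp: set_Pi_pmf PiE_dflt_def)
    show "good (f (h m))"
    proof (rule ccontr)
      assume "\<not> good (f (h m))"
      then have "1 \<le> b f (h m)" unfolding b_def using nn by (simp add: sum_nonneg)
      then show False using bm \<delta> by simp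
    qed
    have "(\<Sum>m'\<in>{1..M} - {m}. conf (f (h m)) (f (h m'))) = (\<Sum>i\<in>h ` ({1..M} - {m}). conf (f (h m)) (f i))"
      using h by (subst sum.reindex) (auto simp: bij_betw_def intro: inj_on_subset)
    also have "\<dots> \<le> (\<Sum>i\<in>?I - {h m}. conf (f (h m)) (f i))"
    proof (rule sum_mono2)
      have "h m' \<noteq> h m" if "m' \<in> {1..M} - {m}" for m'
        using inj_onD[OF bij_betw_imp_inj_on[OF h], of m' m] m that by blast
      moreover have "h m' \<in> ?I" if "m' \<in> {1..M} - {m}" for m' using hG[of m'] that by (simp add: G_def)
      ultimately show "h ` ({1..M} - {m}) \<subseteq> ?I - {h m}"
        by (intro image_subsetI DiffI) auto
    qed (auto simp: nn)
    finally show "s (f (h m)) + (\<Sum>m'\<in>{1..M} - {m}. conf (f (h m)) (f (h m'))) \<le> 2 * \<delta>"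
      using bm unfolding b_def by (cases "good (f (h m))") auto
  qed
qed

section \<open>Preamble detection and dense sampling\<close>

text \<open>
  Codewords start with a preamble of length \<open>2 * L\<close>. Every \<open>L\<close> time units the receiver probes
  \<open>w\<close> outputs; if the letter \<open>y0\<close> is frequent among them it samples densely for a while.
  \<open>crit m b\<close> compares the outputs with codeword \<open>m\<close> started at time \<open>b\<close>: the ratio \<open>g\<close> excludes pure
  noise, the ratio \<open>h\<close> excludes other messages, and \<open>h\<close> on the last \<open>n2\<close> letters excludes
  misaligned copies of the sent codeword itself.
\<close>

locale scheme_params =
  fixes A L w n n2 :: nat and y0 :: "'y::finite" and \<theta> G H F :: real
    and g h :: "'a::finite \<Rightarrow> 'y \<Rightarrow> real"
  assumes A1: "1 \<le> A" and w: "1 \<le> w" "w \<le> L" and n2: "1 \<le> n2" "2 * L + n2 \<le> n"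
begin

definition "N = A + n - 1"

definition slot :: "nat \<Rightarrow> nat set" where "slot k = {k * L + 1..k * L + w}"

abbreviation freq :: "nat \<Rightarrow> (nat \<Rightarrow> 'y) \<Rightarrow> real" where
  "freq k y \<equiv> \<Sum>i\<in>slot k. of_bool (y i = y0)"

definition pos :: "nat \<Rightarrow> (nat \<Rightarrow> 'y) \<Rightarrow> bool" where
  "pos k y \<longleftrightarrow> \<theta> \<le> freq k y"

text \<open>A positive slot \<open>k\<close> triggers sampling up to \<open>k * L + n\<close>, which
  reaches the end of every codeword that started by time \<open>k * L + 1\<close>.\<close>

definition T :: "(nat \<Rightarrow> 'y) \<Rightarrow> nat set" where
  "T y = {i \<in> {1..N}. (\<exists>k. i \<in> slot k) \<or> i = N \<or> (\<exists>k. pos k y \<and> k * L + w < i \<and> i \<le> k * L + n)}"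

text \<open>The first \<open>2 * L\<close> letters are left out: outputs before the end of the
  positive probe need not have been sampled.\<close>

definition match_g :: "(nat \<Rightarrow> 'a) \<Rightarrow> nat \<Rightarrow> (nat \<Rightarrow> 'y) \<Rightarrow> bool" where
  "match_g x b y \<longleftrightarrow> G \<le> (\<Prod>i\<in>{b + 2 * L..b + n - 1}. g (x (i + 1 - b)) (y i))"

definition match_h :: "(nat \<Rightarrow> 'a) \<Rightarrow> nat \<Rightarrow> (nat \<Rightarrow> 'y) \<Rightarrow> bool" where
  "match_h x b y \<longleftrightarrow> H \<le> (\<Prod>i\<in>{b + 2 * L..b + n - 1}. h (x (i + 1 - b)) (y i))"

definition match_end :: "(nat \<Rightarrow> 'a) \<Rightarrow> nat \<Rightarrow> (nat \<Rightarrow> 'y) \<Rightarrow> bool" where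
  "match_end x b y \<longleftrightarrow> F \<le> (\<Prod>i\<in>{b + n - n2..b + n - 1}. h (x (i + 1 - b)) (y i))"

lemma n1: "1 \<le> n" "n2 \<le> n" using n2 by auto

text \<open>The ceiling of (t - 1) / L: the first slot that begins at or after \<open>t\<close>. It
  begins fewer than \<open>L\<close> units after \<open>t\<close> and has width at most
  \<open>L\<close>, so it lies inside the preamble; this is why the preamble has length
  \<open>2 * L\<close>.\<close>

definition probe :: "nat \<Rightarrow> nat" where "probe t = (t + L - 2) div L"

lemma probe:
  assumes "1 \<le> t"
  shows "t \<le> probe t * L + 1" "probe t * L + w \<le> t + 2 * L - 1"
proof -
  have L: "1 \<le> L" using w by simp
  have "probe t * L \<le> t + L - 2" unfolding probe_def by simp
  moreover have "t + L - 2 < probe t * L + L"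
    unfolding probe_def using L by (metis add.commute div_mult_mod_eq mod_less_divisor nat_add_left_cancel_less zero_less_one order_less_le_trans)
  ultimately show "t \<le> probe t * L + 1" "probe t * L + w \<le> t + 2 * L - 1"
    using assms w L by linarith+
qed

lemma card_T_le:
  "card (T y) \<le> w * (N div L + 1) + 1 + n * card {k \<in> {..N div L}. pos k y}"
proof -
  let ?k = "{..N div L}"
  have L: "1 \<le> L" using w by simp
  have kr: "k \<in> ?k" if "k * L < i" "i \<le> N" for k i
  proof -
    have "k * L div L \<le> N div L" using that by (intro div_le_mono) simp
    then show ?thesis using L by simp
  qed
  have "T y \<subseteq> (\<Union>k\<in>?k. slot k) \<union> {N} \<union> (\<Union>k\<in>{k \<in> ?k. pos k y}. {k * L + 1..k * L + n})"
  proof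
    fix i assume i: "i \<in> T y"
    then have iN: "i \<le> N" by (auto simp: T_def)
    from i consider k where "i \<in> slot k" | "i = N" | k where "pos k y" "k * L + w < i" "i \<le> k * L + n"
      by (auto simp: T_def)
    then show "i \<in> (\<Union>k\<in>?k. slot k) \<union> {N} \<union> (\<Union>k\<in>{k \<in> ?k. pos k y}. {k * L + 1..k * L + n})"
    proof cases
      case (1 k)
      then have "k \<in> ?k" using kr[of k i] iN by (auto simp: slot_def)
      then show ?thesis using 1 by blast
    next
      case (3 k)
      then have "k \<in> {k \<in> ?k. pos k y}" "i \<in> {k * L + 1..k * L + n}" using kr[of k i] iN by auto
      then show ?thesis by blast
    qed simp
  qed
  then have "card (T y) \<le> card ((\<Union>k\<in>?k. slot k) \<union> {N} \<union> (\<Union>k\<in>{k \<in> ?k. pos k y}. {k * L + 1..k * L + n}))"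
    by (intro card_mono) (auto simp: slot_def)
  also have "\<dots> \<le> (card (\<Union>k\<in>?k. slot k) + card {N}) + card (\<Union>k\<in>{k \<in> ?k. pos k y}. {k * L + 1..k * L + n})"
    by (intro order.trans[OF card_Un_le] add_right_mono card_Un_le)
  also have "card (\<Union>k\<in>?k. slot k) \<le> (\<Sum>k\<in>?k. card (slot k))" by (intro card_UN_le) auto
  also have "(\<Sum>k\<in>?k. card (slot k)) = w * (N div L + 1)" by (simp add: slot_def)
  also have "card (\<Union>k\<in>{k \<in> ?k. pos k y}. {k * L + 1..k * L + n}) \<le> (\<Sum>k\<in>{k \<in> ?k. pos k y}. card {k * L + 1..k * L + n})"
    by (intro card_UN_le) auto
  also have "\<dots> = n * card {k \<in> ?k. pos k y}" by simp
  finally show ?thesis by simp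
qed

end

locale code_scheme = scheme_params A L w n n2 y0 \<theta> G H F g h
  for A L w n n2 and y0 :: "'y::finite" and \<theta> G H F and g h :: "'a::finite \<Rightarrow> 'y \<Rightarrow> real" +
  fixes B :: nat and c :: "nat \<Rightarrow> nat \<Rightarrow> 'a"
begin

definition crit :: "nat \<Rightarrow> nat \<Rightarrow> (nat \<Rightarrow> 'y) \<Rightarrow> bool" where
  "crit m b y \<longleftrightarrow> match_g (c m) b y \<and> match_h (c m) b y \<and> match_end (c m) b y"

text \<open>The guard \<open>n \<le> i\<close> makes the presumed start \<open>i + 1 - n\<close> a
  genuine difference, at least 1.\<close>

definition K :: "(nat \<Rightarrow> 'y) \<Rightarrow> nat \<Rightarrow> nat set" where
  "K y i = {m \<in> {1..2 ^ B}. n \<le> i \<and> {i + 1 - n + 2 * L..i} \<subseteq> T y \<and> crit m (i + 1 - n) y}"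

lemma crit_cong:
  assumes "\<And>i. i \<in> {b + 2 * L..b + n - 1} \<Longrightarrow> y i = y' i"
  shows "crit m b y = crit m b y'"
proof -
  have "{b + n - n2..b + n - 1} \<subseteq> {b + 2 * L..b + n - 1}" using n2 by auto
  then show ?thesis
    unfolding crit_def match_g_def match_h_def match_end_def using assms
    by (intro arg_cong2[where f = "(\<and>)"] arg_cong[where f = "\<lambda>z. _ \<le> z"] prod.cong) auto
qed

sublocale sampling_scheme N T K
proof
  show "1 \<le> N" using A1 n1 by (simp add: N_def)
  show "T y \<subseteq> {1..N}" for y by (auto simp: T_def)
  show "N \<in> T y" for y using A1 n1 by (simp add: T_def N_def)
  show "i \<in> T y'" if agree: "\<And>j. j \<in> T y \<Longrightarrow> j < i \<Longrightarrow> y j = y' j" and i: "i \<in> T y" for y y' i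
  proof -
    have "pos k y'" if k: "pos k y" "k * L + w < i" for k
    proof -
      \<comment> \<open>Slots are sampled unconditionally and lie before every time that they
        trigger, so the two output sequences agree on them.\<close>
      have "slot k \<subseteq> T y" using k i by (auto simp: T_def slot_def)
      then have "y j = y' j" if "j \<in> slot k" for j
        using agree[of j] that k(2) by (auto simp: slot_def)
      then have "freq k y = freq k y'"
        by (intro sum.cong) auto
      then show ?thesis using k by (simp add: pos_def)
    qed
    then show ?thesis using i unfolding T_def by blast
  qed
  show "K y i = K y' i" if agree: "\<And>j. j \<in> T y \<Longrightarrow> j \<le> i \<Longrightarrow> y j = y' j" and T: "T y \<inter> {..i} = T y' \<inter> {..i}"
    for y y' i
  proof -
    have win: "{i + 1 - n + 2 * L..i} \<subseteq> T y \<longleftrightarrow> {i + 1 - n + 2 * L..i} \<subseteq> T y'"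
      using T by (auto simp: set_eq_iff subset_iff)
    have "crit m (i + 1 - n) y = crit m (i + 1 - n) y'"
      if "n \<le> i" "{i + 1 - n + 2 * L..i} \<subseteq> T y" for m
      using that by (intro crit_cong agree) auto
    then show ?thesis unfolding K_def using win by blast
  qed
qed

text \<open>Transmission starts on arrival. The fallback message 1 keeps the range of the decoder
  right on lists that no receiver run produces.\<close>

definition code :: "('a, 'y) code" where
  "code = \<lparr>bits = B, arrivals = A, blocklength = n, codeword = c, start_time = (\<lambda>t m. t),
     receiver = return_pmf (times, stop), decoder = (\<lambda>z. if decode z \<in> {1..2 ^ B} then decode z else 1)\<rparr>"

lemma code_simps [simp]:
  "bits code = B" "arrivals code = A" "blocklength code = n" "codeword code = c" "start_time code = (\<lambda>t m. t)"
  "receiver code = return_pmf (times, stop)" "decoder code = (\<lambda>z. if decode z \<in> {1..2 ^ B} then decode z else 1)"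
  by (simp_all add: code_def)

lemma horizon_code [simp]: "horizon code = N"
  by (simp add: horizon_def N_def)

lemma adaptive_code_code: "adaptive_code code"
  by (simp add: adaptive_code_def adaptive_times)

lemma valid_code_code:
  assumes "1 \<le> B" "\<And>m i. m \<in> {1..2 ^ B} \<Longrightarrow> i \<in> {1..n} \<Longrightarrow> c m i \<in> inputs W"
  shows "valid_code W code"
  using assms A1 n1 valid by (auto simp: valid_code_def)

text \<open>The deterministic core. The sent word is accepted at its end at the latest, so only
  windows starting by \<open>t\<close> matter. Those ending before \<open>t\<close> see pure noise
  and are excluded by \<open>g\<close>; overlapping ones for another message are excluded by
  \<open>h\<close>, and for the sent message by the end test if shifted by at least
  \<open>n2\<close>. What remains is the right message at most \<open>n2 - 1\<close> units
  early.\<close>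

lemma good_path:
  assumes m: "m \<in> {1..2 ^ B}" and t: "t \<in> {1..A}"
    and p: "pos (probe t) y" and own: "crit m t y"
    and noise: "\<And>m' b. m' \<in> {1..2 ^ B} \<Longrightarrow> 1 \<le> b \<Longrightarrow> b + n \<le> t \<Longrightarrow> \<not> match_g (c m') b y"
    and other: "\<And>m' b. m' \<in> {1..2 ^ B} \<Longrightarrow> m' \<noteq> m \<Longrightarrow> 1 \<le> b \<Longrightarrow> t < b + n \<Longrightarrow> b \<le> t \<Longrightarrow> \<not> match_h (c m') b y"
    and self: "\<And>b. 1 \<le> b \<Longrightarrow> t < b + n \<Longrightarrow> b + n2 \<le> t \<Longrightarrow> \<not> match_end (c m) b y"
  shows "decision_time (times, stop) y < t + n" "t + n \<le> decision_time (times, stop) y + n2"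
    "decoder code (observed (times, stop) y) = m"
proof -
  define i where "i = decision_time (times, stop) y"
  note dp = decision_props[where y = y, folded i_def]
  define e where "e = t + n - 1"
  have eN: "e \<le> N" "n \<le> e" using t n1 by (auto simp: e_def N_def)
  have win: "{t + 2 * L..e} \<subseteq> T y"
  proof
    fix j assume "j \<in> {t + 2 * L..e}"
    then have "probe t * L + w < j" "j \<le> probe t * L + n" "1 \<le> j" "j \<le> N"
      using probe[of t] t eN w n2 by (auto simp: e_def)
    then show "j \<in> T y" using p by (auto simp: T_def)
  qed
  have eb: "e + 1 - n = t" using n1 t by (simp add: e_def)
  have mK: "m \<in> K y e" unfolding K_def eb using m eN win own by simp
  have eT: "e \<in> T y"
  proof -
    have "e \<in> {t + 2 * L..e}" using n2 by (auto simp: e_def)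
    then show ?thesis using win by blast
  qed
  have ie: "i \<le> e"
  proof (rule ccontr)
    assume "\<not> i \<le> e"
    then have "K y e = {}" using dp(3)[OF eT] by simp
    then show False using mK by simp
  qed
  have Kne: "K y i \<noteq> {}"
  proof
    assume *: "K y i = {}"
    then have "i = N" using dp(2) by simp
    then have "i = e" using ie eN by simp
    then show False using * mK by simp
  qed
  have mem: "m' = m \<and> t + n \<le> i + n2" if m': "m' \<in> K y i" for m'
  proof -
    define b where "b = i + 1 - n"
    have mr: "m' \<in> {1..2 ^ B}" and cr: "crit m' b y" and ni: "n \<le> i"
      using m' by (auto simp: K_def b_def)
    have b1: "1 \<le> b" "b \<le> t" using ni ie t n1 by (auto simp: b_def e_def)
    have tb: "t < b + n" using noise[OF mr b1(1)] cr by (meson crit_def not_less)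
    have mm: "m' = m" using other[OF mr _ b1(1) tb b1(2)] cr by (auto simp: crit_def)
    moreover have "\<not> b + n2 \<le> t" using self[OF b1(1) tb] cr mm by (auto simp: crit_def)
    ultimately show ?thesis using ni by (auto simp: b_def)
  qed
  then have Keq: "K y i = {m}" using Kne by blast
  show "decision_time (times, stop) y < t + n" using ie n1 t by (auto simp: e_def i_def)
  show "t + n \<le> decision_time (times, stop) y + n2" using mem[of m] Keq by (simp add: i_def)
  have "decode (observed (times, stop) y) = m"
    using dp(4) Keq Least_equality[of "\<lambda>z. z = m" m] by simp
  then show "decoder code (observed (times, stop) y) = m" using m by simp
qed

end

section \<open>Random codewords and the failure probabilities of the tests\<close>

abbreviation mean_log :: "('a, 'y) channel \<Rightarrow> ('a \<Rightarrow> 'y \<Rightarrow> real) \<Rightarrow> 'a \<Rightarrow> real" where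
  "mean_log W f \<equiv> \<lambda>x. mean (trans W x) (\<lambda>y. log 2 (f x y))"

lemma expectation_prod_subset:
  fixes f :: "'i \<Rightarrow> 'b \<Rightarrow> real"
  assumes "finite A" "J \<subseteq> A" "\<And>i. i \<in> A \<Longrightarrow> finite (set_pmf (p i))" "\<And>i x. i \<in> J \<Longrightarrow> 0 \<le> f i x"
  shows "mean (Pi_pmf A d p) (\<lambda>y. \<Prod>i\<in>J. f i (y i)) = (\<Prod>i\<in>J. mean (p i) (f i))"
proof -
  have "mean (Pi_pmf A d p) (\<lambda>y. \<Prod>i\<in>J. f i (y i))
      = mean (Pi_pmf J d p) (\<lambda>y. \<Prod>i\<in>J. f i (y i))"
    using assms by (intro expectation_Pi_pmf_restrict prod.cong arg_cong2[where f = f]) auto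
  also have "\<dots> = (\<Prod>i\<in>J. mean (p i) (f i))"
    using assms finite_subset[OF assms(2,1)]
    by (intro expectation_prod_Pi_pmf integrable_measure_pmf_finite) auto
  finally show ?thesis .
qed

lemma prob_UN_le:
  assumes "finite I"
  shows "Pr p (\<Union>i\<in>I. E i) \<le> (\<Sum>i\<in>I. Pr p (E i))"
  using assms by (intro measure_pmf.finite_measure_subadditive_finite) auto

lemma prob_subset_le: "E \<subseteq> E' \<Longrightarrow> Pr p E \<le> Pr p E'"
  by (intro measure_pmf.finite_measure_mono) auto

text \<open>\<open>\<theta>\<close> is \<open>w\<close> times the midpoint of the probabilities of
  \<open>y0\<close> under the idle symbol and under \<open>x0\<close>, so either side keeps a margin
  \<open>gap\<close>. \<open>g_idle\<close> and \<open>h_avg\<close> are the normalisations of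
  likelihood ratios needed for Markov's inequality; \<open>a\<close> is the fluctuation allowed to
  each source of randomness, and \<open>c0\<close> the common range for Hoeffding's
  inequality.\<close>

locale coding_setting = scheme_params A L w n n2 y0 \<theta> G H F g h
  for A L w n n2 and y0 :: "'y::finite" and \<theta> G H F and g h :: "'a::finite \<Rightarrow> 'y \<Rightarrow> real" +
  fixes W :: "('a, 'y) channel" and P :: "'a pmf" and x0 :: 'a and a c0 :: real and k :: "'a \<Rightarrow> real"
  assumes x0: "x0 \<in> set_pmf P" "pmf (trans W (idle W)) y0 < pmf (trans W x0) y0"
    and \<theta>: "\<theta> = w * ((pmf (trans W (idle W)) y0 + pmf (trans W x0) y0) / 2)"
    and nonneg: "\<And>x y. 0 \<le> g x y" "\<And>x y. 0 \<le> h x y"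
    and thr: "0 < G" "0 < H" "0 < F" "0 \<le> a" "0 < c0"
    and g_idle: "\<And>x. x \<in> set_pmf P \<Longrightarrow> mean (trans W (idle W)) (g x) \<le> 1"
    and h_avg: "\<And>y. mean P (\<lambda>x. h x y) \<le> 1"
    and logs: "\<And>x y. x \<in> set_pmf P \<Longrightarrow> y \<in> set_pmf (trans W x) \<Longrightarrow>
        0 < g x y \<and> 0 < h x y \<and> \<bar>log 2 (g x y)\<bar> \<le> c0 \<and> \<bar>log 2 (h x y)\<bar> \<le> c0"
    and cost: "\<And>x. x \<in> set_pmf P \<Longrightarrow> \<bar>k x\<bar> \<le> c0"
begin

abbreviation "Qi \<equiv> trans W (idle W)"
abbreviation "gap \<equiv> real w * ((pmf (trans W x0) y0 - pmf Qi y0) / 2)"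

definition inp :: "(nat \<Rightarrow> 'a) \<Rightarrow> nat \<Rightarrow> nat \<Rightarrow> 'a" where
  "inp x t i = (if t \<le> i \<and> i \<le> t + n - 1 then x (i - t + 1) else idle W)"

definition law :: "(nat \<Rightarrow> 'a) \<Rightarrow> nat \<Rightarrow> (nat \<Rightarrow> 'y) pmf" where
  "law x t = Pi_pmf {1..N} undefined (\<lambda>i. trans W (inp x t i))"

definition letter :: "nat \<Rightarrow> 'a pmf" where
  "letter j = (if j \<le> 2 * L then return_pmf x0 else P)"

definition codeword_law :: "(nat \<Rightarrow> 'a) pmf" where
  "codeword_law = Pi_pmf {1..n} undefined letter"

definition \<mu>g :: "'a \<Rightarrow> real" where "\<mu>g x = mean_log W g x"
definition \<mu>h :: "'a \<Rightarrow> real" where "\<mu>h x = mean_log W h x"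

text \<open>Hoeffding for \<open>w\<close> indicators and deviation \<open>gap\<close>, that is,
  half of \<open>w\<close> times the difference of the probabilities; this gives the 8.
  \<open>window_err\<close> is the same for at most \<open>n\<close> terms bounded by
  \<open>c0\<close> and deviation \<open>a\<close>.\<close>

definition "probe_err = exp (- (w * (pmf (trans W x0) y0 - pmf Qi y0)\<^sup>2 / 8))"
definition "window_err = exp (- (a\<^sup>2 / (2 * c0\<^sup>2 * n)))"

text \<open>Concentration is split in two stages. A good word keeps its conditional mean log ratios
  above the thresholds by \<open>a\<close>, which is left for the channel noise; the draw of the
  word uses another \<open>a\<close>, whence the \<open>2 * a\<close> in
  \<open>good_likely\<close>.\<close>

definition good :: "(nat \<Rightarrow> 'a) \<Rightarrow> bool" where
  "good x \<longleftrightarrow> log 2 G + a < (\<Sum>j\<in>{2 * L + 1..n}. \<mu>g (x j)) \<and> log 2 H + a < (\<Sum>j\<in>{2 * L + 1..n}. \<mu>h (x j)) \<and>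
     log 2 F + a < (\<Sum>j\<in>{n - n2 + 1..n}. \<mu>h (x j)) \<and>
     (\<Sum>j\<in>{1..n}. k (x j)) < (\<Sum>j\<in>{1..n}. mean (letter j) k) + a"

lemma finite_codeword_law: "finite (set_pmf codeword_law)"
  unfolding codeword_law_def by (intro finite_set_Pi_pmf) auto

lemma codeword_letter:
  assumes "x \<in> set_pmf codeword_law" "j \<in> {1..n}"
  shows "x j \<in> set_pmf P" "j \<le> 2 * L \<Longrightarrow> x j = x0"
  using assms x0 by (auto simp: codeword_law_def set_Pi_pmf PiE_dflt_def letter_def split: if_splits)

lemma inp_in: "x \<in> set_pmf codeword_law \<Longrightarrow> i \<in> {t..t + n - 1} \<Longrightarrow> inp x t i = x (i + 1 - t) \<and> i + 1 - t \<in> {1..n}"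
  using n1 by (auto simp: inp_def Suc_diff_le)

lemma tail_mono:
  assumes "J \<noteq> {}" "finite J" "card J \<le> n"
  shows "exp (- (a\<^sup>2 / (2 * c0\<^sup>2 * card J))) \<le> window_err"
proof -
  have "0 < card J" using assms by (simp add: card_gt_0_iff)
  then have "a\<^sup>2 / (2 * c0\<^sup>2 * n) \<le> a\<^sup>2 / (2 * c0\<^sup>2 * card J)"
    using assms thr by (intro divide_left_mono mult_left_mono mult_pos_pos) auto
  then show ?thesis by (simp add: window_err_def)
qed

lemma slot_sum_expectation:
  assumes "\<And>i. i \<in> slot j \<Longrightarrow> inp x t i = z"
  shows "(\<Sum>i\<in>slot j. mean (trans W (inp x t i)) (\<lambda>y. of_bool (y = y0))) = w * pmf (trans W z) y0"
proof -
  have "mean (trans W z) (\<lambda>y. of_bool (y = y0)) = pmf (trans W z) y0"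
  proof -
    have "(\<lambda>y. of_bool (y = y0) :: real) = indicator {y0}" by (auto simp: indicator_def)
    then show ?thesis by (simp add: measure_pmf_single)
  qed
  then have "(\<Sum>i\<in>slot j. mean (trans W (inp x t i)) (\<lambda>y. of_bool (y = y0))) = (\<Sum>i\<in>slot j. pmf (trans W z) y0)"
    using assms by (intro sum.cong) auto
  then show ?thesis by (simp add: slot_def)
qed

lemma slot_tail:
  assumes "slot j \<subseteq> {1..N}" "\<And>i. i \<in> slot j \<Longrightarrow> inp x t i = z"
  shows "Pr (law x t) {y. freq j y \<le> w * pmf (trans W z) y0 - gap} \<le> probe_err"
    and "Pr (law x t) {y. freq j y \<ge> w * pmf (trans W z) y0 + gap} \<le> probe_err"
proof -
  have ne: "slot j \<noteq> {}" "card (slot j) = w" using w by (auto simp: slot_def)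
  have e: "exp (- (gap\<^sup>2 / (2 * (1 :: real)\<^sup>2 * card (slot j)))) = probe_err"
    using w ne by (simp add: probe_err_def power2_eq_square field_simps)
  have d: "0 \<le> gap" using x0 by simp
  have "Pr (law x t) {y. freq j y \<le>
      (\<Sum>i\<in>slot j. mean (trans W (inp x t i)) (\<lambda>y. of_bool (y = y0))) - gap}
     \<le> exp (- (gap\<^sup>2 / (2 * (1 :: real)\<^sup>2 * card (slot j))))"
    unfolding law_def by (rule Pi_pmf_tails(1)[OF _ assms(1) ne(1) _ d]) auto
  then show "Pr (law x t) {y. freq j y \<le> w * pmf (trans W z) y0 - gap} \<le> probe_err"
    by (simp only: e slot_sum_expectation[OF assms(2)])
  have "Pr (law x t) {y. freq j y \<ge>
      (\<Sum>i\<in>slot j. mean (trans W (inp x t i)) (\<lambda>y. of_bool (y = y0))) + gap}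
     \<le> exp (- (gap\<^sup>2 / (2 * (1 :: real)\<^sup>2 * card (slot j))))"
    unfolding law_def by (rule Pi_pmf_tails(2)[OF _ assms(1) ne(1) _ d]) auto
  then show "Pr (law x t) {y. freq j y \<ge> w * pmf (trans W z) y0 + gap} \<le> probe_err"
    by (simp only: e slot_sum_expectation[OF assms(2)])
qed

lemma missed_probe:
  assumes x: "x \<in> set_pmf codeword_law" and t: "t \<in> {1..A}"
  shows "Pr (law x t) {y. \<not> pos (probe t) y} \<le> probe_err"
proof -
  have pr: "t \<le> probe t * L + 1" "probe t * L + w \<le> t + 2 * L - 1" using probe[of t] t by auto
  have "slot (probe t) \<subseteq> {1..N}" using pr t n2 w by (auto simp: slot_def N_def)
  moreover have "inp x t i = x0" if "i \<in> slot (probe t)" for i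
  proof -
    have "i \<in> {t..t + n - 1}" "i + 1 - t \<le> 2 * L" using that pr w n2 by (auto simp: slot_def)
    then show ?thesis using inp_in[OF x] codeword_letter(2)[OF x] by metis
  qed
  ultimately have "Pr (law x t) {y. freq (probe t) y \<le> w * pmf (trans W x0) y0 - gap} \<le> probe_err"
    by (rule slot_tail(1))
  moreover have "{y. \<not> pos (probe t) y} \<subseteq> {y. freq (probe t) y \<le> w * pmf (trans W x0) y0 - gap}"
    unfolding pos_def using \<theta> by (auto simp: field_simps)
  ultimately show ?thesis by (meson prob_subset_le order_trans)
qed

lemma false_alarm:
  assumes "slot j \<subseteq> {1..N}" "slot j \<inter> {t..t + n - 1} = {}"
  shows "Pr (law x t) {y. pos j y} \<le> probe_err"
proof -
  have "inp x t i = idle W" if "i \<in> slot j" for i using assms that by (auto simp: inp_def)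
  then have "Pr (law x t) {y. freq j y \<ge> w * pmf Qi y0 + gap} \<le> probe_err"
    by (rule slot_tail(2)[OF assms(1)])
  moreover have "{y. pos j y} \<subseteq> {y. freq j y \<ge> w * pmf Qi y0 + gap}"
    unfolding pos_def using \<theta> by (auto simp: field_simps)
  ultimately show ?thesis by (meson prob_subset_le order_trans)
qed

text \<open>Bounds the mean number of sampled times: all slots, the last time, and up to
  \<open>n\<close> dense samples for each positive slot.\<close>

definition "Ecard = w * (N div L + 1) + 1 + n * (2 * real n + 2 + (N div L + 1) * probe_err)"

lemma finite_law: "finite (set_pmf (law x t))"
  unfolding law_def by (intro finite_set_Pi_pmf) auto

lemma card_T_tail:
  assumes t: "t \<in> {1..A}" and z: "0 < z"
  shows "Pr (law x t) {y. z \<le> real (card (T y))} \<le> Ecard / z"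
proof -
  let ?I = "{..N div L}"
  let ?E = "mean (law x t)"
  have L: "1 \<le> L" using w by simp
  \<comment> \<open>The slots to which \<open>false_alarm\<close> does not apply: those leaving the
    horizon, of which only the last can be one, and those meeting the transmission. Their
    probability is bounded by 1, and there are at most \<open>2 * n + 2\<close> of them.\<close>
  define D where "D = {j \<in> ?I. \<not> (slot j \<subseteq> {1..N} \<and> slot j \<inter> {t..t + n - 1} = {})}"
  have "D \<subseteq> {N div L} \<union> {j. j * L \<in> {t - w..t + n}}"
  proof
    fix j assume j: "j \<in> D"
    show "j \<in> {N div L} \<union> {j. j * L \<in> {t - w..t + n}}"
    proof (cases "slot j \<subseteq> {1..N}")
      case True
      then obtain i where "i \<in> slot j" "i \<in> {t..t + n - 1}" using j unfolding D_def by blast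
      then show ?thesis using w by (auto simp: slot_def)
    next
      case False
      then have "N < j * L + w" by (auto simp: slot_def)
      then have "N < (j + 1) * L" using w by (simp add: algebra_simps)
      then have "N div L < j + 1" using L by (simp add: less_mult_imp_div_less)
      then show ?thesis using j by (simp add: D_def)
    qed
  qed
  moreover have fX: "finite {j. j * L \<in> {t - w..t + n}}" and cX: "card {j. j * L \<in> {t - w..t + n}} \<le> 2 * n + 1"
  proof -
    have inj: "inj_on (\<lambda>j. j * L) {j. j * L \<in> {t - w..t + n}}" using L by (auto simp: inj_on_def)
    have sub: "(\<lambda>j. j * L) ` {j. j * L \<in> {t - w..t + n}} \<subseteq> {t - w..t + n}" by auto
    show "finite {j. j * L \<in> {t - w..t + n}}" using inj sub by (metis finite_atLeastAtMost finite_imageD finite_subset)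
    have "card {j. j * L \<in> {t - w..t + n}} \<le> card {t - w..t + n}" by (rule card_inj_on_le[OF inj sub]) simp
    also have "\<dots> \<le> 2 * n + 1" using w n2 by auto
    finally show "card {j. j * L \<in> {t - w..t + n}} \<le> 2 * n + 1" .
  qed
  ultimately have "card D \<le> card ({N div L} \<union> {j. j * L \<in> {t - w..t + n}})"
    by (intro card_mono) auto
  also have "\<dots> \<le> card {N div L} + card {j. j * L \<in> {t - w..t + n}}" by (rule card_Un_le)
  finally have cD: "card D \<le> 2 * n + 2" using cX by simp
  have ct: "real (card (T y)) \<le> w * (N div L + 1) + 1 + n * (\<Sum>j\<in>?I. indicat_real {y. pos j y} y)" for y
  proof -
    have "(\<Sum>j\<in>?I. indicator {y. pos j y} y :: real) = card {j \<in> ?I. pos j y}"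
      by (simp add: indicator_def sum.If_cases Int_def)
    moreover have "real (card (T y)) \<le> real (w * (N div L + 1) + 1 + n * card {j \<in> ?I. pos j y})"
      using card_T_le[of y] by (simp only: of_nat_le_iff)
    ultimately show ?thesis by simp
  qed
  have "?E (\<lambda>y. real (card (T y))) \<le> ?E (\<lambda>y. w * (N div L + 1) + 1 + n * (\<Sum>j\<in>?I. indicat_real {y. pos j y} y))"
    using ct by (intro expectation_mono_finite finite_law)
  also have "\<dots> = w * (N div L + 1) + 1 + n * (\<Sum>j\<in>?I. Pr (law x t) {y. pos j y})"
    by (simp add: integrable_measure_pmf_finite finite_law)
  also have "(\<Sum>j\<in>?I. Pr (law x t) {y. pos j y}) \<le> (\<Sum>j\<in>?I. indicator D j + probe_err)"
  proof (rule sum_mono)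
    fix j assume j: "j \<in> ?I"
    show "Pr (law x t) {y. pos j y} \<le> indicator D j + probe_err"
    proof (cases "j \<in> D")
      case True
      have "Pr (law x t) {y. pos j y} \<le> 1" by simp
      also have "1 \<le> indicator D j + probe_err" using True by (simp add: probe_err_def)
      finally show ?thesis .
    next
      case False
      then show ?thesis using false_alarm[of j t x] j by (simp add: D_def)
    qed
  qed
  also have "\<dots> = card D + (N div L + 1) * probe_err"
  proof -
    have "D \<subseteq> ?I" by (auto simp: D_def)
    then have "(\<Sum>j\<in>?I. indicator D j :: real) = card D" by (simp add: indicator_def sum.If_cases Int_absorb1)
    then show ?thesis by (simp add: sum.distrib)
  qed
  also have "\<dots> \<le> 2 * real n + 2 + (N div L + 1) * probe_err" using cD by linarith
  finally have "?E (\<lambda>y. real (card (T y))) \<le> Ecard"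
    by (simp add: Ecard_def mult_left_mono)
  moreover have "Pr (law x t) {y. z \<le> real (card (T y))} \<le> ?E (\<lambda>y. real (card (T y))) / z"
    using z by (intro pmf_markov finite_law) auto
  moreover have "?E (\<lambda>y. real (card (T y))) / z \<le> Ecard / z"
    using z calculation(1) by (intro divide_right_mono) auto
  ultimately show ?thesis by linarith
qed

lemma window_lower_tail:
  fixes f :: "'a \<Rightarrow> 'y \<Rightarrow> real"
  assumes x: "x \<in> set_pmf codeword_law" and t: "t \<in> {1..A}" and r: "r < n"
    and f: "\<And>x y. x \<in> set_pmf P \<Longrightarrow> y \<in> set_pmf (trans W x) \<Longrightarrow> 0 < f x y \<and> \<bar>log 2 (f x y)\<bar> \<le> c0"
    and Z: "0 < Z" "log 2 Z + a \<le> (\<Sum>j\<in>{r + 1..n}. mean_log W f (x j))"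
  shows "Pr (law x t) {y. \<not> Z \<le> (\<Prod>i\<in>{t + r..t + n - 1}. f (x (i + 1 - t)) (y i))} \<le> window_err"
proof -
  let ?J = "{t + r..t + n - 1}"
  let ?u = "\<lambda>i. x (i + 1 - t)"
  have J: "?J \<subseteq> {1..N}" "?J \<noteq> {}" "finite ?J" "card ?J \<le> n" using t r by (auto simp: N_def)
  have inJ: "inp x t i = ?u i \<and> ?u i \<in> set_pmf P" if "i \<in> ?J" for i
    using inp_in[OF x, of i t] codeword_letter(1)[OF x] that by auto
  have re: "(\<Sum>i\<in>?J. mean (trans W (inp x t i)) (\<lambda>y. log 2 (f (?u i) y)))
      = (\<Sum>j\<in>{r + 1..n}. mean_log W f (x j))"
    using inJ by (intro sum.reindex_bij_witness[where i = "\<lambda>j. j + t - 1" and j = "\<lambda>i. i + 1 - t"]) (use t r in auto)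
  \<comment> \<open>Only on the support are all factors positive, so that the logarithm of the
    product is the sum of the logarithms.\<close>
  have "Pr (law x t) {y. \<not> Z \<le> (\<Prod>i\<in>?J. f (?u i) (y i))}
      = Pr (law x t) ({y. \<not> Z \<le> (\<Prod>i\<in>?J. f (?u i) (y i))} \<inter> set_pmf (law x t))"
    by (simp only: measure_Int_set_pmf)
  also have "\<dots> \<le> Pr (law x t) {y. (\<Sum>i\<in>?J. log 2 (f (?u i) (y i))) \<le>
      (\<Sum>i\<in>?J. mean (trans W (inp x t i)) (\<lambda>y. log 2 (f (?u i) y))) - a}"
  proof (rule prob_subset_le, safe)
    fix y assume y: "y \<in> set_pmf (law x t)" "\<not> Z \<le> (\<Prod>i\<in>?J. f (?u i) (y i))"
    have pos: "0 < f (?u i) (y i)" if "i \<in> ?J" for i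
    proof -
      have "y i \<in> set_pmf (trans W (inp x t i))"
        using y(1) that J(1) by (auto simp: law_def set_Pi_pmf PiE_dflt_def)
      then show ?thesis using inJ[OF that] f by auto
    qed
    have pp: "0 < (\<Prod>i\<in>?J. f (?u i) (y i))" using pos by (intro prod_pos) auto
    have "(\<Sum>i\<in>?J. log 2 (f (?u i) (y i))) = log 2 (\<Prod>i\<in>?J. f (?u i) (y i))"
    proof -
      have "ln (\<Prod>i\<in>?J. f (?u i) (y i)) = (\<Sum>i\<in>?J. ln (f (?u i) (y i)))"
        using pos by (intro ln_prod) (auto simp: less_imp_neq[symmetric])
      then show ?thesis by (simp add: log_def sum_divide_distrib)
    qed
    also have "\<dots> \<le> log 2 Z" using pp y(2) Z(1) by simp
    finally show "(\<Sum>i\<in>?J. log 2 (f (?u i) (y i))) \<le>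
      (\<Sum>i\<in>?J. mean (trans W (inp x t i)) (\<lambda>y. log 2 (f (?u i) y))) - a"
      using Z(2) re by linarith
  qed
  also have "\<dots> \<le> exp (- (a\<^sup>2 / (2 * c0\<^sup>2 * card ?J)))"
    unfolding law_def using thr J f inJ by (intro Pi_pmf_tails(1)) auto
  also have "\<dots> \<le> window_err" by (rule tail_mono[OF J(2,3,4)])
  finally show ?thesis .
qed

lemma own_window:
  assumes x: "x \<in> set_pmf codeword_law" and t: "t \<in> {1..A}" and gx: "good x"
  shows "Pr (law x t) {y. \<not> (match_g x t y \<and> match_h x t y \<and> match_end x t y)} \<le> 3 * window_err"
proof -
  have r: "2 * L < n" "n - n2 < n" using n2 by auto
  have e: "t + (n - n2) = t + n - n2" using n2 by simp
  have 1: "Pr (law x t) {y. \<not> match_g x t y} \<le> window_err"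
    unfolding match_g_def
    by (rule window_lower_tail[OF x t r(1)]) (use logs thr gx in \<open>auto simp: good_def \<mu>g_def\<close>)
  have 2: "Pr (law x t) {y. \<not> match_h x t y} \<le> window_err"
    unfolding match_h_def
    by (rule window_lower_tail[OF x t r(1)]) (use logs thr gx in \<open>auto simp: good_def \<mu>h_def\<close>)
  have 3: "Pr (law x t) {y. \<not> match_end x t y} \<le> window_err"
    unfolding match_end_def e[symmetric]
    by (rule window_lower_tail[OF x t r(2)]) (use logs thr gx in \<open>auto simp: good_def \<mu>h_def\<close>)
  have "{y. \<not> (match_g x t y \<and> match_h x t y \<and> match_end x t y)} =
     ({y. \<not> match_g x t y} \<union> {y. \<not> match_h x t y}) \<union> {y. \<not> match_end x t y}" by auto
  then show ?thesis
    using 1 2 3 prob_Un_le[of "law x t" "{y. \<not> match_g x t y} \<union> {y. \<not> match_h x t y}" "{y. \<not> match_end x t y}"]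
      prob_Un_le[of "law x t" "{y. \<not> match_g x t y}" "{y. \<not> match_h x t y}"] by simp
qed

lemma law_markov:
  assumes "J \<subseteq> {1..N}" "\<And>i y. i \<in> J \<Longrightarrow> 0 \<le> f i y" "0 < (Z::real)"
  shows "Pr (law x t) {y. Z \<le> (\<Prod>i\<in>J. f i (y i))} \<le> (\<Prod>i\<in>J. mean (trans W (inp x t i)) (f i)) / Z"
  unfolding law_def using assms by (intro Pi_pmf_markov_prod) auto

text \<open>All outputs of the window are idle and the codeword does not influence them, so every
  factor has mean at most 1 for each fixed word; no average over codebooks is involved.\<close>

lemma noise_window:
  assumes x': "x' \<in> set_pmf codeword_law" and t: "t \<in> {1..A}" and b: "1 \<le> b" "b + n \<le> t"
  shows "Pr (law x t) {y. match_g x' b y} \<le> 1 / G"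
proof -
  let ?J = "{b + 2 * L..b + n - 1}"
  have "Pr (law x t) {y. match_g x' b y}
      \<le> (\<Prod>i\<in>?J. mean (trans W (inp x t i)) (g (x' (i + 1 - b)))) / G"
    unfolding match_g_def using thr nonneg t b by (intro law_markov) (auto simp: N_def)
  also have "(\<Prod>i\<in>?J. mean (trans W (inp x t i)) (g (x' (i + 1 - b)))) \<le> 1"
  proof (rule prod_le_1)
    fix i assume i: "i \<in> ?J"
    then have "inp x t i = idle W" using b by (auto simp: inp_def)
    moreover have "x' (i + 1 - b) \<in> set_pmf P" 
    proof (rule codeword_letter(1)[OF x'])
      show "i + 1 - b \<in> {1..n}" using i b by auto
    qed
    ultimately show "0 \<le> mean (trans W (inp x t i)) (g (x' (i + 1 - b))) \<and>
        mean (trans W (inp x t i)) (g (x' (i + 1 - b))) \<le> 1"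
      using g_idle nonneg by simp
  qed
  finally show ?thesis using thr by (simp add: divide_right_mono)
qed

text \<open>Exchange the averages: for each output the mean over a fresh letter \<open>v\<close> is
  at most 1, whatever input \<open>u\<close> produced the output. This covers idle and preamble
  outputs in partly overlapping windows.\<close>

lemma mean_h_le_1: "mean P (\<lambda>v. mean (trans W u) (h v)) \<le> 1"
proof -
  have "mean P (\<lambda>v. mean (trans W u) (h v))
      = (\<Sum>y\<in>UNIV. pmf (trans W u) y * mean P (\<lambda>v. h v y))"
    unfolding expectation_finite by (simp add: sum_distrib_left mult_ac sum.swap[of _ "UNIV :: 'a set"])
  also have "\<dots> \<le> (\<Sum>y\<in>UNIV. pmf (trans W u) y * 1)"
    using h_avg by (intro sum_mono mult_left_mono) auto
  also have "\<dots> = 1" by (simp add: sum_pmf_eq_1)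
  finally show ?thesis .
qed

lemma prod_mean_h_le_1:
  assumes "J \<subseteq> {2 * L + 1..n}" "J \<subseteq> I" "I \<subseteq> {1..n}"
  shows "mean (Pi_pmf I undefined letter)
      (\<lambda>x. \<Prod>j\<in>J. mean (trans W (u j)) (h (x j))) \<le> 1"
proof -
  have "finite I" using assms(3) finite_subset by blast
  then have "mean (Pi_pmf I undefined letter) (\<lambda>x. \<Prod>j\<in>J. mean (trans W (u j)) (h (x j)))
      = (\<Prod>j\<in>J. mean (letter j) (\<lambda>v. mean (trans W (u j)) (h v)))"
    using assms nonneg by (intro expectation_prod_subset) auto
  also have "\<dots> \<le> 1"
  proof (rule prod_le_1)
    fix j assume "j \<in> J"
    then have "letter j = P" using assms by (auto simp: letter_def)
    then show "0 \<le> mean (letter j) (\<lambda>v. mean (trans W (u j)) (h v)) \<and>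
        mean (letter j) (\<lambda>v. mean (trans W (u j)) (h v)) \<le> 1"
      using mean_h_le_1 nonneg by simp
  qed
  finally show ?thesis .
qed

lemma reindex_window:
  assumes "1 \<le> b" "r < n"
  shows "(\<Prod>i\<in>{b + r..b + n - 1}. f i (i + 1 - b)) = (\<Prod>j\<in>{r + 1..n}. f (j + b - 1) j)"
  by (rule prod.reindex_bij_witness[where i = "\<lambda>j. j + b - 1" and j = "\<lambda>i. i + 1 - b"]) (use assms in auto)

text \<open>The competing word is drawn independently of the outputs, so each compared letter
  contributes a factor of mean at most 1, whichever input it is matched against.\<close>

lemma other_window:
  assumes t: "t \<in> {1..A}" and b: "1 \<le> b" "b \<le> t"
  shows "mean codeword_law (\<lambda>x'. Pr (law x t) {y. match_h x' b y}) \<le> 1 / H"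
proof -
  let ?J = "{b + 2 * L..b + n - 1}"
  have r: "2 * L < n" using n2 by simp
  have "Pr (law x t) {y. match_h x' b y}
      \<le> (\<Prod>j\<in>{2 * L + 1..n}. mean (trans W (inp x t (j + b - 1))) (h (x' j))) / H" for x'
  proof -
    have "Pr (law x t) {y. match_h x' b y}
      \<le> (\<Prod>i\<in>?J. mean (trans W (inp x t i)) (h (x' (i + 1 - b)))) / H"
      unfolding match_h_def using thr nonneg t b by (intro law_markov) (auto simp: N_def)
    then show ?thesis
      using reindex_window[OF b(1) r, of "\<lambda>i j. mean (trans W (inp x t i)) (h (x' j))"] by simp
  qed
  then have "mean codeword_law (\<lambda>x'. Pr (law x t) {y. match_h x' b y})
     \<le> mean codeword_law (\<lambda>x'. (\<Prod>j\<in>{2 * L + 1..n}. mean (trans W (inp x t (j + b - 1))) (h (x' j))) / H)"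
    by (intro expectation_mono_finite finite_codeword_law)
  also have "\<dots> = mean codeword_law (\<lambda>x'. \<Prod>j\<in>{2 * L + 1..n}. mean (trans W (inp x t (j + b - 1))) (h (x' j))) / H"
    by simp
  also have "\<dots> \<le> 1 / H"
    unfolding codeword_law_def using thr
    by (intro divide_right_mono prod_mean_h_le_1[where u = "\<lambda>j. inp x t (j + b - 1)"]) auto
  finally show ?thesis .
qed

text \<open>
  In a window that ends at least \<open>n2\<close> early, the outputs compared with the last \<open>n2\<close> letters of the
  codeword are produced by its other letters, which are independent of these.
\<close>

lemma self_window:
  assumes t: "t \<in> {1..A}" and b: "1 \<le> b" "b + n2 \<le> t"
  shows "mean codeword_law (\<lambda>x. Pr (law x t) {y. match_end x b y}) \<le> 1 / F"
proof -
  let ?J = "{b + n - n2..b + n - 1}" and ?I1 = "{1..n - n2}" and ?I2 = "{n - n2 + 1..n}"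
  have r: "n - n2 < n" "b + (n - n2) = b + n - n2" using n2 by auto
  let ?X = "\<lambda>x. \<Prod>j\<in>?I2. mean (trans W (inp x t (j + b - 1))) (h (x j))"
  have "Pr (law x t) {y. match_end x b y} \<le> ?X x / F" for x
  proof -
    have "Pr (law x t) {y. match_end x b y}
      \<le> (\<Prod>i\<in>?J. mean (trans W (inp x t i)) (h (x (i + 1 - b)))) / F"
      unfolding match_end_def using thr nonneg t b n2 by (intro law_markov) (auto simp: N_def)
    then show ?thesis
      using reindex_window[OF b(1) r(1), of "\<lambda>i j. mean (trans W (inp x t i)) (h (x j))"] r by simp
  qed
  then have "mean codeword_law (\<lambda>x. Pr (law x t) {y. match_end x b y})
     \<le> mean codeword_law (\<lambda>x. ?X x / F)"
    by (intro expectation_mono_finite finite_codeword_law)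
  also have "\<dots> = mean codeword_law ?X / F" by simp
  also have "mean codeword_law ?X \<le> 1"
  proof -
    let ?p1 = "Pi_pmf ?I1 undefined letter" and ?p2 = "Pi_pmf ?I2 undefined letter"
    let ?mrg = "\<lambda>(f, g) i. if i \<in> ?I1 then f i else g i"
    have un: "{1..n} = ?I1 \<union> ?I2" "?I1 \<inter> ?I2 = {}" using n2 by auto
    have cl: "codeword_law = map_pmf ?mrg (pair_pmf ?p1 ?p2)"
      unfolding codeword_law_def un(1) by (rule Pi_pmf_union) (use un in auto)
    have X: "?X (?mrg (f, g)) = (\<Prod>j\<in>?I2. mean (trans W (inp f t (j + b - 1))) (h (g j)))" for f g
    proof (rule prod.cong[OF refl])
      fix j assume j: "j \<in> ?I2"
      \<comment> \<open>The output at position \<open>j + b - 1\<close> carries letter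
        \<open>j + b - t\<close> of the sent word, or the idle symbol. As
        \<open>b + n2 \<le> t\<close> and \<open>j \<le> n\<close>, that index is at most
        \<open>n - n2\<close>, so only \<open>f\<close> enters.\<close>
      then have "inp (?mrg (f, g)) t (j + b - 1) = inp f t (j + b - 1)"
        using b by (auto simp: inp_def)
      moreover have "?mrg (f, g) j = g j" using j by simp
      ultimately show "mean (trans W (inp (?mrg (f, g)) t (j + b - 1))) (h (?mrg (f, g) j))
         = mean (trans W (inp f t (j + b - 1))) (h (g j))" by (simp only:)
    qed
    have "mean codeword_law ?X
       = mean (pair_pmf ?p1 ?p2) (\<lambda>z. ?X (?mrg z))"
      unfolding cl by (rule integral_map_pmf)
    also have "\<dots> = mean (pair_pmf ?p1 ?p2)
        (\<lambda>(f, g). \<Prod>j\<in>?I2. mean (trans W (inp f t (j + b - 1))) (h (g j)))"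
    proof (intro Bochner_Integration.integral_cong refl)
      fix z :: "(nat \<Rightarrow> 'a) \<times> (nat \<Rightarrow> 'a)"
      obtain f g where z: "z = (f, g)" by (cases z)
      show "?X (?mrg z) = (case z of (f, g) \<Rightarrow> \<Prod>j\<in>?I2. mean (trans W (inp f t (j + b - 1))) (h (g j)))"
        unfolding z using X[of f g] by simp
    qed
    also have "\<dots> = mean ?p1 (\<lambda>f. mean ?p2
        (\<lambda>g. \<Prod>j\<in>?I2. mean (trans W (inp f t (j + b - 1))) (h (g j))))"
      by (intro expectation_pair_finite finite_set_Pi_pmf) auto
    also have "\<dots> \<le> mean ?p1 (\<lambda>f. 1)"
      using n2 by (intro expectation_mono_finite finite_set_Pi_pmf prod_mean_h_le_1) auto
    also have "\<dots> = 1" by simp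
    finally show ?thesis .
  qed
  finally show ?thesis using thr by (simp add: divide_right_mono)
qed

lemma good_likely:
  assumes "log 2 G + 2 * a \<le> (real n - 2 * real L) * mean P \<mu>g"
    and "log 2 H + 2 * a \<le> (real n - 2 * real L) * mean P \<mu>h"
    and "log 2 F + 2 * a \<le> real n2 * mean P \<mu>h"
  shows "Pr codeword_law {x. \<not> good x} \<le> 4 * window_err"
proof -
  have absmu: "\<bar>mean_log W f x\<bar> \<le> c0"
    if "x \<in> set_pmf P" "\<And>y. y \<in> set_pmf (trans W x) \<Longrightarrow> \<bar>log 2 (f x y)\<bar> \<le> c0" for x and f :: "'a \<Rightarrow> 'y \<Rightarrow> real"
  proof -
    have "mean_log W f x \<le> mean (trans W x) (\<lambda>y. c0)"
      using that(2) by (intro expectation_mono_finite) (auto simp: abs_le_iff)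
    moreover have "mean (trans W x) (\<lambda>y. - c0) \<le> mean_log W f x"
      using that(2) by (intro expectation_mono_finite) (auto simp: abs_le_iff minus_le_iff)
    ultimately show ?thesis by simp
  qed
  have absg: "\<bar>\<mu>g x\<bar> \<le> c0" and absh: "\<bar>\<mu>h x\<bar> \<le> c0" if "x \<in> set_pmf P" for x
    unfolding \<mu>g_def \<mu>h_def using absmu[OF that, of g] absmu[OF that, of h] logs[OF that] by auto
  have low: "Pr codeword_law {x. \<not> log 2 Z + a < (\<Sum>j\<in>{r + 1..n}. \<mu> (x j))} \<le> window_err"
    if r: "2 * L \<le> r" "r < n" and \<mu>: "\<And>x. x \<in> set_pmf P \<Longrightarrow> \<bar>\<mu> x\<bar> \<le> c0"
      and Z: "log 2 Z + 2 * a \<le> (real n - real r) * mean P \<mu>" for r Z and \<mu> :: "'a \<Rightarrow> real"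
  proof -
    have "(\<Sum>j\<in>{r + 1..n}. mean (letter j) \<mu>) = (\<Sum>j\<in>{r + 1..n}. mean P \<mu>)"
      using r by (intro sum.cong) (auto simp: letter_def)
    also have "\<dots> = (real n - real r) * mean P \<mu>"
      using r by (simp add: of_nat_diff)
    finally have "{x. \<not> log 2 Z + a < (\<Sum>j\<in>{r + 1..n}. \<mu> (x j))} \<subseteq>
      {x. (\<Sum>j\<in>{r + 1..n}. \<mu> (x j)) \<le> (\<Sum>j\<in>{r + 1..n}. mean (letter j) \<mu>) - a}"
      using Z by auto
    then have "Pr codeword_law {x. \<not> log 2 Z + a < (\<Sum>j\<in>{r + 1..n}. \<mu> (x j))} \<le>
      Pr codeword_law {x. (\<Sum>j\<in>{r + 1..n}. \<mu> (x j)) \<le> (\<Sum>j\<in>{r + 1..n}. mean (letter j) \<mu>) - a}"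
      by (rule prob_subset_le)
    also have "\<dots> \<le> exp (- (a\<^sup>2 / (2 * c0\<^sup>2 * card {r + 1..n})))"
      unfolding codeword_law_def using thr r \<mu> by (intro Pi_pmf_tails(1)) (auto simp: letter_def)
    also have "\<dots> \<le> window_err" using r by (intro tail_mono) auto
    finally show ?thesis .
  qed
  have 1: "Pr codeword_law {x. \<not> log 2 G + a < (\<Sum>j\<in>{2 * L + 1..n}. \<mu>g (x j))} \<le> window_err"
    by (rule low) (use assms n2 absg in auto)
  have 2: "Pr codeword_law {x. \<not> log 2 H + a < (\<Sum>j\<in>{2 * L + 1..n}. \<mu>h (x j))} \<le> window_err"
    by (rule low) (use assms n2 absh in auto)
  have 3: "Pr codeword_law {x. \<not> log 2 F + a < (\<Sum>j\<in>{n - n2 + 1..n}. \<mu>h (x j))} \<le> window_err"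
    by (rule low) (use assms n2 absh in \<open>auto simp: of_nat_diff\<close>)
  have 4: "Pr codeword_law {x. \<not> (\<Sum>j\<in>{1..n}. k (x j)) < (\<Sum>j\<in>{1..n}. mean (letter j) k) + a} \<le> window_err"
  proof -
    have "Pr codeword_law {x. (\<Sum>j\<in>{1..n}. k (x j)) \<ge> (\<Sum>j\<in>{1..n}. mean (letter j) k) + a}
       \<le> exp (- (a\<^sup>2 / (2 * c0\<^sup>2 * card {1..n})))"
      unfolding codeword_law_def using thr n1 cost x0 by (intro Pi_pmf_tails(2)) (auto simp: letter_def split: if_splits)
    also have "\<dots> \<le> window_err" using n1 by (intro tail_mono) auto
    finally show ?thesis by (simp add: not_less)
  qed
  let ?a1 = "{x. \<not> log 2 G + a < (\<Sum>j\<in>{2 * L + 1..n}. \<mu>g (x j))}"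
  let ?a2 = "{x. \<not> log 2 H + a < (\<Sum>j\<in>{2 * L + 1..n}. \<mu>h (x j))}"
  let ?a3 = "{x. \<not> log 2 F + a < (\<Sum>j\<in>{n - n2 + 1..n}. \<mu>h (x j))}"
  let ?a4 = "{x. \<not> (\<Sum>j\<in>{1..n}. k (x j)) < (\<Sum>j\<in>{1..n}. mean (letter j) k) + a}"
  have "{x. \<not> good x} = ((?a1 \<union> ?a2) \<union> ?a3) \<union> ?a4" by (auto simp: good_def)
  then show ?thesis
    using 1 2 3 4 prob_Un_le[of codeword_law "(?a1 \<union> ?a2) \<union> ?a3" ?a4] prob_Un_le[of codeword_law "?a1 \<union> ?a2" ?a3]
      prob_Un_le[of codeword_law ?a1 ?a2] by simp
qed

end

section \<open>A code with small failure probability\<close>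

lemma prob_pair_return:
  "Pr (pair_pmf p (return_pmf r)) {(y, r). E y r} = Pr p {y. E y r}"
proof -
  have "Pr (return_pmf r) {r. E y r} = indicator {y. E y r} y" for y
    by (simp add: measure_return_pmf indicator_def)
  then show ?thesis by (simp add: prob_pair_pmf)
qed

text \<open>The decision falls on one of the last \<open>n2\<close> letters of the transmission; the
  lower bound is written without truncated subtraction.\<close>

abbreviation on_target :: "('a, 'y) code \<Rightarrow> nat \<Rightarrow> nat \<Rightarrow> real \<Rightarrow> nat \<Rightarrow> nat \<Rightarrow> (nat \<Rightarrow> 'y) \<Rightarrow>
    'y sampler \<times> 'y stopping_rule \<Rightarrow> bool" where
  "on_target C n n2 z m t y r \<equiv> decision_time r y < t + n \<and> t + n \<le> decision_time r y + n2 \<and>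
     decoder C (observed r y) = m \<and> real (num_samples r y) \<le> z"

context coding_setting
begin

definition overlap :: "nat \<Rightarrow> nat set" where "overlap t = {b \<in> {1..t}. t < b + n}"

lemma overlap: "finite (overlap t)" "card (overlap t) \<le> n"
proof -
  have sub: "overlap t \<subseteq> {t + 1 - n..t}" by (auto simp: overlap_def)
  then show "finite (overlap t)" by (rule finite_subset) simp
  have "card (overlap t) \<le> card {t + 1 - n..t}" using sub by (intro card_mono) auto
  also have "\<dots> \<le> n" by auto
  finally show "card (overlap t) \<le> n" .
qed

definition self_conf :: "(nat \<Rightarrow> 'a) \<Rightarrow> real" where
  "self_conf x = (\<Sum>t=1..A. \<Sum>b\<in>{b \<in> overlap t. b + n2 \<le> t}. Pr (law x t) {y. match_end x b y}) / A"

definition conf :: "(nat \<Rightarrow> 'a) \<Rightarrow> (nat \<Rightarrow> 'a) \<Rightarrow> real" where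
  "conf x x' = (\<Sum>t=1..A. \<Sum>b\<in>overlap t. Pr (law x t) {y. match_h x' b y}) / A"

lemma average_le:
  fixes f :: "nat \<Rightarrow> nat \<Rightarrow> (nat \<Rightarrow> 'a) \<Rightarrow> real" and q :: real
  assumes "\<And>t. I t \<subseteq> overlap t" "0 \<le> q"
    and "\<And>t b. t \<in> {1..A} \<Longrightarrow> b \<in> I t \<Longrightarrow> mean codeword_law (f t b) \<le> q"
  shows "mean codeword_law (\<lambda>x. (\<Sum>t=1..A. \<Sum>b\<in>I t. f t b x) / A) \<le> n * q"
proof -
  have intg: "integrable (measure_pmf codeword_law) g" for g :: "(nat \<Rightarrow> 'a) \<Rightarrow> real"
    by (rule integrable_measure_pmf_finite[OF finite_codeword_law])
  have "mean codeword_law (\<lambda>x. (\<Sum>t=1..A. \<Sum>b\<in>I t. f t b x) / A)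
      = mean codeword_law (\<lambda>x. \<Sum>t=1..A. \<Sum>b\<in>I t. f t b x) / A"
    by simp
  also have "mean codeword_law (\<lambda>x. \<Sum>t=1..A. \<Sum>b\<in>I t. f t b x)
      = (\<Sum>t=1..A. mean codeword_law (\<lambda>x. \<Sum>b\<in>I t. f t b x))"
    by (intro Bochner_Integration.integral_sum intg)
  also have "\<dots> = (\<Sum>t=1..A. \<Sum>b\<in>I t. mean codeword_law (f t b))"
    by (intro sum.cong refl Bochner_Integration.integral_sum intg)
  also have "\<dots> \<le> (\<Sum>t=1..A. \<Sum>b\<in>I t. q)"
    using assms by (intro sum_mono) auto
  also have "\<dots> \<le> (\<Sum>t=1..A. n * q)"
  proof (rule sum_mono)
    fix t
    have "card (I t) \<le> n" using card_mono[OF overlap(1) assms(1)] overlap(2)[of t] order_trans by blast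
    then show "(\<Sum>b\<in>I t. q) \<le> n * q" using assms(2) by (simp add: mult_right_mono)
  qed
  also have "\<dots> = A * (n * q)" by simp
  finally show ?thesis using A1 by (simp add: divide_right_mono mult.commute pos_divide_le_eq)
qed

lemma self_conf_mean: "mean codeword_law self_conf \<le> n / F"
  unfolding self_conf_def[abs_def] using thr
  by (intro order.trans[OF average_le[where q = "1 / F"]] self_window) (auto simp: overlap_def)

lemma conf_mean: "mean codeword_law (conf x) \<le> n / H"
  unfolding conf_def[abs_def] using thr
  by (intro order.trans[OF average_le[where q = "1 / H"]] other_window) (auto simp: overlap_def)

lemma conf_nonneg: "0 \<le> self_conf x" "0 \<le> conf x x'"
  by (auto simp: self_conf_def conf_def intro!: divide_nonneg_nonneg sum_nonneg)

text \<open>Union bound over six failures: preamble missed, sent word rejected, a pure noise window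
  accepted (at most \<open>A * 2 ^ B\<close> candidates), another message accepted, a large shift of
  the sent word accepted, too many samples. Only the fourth and fifth need an average over the
  codebook; expurgation bounds their sum by \<open>2 * \<delta>\<close> for every kept word.\<close>

theorem random_code:
  assumes B: "1 \<le> B" and inputs: "set_pmf P \<subseteq> inputs W" and z: "0 < z"
    and means: "log 2 G + 2 * a \<le> (real n - 2 * real L) * mean P \<mu>g"
      "log 2 H + 2 * a \<le> (real n - 2 * real L) * mean P \<mu>h"
      "log 2 F + 2 * a \<le> real n2 * mean P \<mu>h"
    and \<delta>: "4 * window_err + n / F + 2 * 2 ^ B * (n / H) \<le> \<delta>" "0 < \<delta>" "\<delta> < 1 / 2"
  obtains C where "valid_code W C" "adaptive_code C" "bits C = B" "arrivals C = A" "blocklength C = n"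
    "\<And>m. m \<in> messages C \<Longrightarrow> msg_prob W C m (\<lambda>t y r. \<not> on_target C n n2 z m t y r)
      \<le> probe_err + 3 * window_err + A * 2 ^ B / G + 2 * \<delta> + Ecard / z"
    "\<And>m j. m \<in> messages C \<Longrightarrow> j \<in> {1..n} \<Longrightarrow> codeword C m j \<in> set_pmf P"
    "\<And>m. m \<in> messages C \<Longrightarrow> (\<Sum>j=1..n. k (codeword C m j)) \<le> 2 * L * k x0 + (real n - 2 * L) * mean P k + a"
proof -
  have "4 * window_err + real n / F + 2 * real (2 ^ B) * (real n / H) \<le> \<delta>" using \<delta>(1) by simp
  then obtain c :: "nat \<Rightarrow> nat \<Rightarrow> 'a" where c: "\<And>m. m \<in> {1..2 ^ B} \<Longrightarrow> c m \<in> set_pmf codeword_law"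
    "\<And>m. m \<in> {1..2 ^ B} \<Longrightarrow> good (c m)"
    "\<And>m. m \<in> {1..2 ^ B} \<Longrightarrow> self_conf (c m) + (\<Sum>m'\<in>{1..2 ^ B} - {m}. conf (c m) (c m')) \<le> 2 * \<delta>"
    using expurgation[where p = codeword_law and good = good and s = self_conf and conf = conf and M = "2 ^ B",
        OF finite_codeword_law conf_nonneg good_likely[OF means] self_conf_mean conf_mean _ \<delta>(2,3)] by auto
  interpret code_scheme A L w n n2 y0 \<theta> G H F g h B c by unfold_locales
  have letters: "c m j \<in> set_pmf P" if "m \<in> {1..2 ^ B}" "j \<in> {1..n}" for m j
    using codeword_letter(1)[OF c(1)[OF that(1)] that(2)] .
  show ?thesis
  proof (rule that[of code])
    show "valid_code W code" using B letters inputs by (intro valid_code_code) auto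
    show "adaptive_code code" by (rule adaptive_code_code)
    show "bits code = B" "arrivals code = A" "blocklength code = n" by simp_all
    show "codeword code m j \<in> set_pmf P" if "m \<in> messages code" "j \<in> {1..n}" for m j
      using letters that by simp
    show "(\<Sum>j=1..n. k (codeword code m j)) \<le> 2 * L * k x0 + (real n - 2 * L) * mean P k + a"
      if "m \<in> messages code" for m
    proof -
      have "(\<Sum>j=1..n. mean (letter j) k)
          = (\<Sum>j\<in>{1..2 * L}. mean (letter j) k) + (\<Sum>j\<in>{2 * L + 1..n}. mean (letter j) k)"
        using n2 by (subst sum.union_disjoint[symmetric]) (auto intro!: sum.cong)
      also have "\<dots> = (\<Sum>j\<in>{1..2 * L}. k x0) + (\<Sum>j\<in>{2 * L + 1..n}. mean P k)"
        by (intro arg_cong2[where f = "(+)"] sum.cong) (auto simp: letter_def)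
      also have "\<dots> = 2 * L * k x0 + (real n - 2 * L) * mean P k"
        using n2 by (simp add: of_nat_diff)
      finally show ?thesis using c(2)[of m] that by (simp add: good_def)
    qed
    fix m assume "m \<in> messages code"
    then have m: "m \<in> {1..2 ^ B}" by simp
    let ?r = "(times, stop)"
    let ?bad = "\<lambda>t y. \<not> on_target code n n2 z m t y ?r"
    have out: "output_pmf W code m t = law (c m) t" for t
      unfolding output_pmf_def law_def horizon_code
      by (intro Pi_pmf_cong refl arg_cong[where f = "trans W"]) (simp add: channel_input_def inp_def)
    let ?U = "\<lambda>t. {1..(2::nat) ^ B} \<times> {b \<in> {1..t}. b + n \<le> t}"
    let ?X = "\<lambda>t. \<Sum>m'\<in>{1..2 ^ B} - {m}. \<Sum>b\<in>overlap t. Pr (law (c m) t) {y. match_h (c m') b y}"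
    let ?Y = "\<lambda>t. \<Sum>b\<in>{b \<in> overlap t. b + n2 \<le> t}. Pr (law (c m) t) {y. match_end (c m) b y}"
    have pt: "Pr (law (c m) t) {y. ?bad t y} \<le> probe_err + 3 * window_err + A * 2 ^ B / G + ?X t + ?Y t + Ecard / z"
      if t: "t \<in> {1..A}" for t
    proof -
      let ?p = "Pr (law (c m) t)"
      let ?E1 = "{y. \<not> pos (probe t) y}" and ?E2 = "{y. \<not> crit m t y}"
      let ?E3 = "\<Union>(m', b)\<in>?U t. {y. match_g (c m') b y}"
      let ?E4 = "\<Union>m'\<in>{1..2 ^ B} - {m}. \<Union>b\<in>overlap t. {y. match_h (c m') b y}"
      let ?E5 = "\<Union>b\<in>{b \<in> overlap t. b + n2 \<le> t}. {y. match_end (c m) b y}"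
      let ?E6 = "{y. z \<le> real (card (T y))}"
      have sub: "{y. ?bad t y} \<subseteq> ((((?E1 \<union> ?E2) \<union> ?E3) \<union> ?E4) \<union> ?E5) \<union> ?E6"
      proof (rule subsetI, rule ccontr)
        fix y assume y: "y \<in> {y. ?bad t y}" "y \<notin> ((((?E1 \<union> ?E2) \<union> ?E3) \<union> ?E4) \<union> ?E5) \<union> ?E6"
        have p: "pos (probe t) y" and cr: "crit m t y" and z: "real (card (T y)) < z" using y(2) by auto
        have n3: "\<not> match_g (c m') b y" if "m' \<in> {1..2 ^ B}" "1 \<le> b" "b + n \<le> t" for m' b
        proof -
          have "(m', b) \<in> ?U t" using that by auto
          then show ?thesis using y(2) by blast
        qed
        have n4: "\<not> match_h (c m') b y" if "m' \<in> {1..2 ^ B}" "m' \<noteq> m" "1 \<le> b" "t < b + n" "b \<le> t" for m' b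
        proof -
          have "m' \<in> {1..2 ^ B} - {m}" "b \<in> overlap t" using that by (auto simp: overlap_def)
          then show ?thesis using y(2) by blast
        qed
        have n5: "\<not> match_end (c m) b y" if "1 \<le> b" "t < b + n" "b + n2 \<le> t" for b
        proof -
          have "b \<in> {b \<in> overlap t. b + n2 \<le> t}" using that by (auto simp: overlap_def)
          then show ?thesis using y(2) by blast
        qed
        note gp = good_path[OF m t p cr n3 n4 n5]
        have "real (num_samples ?r y) \<le> z"
          using num_samples_le[of y] z by linarith
        then show False using y(1) gp by blast
      qed
      have "?p {y. ?bad t y} \<le> ?p (((((?E1 \<union> ?E2) \<union> ?E3) \<union> ?E4) \<union> ?E5) \<union> ?E6)"
        by (rule prob_subset_le[OF sub])
      also have "\<dots> \<le> ((((?p ?E1 + ?p ?E2) + ?p ?E3) + ?p ?E4) + ?p ?E5) + ?p ?E6"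
        by (intro order.trans[OF prob_Un_le] add_right_mono order.refl)
      also have "\<dots> \<le> ((((probe_err + 3 * window_err) + A * 2 ^ B / G) + ?X t) + ?Y t) + Ecard / z"
      proof (intro add_mono)
        show "?p ?E1 \<le> probe_err" by (rule missed_probe[OF c(1)[OF m] t])
        show "?p ?E2 \<le> 3 * window_err" using own_window[OF c(1)[OF m] t c(2)[OF m]] by (simp only: crit_def)
        show "?p ?E6 \<le> Ecard / z" by (rule card_T_tail[OF t z])
        show "?p ?E5 \<le> ?Y t" using overlap by (intro prob_UN_le) auto
        have "?p ?E4 \<le> (\<Sum>m'\<in>{1..2 ^ B} - {m}. ?p (\<Union>b\<in>overlap t. {y. match_h (c m') b y}))"
          by (intro prob_UN_le) auto
        also have "\<dots> \<le> ?X t" by (intro sum_mono prob_UN_le overlap)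
        finally show "?p ?E4 \<le> ?X t" .
        have "?p ?E3 \<le> (\<Sum>u\<in>?U t. ?p (case u of (m', b) \<Rightarrow> {y. match_g (c m') b y}))"
          by (intro prob_UN_le) auto
        also have "\<dots> \<le> (\<Sum>u\<in>?U t. 1 / G)"
          using t c(1) by (intro sum_mono) (auto intro!: noise_window)
        also have "\<dots> = card (?U t) * (1 / G)" by simp
        also have "\<dots> \<le> (A * 2 ^ B) * (1 / G)"
        proof (intro mult_right_mono)
          have "card {b \<in> {1..t}. b + n \<le> t} \<le> card {1..t}" by (intro card_mono) auto
          then have "card {b \<in> {1..t}. b + n \<le> t} \<le> A" using t by simp
          then have "card (?U t) \<le> 2 ^ B * A" by (simp add: card_cartesian_product)
          then have "real (card (?U t)) \<le> real (2 ^ B * A)" by (simp only: of_nat_le_iff)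
          then show "real (card (?U t)) \<le> A * 2 ^ B" by (simp add: mult.commute)
        qed (use thr in auto)
        finally show "?p ?E3 \<le> A * 2 ^ B / G" by simp
      qed
      finally show ?thesis .
    qed
    have "msg_prob W code m (\<lambda>t y r. \<not> on_target code n n2 z m t y r)
      = (\<Sum>t=1..A. Pr (law (c m) t) {y. ?bad t y}) / A"
      unfolding msg_prob_def out code_simps(2,6) prob_pair_return ..
    also have "\<dots> \<le> (\<Sum>t=1..A. (probe_err + 3 * window_err + A * 2 ^ B / G + Ecard / z) + (?X t + ?Y t)) / A"
    proof (intro divide_right_mono sum_mono)
      fix t assume "t \<in> {1..A}"
      from pt[OF this] show "Pr (law (c m) t) {y. ?bad t y} \<le> (probe_err + 3 * window_err + A * 2 ^ B / G + Ecard / z) + (?X t + ?Y t)"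
        by linarith
    qed simp
    also have "\<dots> = (probe_err + 3 * window_err + A * 2 ^ B / G + Ecard / z) + ((\<Sum>t=1..A. ?X t) / A + (\<Sum>t=1..A. ?Y t) / A)"
      unfolding sum.distrib add_divide_distrib using A1 by simp
    also have "(\<Sum>t=1..A. ?Y t) / A = self_conf (c m)" by (simp only: self_conf_def)
    also have "(\<Sum>t=1..A. ?X t) / A = (\<Sum>m'\<in>{1..2 ^ B} - {m}. conf (c m) (c m'))"
      unfolding conf_def sum_divide_distrib[symmetric] by (subst sum.swap) (rule refl)
    finally show "msg_prob W code m (\<lambda>t y r. \<not> on_target code n n2 z m t y r)
      \<le> probe_err + 3 * window_err + A * 2 ^ B / G + 2 * \<delta> + Ecard / z"
      using c(3)[OF m] by linarith
  qed
qed

end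

section \<open>Likelihood ratios for decoding\<close>

lemma pmf_le_imp_eq:
  fixes p q :: "'b::finite pmf"
  assumes "\<And>y. pmf p y \<le> pmf q y"
  shows "p = q"
proof (rule pmf_eqI)
  fix y
  have "(\<Sum>y\<in>UNIV. pmf q y - pmf p y) = 0"
    by (simp add: sum_subtractf sum_pmf_eq_1)
  then have "\<forall>y\<in>UNIV. pmf q y - pmf p y = 0"
    using assms by (subst (asm) sum_nonneg_eq_0_iff) auto
  then show "pmf p y = pmf q y" by simp
qed

text \<open>Supplies the preamble. If no letter gave any output more mass than \<open>q\<close>, all
  transition laws would equal \<open>q\<close> and the information would vanish.\<close>

lemma distinguishing_letter:
  fixes W :: "('a::finite, 'y::finite) channel"
  assumes "mutual_info W P > 0"
  shows "\<exists>x0\<in>set_pmf P. \<exists>y0. pmf q y0 < pmf (trans W x0) y0"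
proof (rule ccontr)
  assume "\<not> ?thesis"
  then have *: "trans W x = q" if "x \<in> set_pmf P" for x
    using that by (intro pmf_le_imp_eq) (auto simp: not_less)
  then have "output_law W P = bind_pmf P (\<lambda>x. q)"
    unfolding output_law_def by (intro bind_pmf_cong) auto
  then have "mutual_info W P = mean P (\<lambda>x. 0)"
    unfolding mutual_info_eq using * by (intro integral_cong_AE) (auto simp: AE_measure_pmf_iff)
  then show False using assms by simp
qed

lemma rate_bound_positive:
  fixes W :: "('a::finite, 'y::finite) channel"
  assumes ch: "async_channel W" and P: "set_pmf P \<subseteq> inputs W" and \<beta>: "\<beta> > 0"
    and v: "rate_bound W \<beta> P = ennreal v" "v > 0"
  obtains e where "expected_cost W P = ennreal e" "0 < e" "v * e \<le> mutual_info W P" "0 < mutual_info W P"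
    "set_pmf (output_law W P) \<subseteq> set_pmf (trans W (idle W)) \<Longrightarrow>
       v * e * (1 + \<beta>) \<le> mutual_info W P + kl (output_law W P) (trans W (idle W))"
proof -
  let ?I = "mutual_info W P" and ?o = "output_law W P" and ?Qi = "trans W (idle W)"
  have le: "ennreal v \<le> ennreal ?I / expected_cost W P"
    "ennreal v \<le> (ennreal ?I + divergence ?o ?Qi) / (expected_cost W P * ennreal (1 + \<beta>))"
    using v(1) unfolding rate_bound_def by (metis min.cobounded1, metis min.cobounded2 map_snd_joint)
  have I0: "0 < ?I"
  proof (rule ccontr)
    assume "\<not> 0 < ?I"
    then have "ennreal ?I = 0" by (simp add: ennreal_neg)
    then have "ennreal v \<le> 0" using le(1) by simp
    then show False using v(2) by simp
  qed
  have "expected_cost W P \<noteq> \<top>" using le(1) v(2) by auto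
  then obtain e where e: "expected_cost W P = ennreal e" "0 < e"
    using expected_cost_pos[OF ch P I0] by (cases "expected_cost W P") auto
  have "ennreal v \<le> ennreal (?I / e)" using le(1) e I0 by (simp add: divide_ennreal)
  then have "v \<le> ?I / e" using v(2) e I0 by simp
  then have 1: "v * e \<le> ?I" using e by (simp add: le_divide_eq)
  have 2: "v * e * (1 + \<beta>) \<le> ?I + kl ?o ?Qi" if ac: "set_pmf ?o \<subseteq> set_pmf ?Qi"
  proof -
    have D0: "0 \<le> kl ?o ?Qi" by (rule kl_nonneg[OF _ ac]) simp
    have "ennreal v \<le> ennreal ((?I + kl ?o ?Qi) / (e * (1 + \<beta>)))"
      using le(2) ac e \<beta> I0 D0
      by (simp add: divergence_eq divide_ennreal[symmetric] ennreal_mult' ennreal_plus)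
    then have "v \<le> (?I + kl ?o ?Qi) / (e * (1 + \<beta>))" using v(2) e I0 D0 \<beta> by simp
    then have "v * (e * (1 + \<beta>)) \<le> ?I + kl ?o ?Qi" using e \<beta> by (subst (asm) pos_le_divide_eq) auto
    then show ?thesis by (simp add: mult.assoc)
  qed
  show ?thesis by (rule that[OF e 1 I0 2])
qed

text \<open>
  Flooring the idle law at \<open>\<kappa>\<close> keeps the ratio finite; if some output cannot be produced by the idle
  symbol, its mean logarithm grows without bound as \<open>\<kappa>\<close> tends to \<open>0\<close>.
\<close>

lemma noise_ratio:
  fixes W :: "('a::finite, 'y::finite) channel" and q :: "'y pmf"
  assumes J: "set_pmf (output_law W P) \<subseteq> set_pmf q \<Longrightarrow> J \<le> mutual_info W P + kl (output_law W P) q"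
  obtains g :: "'a \<Rightarrow> 'y \<Rightarrow> real" where "\<And>x y. 0 \<le> g x y" "\<And>x. mean q (g x) \<le> 1"
    "\<And>x y. y \<in> set_pmf (trans W x) \<Longrightarrow> 0 < g x y"
    "J \<le> mean P (mean_log W g)"
proof -
  let ?o = "output_law W P"
  define g where "g \<kappa> x y = pmf (trans W x) y / max (pmf q y) \<kappa>" for \<kappa> :: real and x y
  have g: "0 \<le> g \<kappa> x y" "mean q (g \<kappa> x) \<le> 1" "y \<in> set_pmf (trans W x) \<Longrightarrow> 0 < g \<kappa> x y"
    if \<kappa>: "0 < \<kappa>" for \<kappa> x y
  proof -
    have m: "0 < max (pmf q y) \<kappa>" for y using \<kappa> by simp
    show "0 \<le> g \<kappa> x y" using m[of y] by (simp add: g_def)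
    show "0 < g \<kappa> x y" if "y \<in> set_pmf (trans W x)" using that m[of y] by (simp add: g_def pmf_positive)
    have "mean q (g \<kappa> x) \<le> (\<Sum>y\<in>UNIV. pmf (trans W x) y)"
      unfolding expectation_finite
    proof (rule sum_mono)
      fix y
      have "pmf q y / max (pmf q y) \<kappa> \<le> 1" using m[of y] by (simp add: divide_le_eq)
      then have "pmf (trans W x) y * (pmf q y / max (pmf q y) \<kappa>) \<le> pmf (trans W x) y * 1"
        by (intro mult_left_mono) auto
      then show "pmf q y * g \<kappa> x y \<le> pmf (trans W x) y" by (simp add: g_def mult.commute)
    qed
    then show "mean q (g \<kappa> x) \<le> 1" by (simp add: sum_pmf_eq_1)
  qed
  show ?thesis
  proof (cases "set_pmf ?o \<subseteq> set_pmf q")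
    case True
    \<comment> \<open>At the smallest positive probability the floor never acts on outputs that can
      occur, and \<open>g\<close> is the plain likelihood ratio there.\<close>
    define \<kappa> where "\<kappa> = Min (pmf q ` set_pmf q)"
    have \<kappa>: "0 < \<kappa>" "\<And>y. y \<in> set_pmf q \<Longrightarrow> \<kappa> \<le> pmf q y"
      unfolding \<kappa>_def by (auto simp: set_pmf_not_empty pmf_positive)
    have "mean P (mean_log W (g \<kappa>))
        = mean P (\<lambda>x. kl (trans W x) q)"
    proof (intro integral_cong_AE)
      have "mean_log W (g \<kappa>) x = kl (trans W x) q" if x: "x \<in> set_pmf P" for x
        unfolding kl_def
      proof (intro integral_cong_AE)
        have "log 2 (g \<kappa> x y) = log 2 (pmf (trans W x) y / pmf q y)" if "y \<in> set_pmf (trans W x)" for y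
        proof -
          have "y \<in> set_pmf q" using set_output_law[OF x, of W] True that by auto
          then show ?thesis using \<kappa>(2)[of y] by (simp add: g_def max_def)
        qed
        then show "AE y in trans W x. log 2 (g \<kappa> x y) = log 2 (pmf (trans W x) y / pmf q y)"
          by (simp add: AE_measure_pmf_iff)
      qed auto
      then show "AE x in P. mean_log W (g \<kappa>) x = kl (trans W x) q"
        by (simp add: AE_measure_pmf_iff)
    qed auto
    then show ?thesis
      using that[of "g \<kappa>"] g[OF \<kappa>(1)] J[OF True] compensation_identity[OF True] by simp
  next
    case False
    then obtain y1 where y1: "y1 \<in> set_pmf ?o" "pmf q y1 = 0" by (auto simp: set_pmf_iff)
    have o1: "0 < pmf ?o y1" using y1 by (simp add: pmf_positive)
    define S where "S = mean P (\<lambda>x. mean (trans W x) (\<lambda>y. log 2 (pmf (trans W x) y)))"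
    \<comment> \<open>\<open>y1\<close> occurs under the input law but not under the idle law.
      Flooring at \<open>2 powr (- u)\<close> makes it contribute \<open>pmf ?o y1 * u\<close>,
      enough to lift the mean log ratio from \<open>S\<close> to \<open>J\<close>; all other outputs
      contribute at least 0.\<close>
    define u where "u = max 0 ((J - S) / pmf ?o y1)"
    define \<kappa> :: real where "\<kappa> = 2 powr (- u)"
    have "0 \<le> u" by (simp add: u_def)
    then have "2 powr (- u) \<le> 2 powr (0 :: real)" by (intro powr_mono) auto
    then have \<kappa>: "0 < \<kappa>" "\<kappa> \<le> 1" "log 2 \<kappa> = - u" by (simp_all add: \<kappa>_def)
    have pt: "mean_log W (g \<kappa>) x
        = mean (trans W x) (\<lambda>y. log 2 (pmf (trans W x) y)) - (\<Sum>y\<in>UNIV. pmf (trans W x) y * log 2 (max (pmf q y) \<kappa>))" for x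
    proof -
      have "pmf (trans W x) y * log 2 (g \<kappa> x y) = pmf (trans W x) y * log 2 (pmf (trans W x) y) - pmf (trans W x) y * log 2 (max (pmf q y) \<kappa>)" for y
      proof (cases "pmf (trans W x) y = 0")
        case False
        then have "0 < pmf (trans W x) y" by (simp add: pmf_pos)
        moreover have "0 < max (pmf q y) \<kappa>" using \<kappa> by simp
        ultimately have "log 2 (g \<kappa> x y) = log 2 (pmf (trans W x) y) - log 2 (max (pmf q y) \<kappa>)"
          unfolding g_def by (simp add: log_divide del: max_less_iff_conj less_max_iff_disj)
        then show ?thesis by (simp add: right_diff_distrib)
      qed simp
      then show ?thesis unfolding expectation_finite by (simp add: sum_subtractf)
    qed
    have "mean P (mean_log W (g \<kappa>))
        = S - (\<Sum>x\<in>UNIV. \<Sum>y\<in>UNIV. pmf P x * (pmf (trans W x) y * log 2 (max (pmf q y) \<kappa>)))"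
      unfolding pt S_def expectation_finite[of P] by (simp add: right_diff_distrib sum_subtractf sum_distrib_left)
    also have "(\<Sum>x\<in>UNIV. \<Sum>y\<in>UNIV. pmf P x * (pmf (trans W x) y * log 2 (max (pmf q y) \<kappa>)))
        = (\<Sum>y\<in>UNIV. pmf ?o y * log 2 (max (pmf q y) \<kappa>))"
      by (subst sum.swap) (simp add: pmf_output_law sum_distrib_right mult.assoc)
    finally have E: "mean P (mean_log W (g \<kappa>))
        = S - (\<Sum>y\<in>UNIV. pmf ?o y * log 2 (max (pmf q y) \<kappa>))" .
    have "(\<Sum>y\<in>UNIV. pmf ?o y * log 2 (max (pmf q y) \<kappa>)) \<le> (\<Sum>y\<in>UNIV. if y = y1 then pmf ?o y1 * log 2 \<kappa> else 0)"
    proof (rule sum_mono)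
      fix y
      have "0 < max (pmf q y) \<kappa>" "max (pmf q y) \<kappa> \<le> 1" using \<kappa> by (auto simp: pmf_le_1)
      then have "log 2 (max (pmf q y) \<kappa>) \<le> 0" by simp
      then show "pmf ?o y * log 2 (max (pmf q y) \<kappa>) \<le> (if y = y1 then pmf ?o y1 * log 2 \<kappa> else 0)"
        using y1 \<kappa> by (auto simp: max_def mult_nonneg_nonpos)
    qed
    also have "\<dots> = - (pmf ?o y1 * u)" using \<kappa> by simp
    finally have U: "(\<Sum>y\<in>UNIV. pmf ?o y * log 2 (max (pmf q y) \<kappa>)) \<le> - (pmf ?o y1 * u)" .
    have "pmf ?o y1 * u \<ge> J - S"
    proof -
      have "(J - S) / pmf ?o y1 \<le> u" by (simp add: u_def)
      then show ?thesis using o1 by (simp add: divide_le_eq mult.commute)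
    qed
    then have "J \<le> mean P (mean_log W (g \<kappa>))"
      using E U by linarith
    then show ?thesis using that[of "g \<kappa>"] g[OF \<kappa>(1)] by simp
  qed
qed

lemma message_ratio:
  fixes W :: "('a::finite, 'y::finite) channel" and P :: "'a pmf"
  defines "h \<equiv> \<lambda>x y. pmf (trans W x) y / pmf (output_law W P) y"
  shows "0 \<le> h x y" "mean P (\<lambda>x. h x y) \<le> 1"
    "x \<in> set_pmf P \<Longrightarrow> y \<in> set_pmf (trans W x) \<Longrightarrow> 0 < h x y"
    "mean P (mean_log W h) = mutual_info W P"
proof -
  show "0 \<le> h x y" by (simp add: h_def)
  have "mean P (\<lambda>x. h x y) = pmf (output_law W P) y / pmf (output_law W P) y"
    by (simp add: expectation_finite h_def pmf_output_law[of W P y] times_divide_eq_right flip: sum_divide_distrib)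
  \<comment> \<open>Only an inequality: at outputs that never occur the quotient 0 / 0 is 0.\<close>
  also have "\<dots> \<le> 1" by simp
  finally show "mean P (\<lambda>x. h x y) \<le> 1" .
  show "0 < h x y" if "x \<in> set_pmf P" "y \<in> set_pmf (trans W x)"
    using set_output_law[OF that(1), of W] that(2) by (auto simp: h_def pmf_positive)
  show "mean P (mean_log W h) = mutual_info W P"
    by (simp add: mutual_info_eq kl_def h_def)
qed

section \<open>Asymptotics of the code parameters\<close>

text \<open>One item for each estimate in \<open>slack_codes\<close>: \<open>probe_err\<close>,
  \<open>window_err\<close>, false acceptance of noise, the two confusion terms, and the mean number
  of samples relative to the arrival window; the last two give \<open>w \<le> L\<close> and
  \<open>n \<le> A\<close>.\<close>

lemma vanishing_bounds:
  fixes \<beta> \<eta> \<kappa> q s u \<xi> :: real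
  assumes "0 < \<beta>" "0 < \<eta>" "0 < \<kappa>" "0 < q" "0 < s" "0 < u" "0 < \<xi>"
  shows "((\<lambda>B. exp (- (sqrt (real B) * q))) \<longlongrightarrow> 0) sequentially"
    and "((\<lambda>B. exp (- (real B * s))) \<longlongrightarrow> 0) sequentially"
    and "((\<lambda>B. 2 * 2 powr (- (u * real B))) \<longlongrightarrow> (0 :: real)) sequentially"
    and "((\<lambda>B. \<kappa> * real B * 2 powr (- (u * real B))) \<longlongrightarrow> 0) sequentially"
    and "((\<lambda>B. ((sqrt (real B) + 1) * (2 / (\<eta> * real B) + 1 / 2 powr (\<beta> * real B)) + 1 / 2 powr (\<beta> * real B)
        + \<kappa> * real B * ((2 * \<kappa> * real B + 2) / 2 powr (\<beta> * real B)
            + (2 / (\<eta> * real B) + 1 / 2 powr (\<beta> * real B)) * exp (- (sqrt (real B) * q)))) / \<xi>) \<longlongrightarrow> 0) sequentially"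
    and "\<forall>\<^sub>F B in sequentially. sqrt (real B) + 1 \<le> \<eta> * real B"
    and "\<forall>\<^sub>F B in sequentially. \<kappa> * real B \<le> 2 powr (\<beta> * real B)"
  using assms by real_asymp+

text \<open>\<open>r\<close> is the number of letters per bit. The last two assumptions say that
  \<open>r * B\<close> letters supply (1 + \<beta>) B bits of evidence against noise and
  \<open>B\<close> bits against other messages.\<close>

locale test_setting =
  fixes W :: "('a::finite, 'y::finite) channel" and P :: "'a pmf" and x0 :: 'a and y0 :: 'y
    and g h :: "'a \<Rightarrow> 'y \<Rightarrow> real" and c0 :: real and k :: "'a \<Rightarrow> real" and \<beta> r :: real
  assumes inputs: "set_pmf P \<subseteq> inputs W"
    and x0: "x0 \<in> set_pmf P" "pmf (trans W (idle W)) y0 < pmf (trans W x0) y0"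
    and nonneg: "\<And>x y. 0 \<le> g x y" "\<And>x y. 0 \<le> h x y" and c0: "0 < c0"
    and g_idle: "\<And>x. x \<in> set_pmf P \<Longrightarrow> mean (trans W (idle W)) (g x) \<le> 1"
    and h_avg: "\<And>y. mean P (\<lambda>x. h x y) \<le> 1"
    and logs: "\<And>x y. x \<in> set_pmf P \<Longrightarrow> y \<in> set_pmf (trans W x) \<Longrightarrow>
        0 < g x y \<and> 0 < h x y \<and> \<bar>log 2 (g x y)\<bar> \<le> c0 \<and> \<bar>log 2 (h x y)\<bar> \<le> c0"
    and cost: "\<And>x. x \<in> set_pmf P \<Longrightarrow> \<bar>k x\<bar> \<le> c0" "\<And>x. 0 \<le> k x"
    and \<beta>: "0 < \<beta>" and r: "0 < r"
    and g_mean: "1 + \<beta> \<le> r * mean P (mean_log W g)"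
    and h_mean: "1 \<le> r * mean P (mean_log W h)"
begin

definition "Jg = mean P (mean_log W g)"
definition "Jh = mean P (mean_log W h)"

lemma Jpos: "0 < Jg" "0 < Jh"
  using g_mean h_mean r \<beta> unfolding Jg_def Jh_def
  by (metis add_pos_pos less_le_trans zero_less_one zero_less_mult_pos)+

text \<open>\<open>\<eta>\<close> is the relative surplus of letters, \<open>\<xi>\<close> the share
  of the arrival window that may be sampled, \<open>\<zeta>\<close> the failure probability. The
  preamble adds \<open>2 * \<eta>\<close> to the length per bit, and rounding adds at most 3 in
  all.\<close>

definition slack_code :: "real \<Rightarrow> real \<Rightarrow> real \<Rightarrow> nat \<Rightarrow> ('a, 'y) code \<Rightarrow> nat \<Rightarrow> bool" where
  "slack_code \<eta> \<xi> \<zeta> B C n2 \<longleftrightarrow> valid_code W C \<and> adaptive_code C \<and> bits C = B \<and>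
     arrivals C = nat \<lceil>2 powr (\<beta> * real B)\<rceil> \<and>
     r * (1 + \<eta>) * real B \<le> real (blocklength C) \<and>
     real (blocklength C) \<le> (r * (1 + \<eta>) + 2 * \<eta>) * real B + 3 \<and>
     real n2 \<le> \<eta> * real B + 1 \<and> n2 \<le> blocklength C \<and>
     (\<forall>m\<in>messages C. msg_prob W C m (\<lambda>t y r. \<not> on_target C (blocklength C) n2 (\<xi> * real (arrivals C)) m t y r) \<le> \<zeta>) \<and>
     (\<forall>m\<in>messages C. \<forall>j\<in>{1..blocklength C}. codeword C m j \<in> set_pmf P) \<and>
     (\<forall>m\<in>messages C. (\<Sum>j=1..blocklength C. k (codeword C m j))
        \<le> (2 * \<eta> * B + 2) * k x0 + (r * (1 + \<eta>) * B + 1) * mean P k + \<eta> * B)"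

lemma slack_codes:
  assumes \<eta>: "0 < \<eta>" "\<eta> \<le> r" and \<xi>: "0 < \<xi>" and \<zeta>: "0 < \<zeta>" "\<zeta> \<le> 1"
  shows "\<forall>\<^sub>F B in sequentially. \<exists>C n2. slack_code \<eta> \<xi> \<zeta> B C n2"
proof -
  define q where "q = (pmf (trans W x0) y0 - pmf (trans W (idle W)) y0)\<^sup>2 / 8"
  \<comment> \<open>The final 1 absorbs the rounding term 3 as soon as \<open>B \<ge> 3\<close>, so
    that \<open>n \<le> \<kappa> * B\<close>.\<close>
  define \<kappa> where "\<kappa> = r * (1 + \<eta>) + 2 * \<eta> + 1"
  \<comment> \<open>The deviation is \<open>\<gamma> * B\<close>. The divisor 8 makes twice the
    deviation at most a quarter of the respective surplus; half of the surplus is already spent on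
    the thresholds.\<close>
  define \<gamma> where "\<gamma> = min (\<eta> / 8) (\<eta> * Jh / 8)"
  define s where "s = \<gamma>\<^sup>2 / (2 * c0\<^sup>2 * \<kappa>)"
  have q: "0 < q" using x0 by (simp add: q_def)
  have \<kappa>: "0 < \<kappa>" using r \<eta> by (simp add: \<kappa>_def add_pos_pos)
  have \<gamma>: "0 < \<gamma>" "\<gamma> \<le> \<eta> / 8" "\<gamma> \<le> \<eta> * Jh / 8" using \<eta> Jpos by (simp_all add: \<gamma>_def)
  have s: "0 < s" using \<gamma> c0 \<kappa> by (simp add: s_def)
  have u: "0 < (1 + \<beta>) * (\<eta> / 2)" "0 < \<eta> * Jh / 2" "0 < \<eta> / 2" using \<beta> \<eta> Jpos by simp_all
  note vb = vanishing_bounds[OF \<beta> \<eta>(1) \<kappa> q s _ \<xi>]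
  \<comment> \<open>Shares of \<zeta>: the expurgation parameter is 4/96 + 1/24 + 1/24 = 1/8, and
    the total 1/8 + 3/96 + 1/8 + 2/8 + 1/8 stays below 1.\<close>
  have z: "0 < \<zeta> / 8" "0 < \<zeta> / 96" "0 < \<zeta> / 24" using \<zeta> by simp_all
  have "\<forall>\<^sub>F B in sequentially. exp (- (sqrt (real B) * q)) < \<zeta> / 8"
    by (rule order_tendstoD(2)[OF vb(1)[OF u(1)] z(1)])
  moreover have "\<forall>\<^sub>F B in sequentially. exp (- (real B * s)) < \<zeta> / 96"
    by (rule order_tendstoD(2)[OF vb(2)[OF u(1)] z(2)])
  moreover have "\<forall>\<^sub>F B in sequentially. 2 * 2 powr (- ((1 + \<beta>) * (\<eta> / 2) * real B)) < \<zeta> / 8"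
    by (rule order_tendstoD(2)[OF vb(3)[OF u(1)] z(1)])
  moreover have "\<forall>\<^sub>F B in sequentially. \<kappa> * real B * 2 powr (- (\<eta> * Jh / 2 * real B)) < \<zeta> / 24"
    by (rule order_tendstoD(2)[OF vb(4)[OF u(2)] z(3)])
  moreover have "\<forall>\<^sub>F B in sequentially. 2 * (\<kappa> * real B * 2 powr (- (\<eta> / 2 * real B))) < \<zeta> / 24"
  proof -
    have "0 < \<zeta> / 48" using \<zeta> by simp
    from order_tendstoD(2)[OF vb(4)[OF u(3)] this] show ?thesis
      by eventually_elim linarith
  qed
  moreover note order_tendstoD(2)[OF vb(5)[OF u(1)] z(1)]
  moreover note vb(6)[OF u(1)]
  moreover note vb(7)[OF u(1)]
  moreover have "\<forall>\<^sub>F B in sequentially. (3::nat) \<le> B" by (rule eventually_ge_at_top)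
  ultimately show ?thesis
  proof eventually_elim
    case (elim B)
    have B: "0 < real B" using elim(9) by simp
    define D where "D = 2 powr (\<beta> * real B)"
    define A where "A = nat \<lceil>D\<rceil>"
    define L where "L = nat \<lceil>\<eta> * real B\<rceil>"
    \<comment> \<open>Between constant and linear: the growing width makes \<open>probe_err\<close>
      vanish, while the probed fraction \<open>w / L\<close> still tends to 0.\<close>
    define w where "w = nat \<lceil>sqrt (real B)\<rceil>"
    define n1 where "n1 = nat \<lceil>r * (1 + \<eta>) * real B\<rceil>"
    define n where "n = 2 * L + n1"
    \<comment> \<open>Thresholds take half of the surplus. The letters supply a factor 1 + \<eta>;
      the union bounds need exponents above (1 + \<beta>) B for \<open>G\<close> and above
      \<open>B\<close> for \<open>H\<close>, and the factor 1 + \<eta> / 2 lies in between.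
      \<open>F\<close> uses half of what the last \<open>L\<close> letters supply.\<close>
    define G where "G = 2 powr ((1 + \<beta>) * (1 + \<eta> / 2) * real B)"
    define H where "H = 2 powr ((1 + \<eta> / 2) * real B)"
    define F where "F = 2 powr (\<eta> * Jh / 2 * real B)"
    define \<theta> where "\<theta> = w * ((pmf (trans W (idle W)) y0 + pmf (trans W x0) y0) / 2)"
    have D1: "1 \<le> D" unfolding D_def using \<beta> by (intro ge_one_powr_ge_zero) auto
    have A: "D \<le> A" "A \<le> D + 1" "1 \<le> A" using D1 by (auto simp: A_def) linarith+
    have ceil: "x \<le> real (nat \<lceil>x\<rceil>)" "real (nat \<lceil>x\<rceil>) \<le> x + 1" if "0 \<le> x" for x :: real
      using that by linarith+
    have L: "\<eta> * B \<le> L" "L \<le> \<eta> * B + 1" unfolding L_def using \<eta> by (intro ceil; simp)+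
    note kpos = cost(2)
    have bw: "sqrt B \<le> w" "w \<le> sqrt B + 1" unfolding w_def by (intro ceil; simp)+
    have bn: "r * (1 + \<eta>) * B \<le> n1" "n1 \<le> r * (1 + \<eta>) * B + 1"
      unfolding n1_def using r \<eta> by (intro ceil; simp)+
    have n: "real n = 2 * real L + real n1" by (simp add: n_def)
    have n_up: "n \<le> (r * (1 + \<eta>) + 2 * \<eta>) * B + 3" using n bn L by (simp add: algebra_simps)
    have n\<kappa>: "n \<le> \<kappa> * B"
    proof -
      have "n \<le> (r * (1 + \<eta>) + 2 * \<eta>) * B + B" using n_up elim(9) by linarith
      then show ?thesis by (simp add: \<kappa>_def algebra_simps)
    qed
    have wL: "1 \<le> w" "w \<le> L"
    proof -
      have "0 < sqrt B" using B by simp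
      then show "1 \<le> w" using bw(1) by (cases w) auto
      have "real w \<le> real L" using bw(2) elim(7) L(1) by linarith
      then show "w \<le> L" by simp
    qed
    have Ln: "1 \<le> L" "2 * L + L \<le> n"
    proof -
      show "1 \<le> L" using wL by simp
      have "\<eta> * B \<le> r * (1 + \<eta>) * B"
        using \<eta> r B by (intro mult_right_mono) (auto simp: algebra_simps intro: order_trans add_increasing2)
      then have "L \<le> n1" unfolding L_def n1_def by (intro nat_mono ceiling_mono)
      then show "2 * L + L \<le> n" by (simp add: n_def)
    qed
    \<comment> \<open>Here \<open>n2 = L\<close>, so the uncertainty of the decision time is at most
      about \<eta> B.\<close>
    interpret coding_setting A L w n L y0 \<theta> G H F g h W P x0 "\<gamma> * B" c0 k
    proof
      show "1 \<le> A" by (rule A)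
      show "1 \<le> w" "w \<le> L" "1 \<le> L" "2 * L + L \<le> n" by (fact wL Ln)+
      show "\<theta> = w * ((pmf (trans W (idle W)) y0 + pmf (trans W x0) y0) / 2)" by (rule \<theta>_def)
      show "0 < G" "0 < H" "0 < F" by (simp_all add: G_def H_def F_def)
      show "0 \<le> \<gamma> * real B" using \<gamma> by simp
    qed (fact x0 nonneg c0 g_idle h_avg logs cost(1))+
    have lg: "log 2 G = (1 + \<beta>) * (1 + \<eta> / 2) * B" "log 2 H = (1 + \<eta> / 2) * B" "log 2 F = \<eta> * Jh / 2 * B"
      by (simp_all add: G_def H_def F_def)
    have \<mu>: "mean P \<mu>g = Jg" "mean P \<mu>h = Jh"
      by (simp_all add: Jg_def Jh_def \<mu>g_def[abs_def] \<mu>h_def[abs_def])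
    have nL: "real n - 2 * real L = n1" by (simp add: n)
    have \<gamma>B: "2 * (\<gamma> * B) \<le> \<eta> / 4 * B" "2 * (\<gamma> * B) \<le> \<eta> * Jh / 4 * B"
    proof -
      have "(2 * \<gamma>) * B \<le> \<eta> / 4 * B" using \<gamma> by (intro mult_right_mono) auto
      then show "2 * (\<gamma> * B) \<le> \<eta> / 4 * B" by (simp only: mult.assoc)
      have "(2 * \<gamma>) * B \<le> \<eta> * Jh / 4 * B" using \<gamma> by (intro mult_right_mono) auto
      then show "2 * (\<gamma> * B) \<le> \<eta> * Jh / 4 * B" by (simp only: mult.assoc)
    qed
    have \<eta>B: "0 < \<eta> * B" using \<eta> B by simp
    have m1: "log 2 G + 2 * (\<gamma> * B) \<le> (real n - 2 * real L) * mean P \<mu>g"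
    proof -
      have "(1 + \<beta>) * ((1 + \<eta>) * B) \<le> (r * Jg) * ((1 + \<eta>) * B)"
        using g_mean \<eta> by (intro mult_right_mono) (auto simp: Jg_def)
      also have "\<dots> = (r * (1 + \<eta>) * B) * Jg" by simp
      also have "\<dots> \<le> n1 * Jg" using bn Jpos by (intro mult_right_mono) auto
      finally have "(1 + \<beta>) * ((1 + \<eta>) * B) \<le> n1 * Jg" .
      moreover have "(1 + \<beta>) * (1 + \<eta> / 2) * B + \<eta> / 4 * B \<le> (1 + \<beta>) * ((1 + \<eta>) * B)"
      proof -
        have "0 \<le> \<beta> * (\<eta> * B)" using \<beta> \<eta>B by simp
        moreover have "(1 + \<beta>) * ((1 + \<eta>) * B) - ((1 + \<beta>) * (1 + \<eta> / 2) * B + \<eta> / 4 * B) = \<eta> * B / 4 + \<beta> * (\<eta> * B) / 2"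
          by (simp add: field_simps)
        ultimately show ?thesis using \<eta>B by linarith
      qed
      ultimately show ?thesis unfolding lg nL \<mu> using \<gamma>B(1) by linarith
    qed
    have hn: "(1 + \<eta>) * B \<le> n1 * Jh"
    proof -
      have "1 * ((1 + \<eta>) * B) \<le> (r * Jh) * ((1 + \<eta>) * B)"
        using h_mean \<eta> by (intro mult_right_mono) (auto simp: Jh_def)
      also have "\<dots> = (r * (1 + \<eta>) * B) * Jh" by simp
      also have "\<dots> \<le> n1 * Jh" using bn Jpos by (intro mult_right_mono) auto
      finally show ?thesis by simp
    qed
    have m2: "log 2 H + 2 * (\<gamma> * B) \<le> (real n - 2 * real L) * mean P \<mu>h"
      unfolding lg nL \<mu> using hn \<gamma>B(1) \<eta>B by (simp add: algebra_simps)
    have m3: "log 2 F + 2 * (\<gamma> * B) \<le> real L * mean P \<mu>h"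
    proof -
      have "\<eta> * B * Jh \<le> L * Jh" using L Jpos by (intro mult_right_mono) auto
      moreover have "0 \<le> \<eta> * Jh * B" using \<eta> Jpos by simp
      ultimately show ?thesis unfolding lg \<mu> using \<gamma>B(2) by (simp add: algebra_simps)
    qed
    define E1 where "E1 = exp (- (sqrt (real B) * q))"
    have probe_err: "probe_err \<le> E1"
    proof -
      have "sqrt B * q \<le> w * q" using bw q by (intro mult_right_mono) auto
      then show ?thesis by (simp add: probe_err_def E1_def q_def)
    qed
    have window_err: "window_err \<le> \<zeta> / 96"
    proof -
      have n0: "0 < real n" using Ln by simp
      have "B * s = (\<gamma> * B)\<^sup>2 / (2 * c0\<^sup>2 * (\<kappa> * B))"
        using B by (simp add: s_def power2_eq_square mult_ac)
      also have "\<dots> \<le> (\<gamma> * B)\<^sup>2 / (2 * c0\<^sup>2 * n)"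
        using n\<kappa> n0 c0 \<kappa> B by (intro divide_left_mono mult_left_mono mult_pos_pos) auto
      finally have "window_err \<le> exp (- (B * s))" by (simp add: window_err_def)
      then show ?thesis using elim(2) by linarith
    qed
    have pw: "(2 :: real) ^ B = 2 powr B" by (simp add: powr_realpow)
    have AG: "A * 2 ^ B / G \<le> \<zeta> / 8"
    proof -
      have "A * 2 ^ B / G \<le> (2 * D) * 2 ^ B / G"
        using A D1 by (intro divide_right_mono mult_right_mono) (auto simp: G_def)
      also have "\<dots> = 2 * (2 powr (\<beta> * B) * 2 powr B / 2 powr ((1 + \<beta>) * (1 + \<eta> / 2) * real B))"
        unfolding D_def G_def pw by simp
      also have "\<dots> = 2 * 2 powr (\<beta> * B + B - (1 + \<beta>) * (1 + \<eta> / 2) * B)"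
        by (simp only: powr_add powr_diff)
      also have "\<beta> * B + B - (1 + \<beta>) * (1 + \<eta> / 2) * B = - ((1 + \<beta>) * (\<eta> / 2) * real B)"
        by (simp add: field_simps)
      finally show ?thesis using elim(3) by linarith
    qed
    have nF: "n / F \<le> \<zeta> / 24"
    proof -
      have "n / F \<le> \<kappa> * B / F" using n\<kappa> by (intro divide_right_mono) (auto simp: F_def)
      also have "\<dots> = \<kappa> * real B * 2 powr (- (\<eta> * Jh / 2 * real B))"
        by (simp add: F_def powr_minus_divide)
      finally show ?thesis using elim(4) by linarith
    qed
    have nH: "2 * 2 ^ B * (n / H) \<le> \<zeta> / 24"
    proof -
      have "2 * 2 ^ B * (n / H) \<le> 2 * 2 ^ B * (\<kappa> * B / H)"
        using n\<kappa> by (intro divide_right_mono mult_left_mono) (auto simp: H_def)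
      also have "\<dots> = 2 * (\<kappa> * real B * (2 powr B / H))" by (simp add: pw)
      also have "2 powr B / H = 2 powr (- (\<eta> / 2 * real B))"
      proof -
        have "2 powr B / H = 2 powr (B - (1 + \<eta> / 2) * B)" unfolding H_def by (simp only: powr_diff)
        also have "B - (1 + \<eta> / 2) * B = - (\<eta> / 2 * real B)" by (simp add: field_simps)
        finally show ?thesis .
      qed
      finally show ?thesis using elim(5) by linarith
    qed
    have \<delta>: "4 * window_err + n / F + 2 * 2 ^ B * (n / H) \<le> \<zeta> / 8" "0 < \<zeta> / 8" "\<zeta> / 8 < 1 / 2"
      using window_err nF nH \<zeta> by linarith+
    have z: "0 < \<xi> * A" using \<xi> A by simp
    have Ez: "Ecard / (\<xi> * A) \<le> \<zeta> / 8"
    proof -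
      have AD: "1 \<le> A / D" using A D1 by simp
      have N2: "N \<le> 2 * real A"
      proof -
        have "real N \<le> A + n" by (simp add: N_def)
        then show ?thesis using n\<kappa> elim(8) A(1) by (simp add: D_def)
      qed
      have "real (N div L) \<le> real N / real L" by (rule of_nat_div_le_of_nat)
      also have "\<dots> \<le> 2 * A / (\<eta> * B)" using N2 L \<eta>B by (intro frac_le) auto
      finally have Y: "real (N div L) + 1 \<le> A * (2 / (\<eta> * B) + 1 / D)" using AD by (simp add: algebra_simps)
      have Y0: "0 \<le> A * (2 / (\<eta> * B) + 1 / D)" using \<eta>B D1 by simp
      have E0: "0 \<le> E1" by (simp add: E1_def)
      \<comment> \<open>Because \<open>A / D \<ge> 1\<close>, constants may be multiplied by it.
        Then \<open>A\<close> factors out and cancels, leaving the expression in \<open>D\<close>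
        that was shown to vanish.\<close>
      have "Ecard = w * (real (N div L) + 1) + 1 + n * ((2 * real n + 2) * 1 + (real (N div L) + 1) * probe_err)"
        by (simp add: Ecard_def algebra_simps)
      also have "\<dots> \<le> (sqrt B + 1) * (A * (2 / (\<eta> * B) + 1 / D)) + A / D
         + (\<kappa> * B) * ((2 * (\<kappa> * B) + 2) * (A / D) + (A * (2 / (\<eta> * B) + 1 / D)) * E1)"
        using bw n\<kappa> Y Y0 AD probe_err E0 \<kappa> B by (intro add_mono mult_mono) (auto simp: probe_err_def)
      also have "\<dots> = A * ((sqrt B + 1) * (2 / (\<eta> * B) + 1 / D) + 1 / D
         + \<kappa> * B * ((2 * \<kappa> * B + 2) / D + (2 / (\<eta> * B) + 1 / D) * E1))"
        by (simp add: algebra_simps add_divide_distrib)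
      finally have "Ecard / (\<xi> * A) \<le> A * ((sqrt B + 1) * (2 / (\<eta> * B) + 1 / D) + 1 / D
         + \<kappa> * B * ((2 * \<kappa> * B + 2) / D + (2 / (\<eta> * B) + 1 / D) * E1)) / (\<xi> * A)"
        using z by (intro divide_right_mono) auto
      also have "\<dots> = ((sqrt B + 1) * (2 / (\<eta> * B) + 1 / D) + 1 / D
         + \<kappa> * B * ((2 * \<kappa> * B + 2) / D + (2 / (\<eta> * B) + 1 / D) * E1)) / \<xi>"
        using A(3) by simp
      finally show ?thesis using elim(6) unfolding D_def E1_def by linarith
    qed
    have B1: "1 \<le> B" using elim(9) by simp
    obtain C where C: "valid_code W C" "adaptive_code C" "bits C = B" "arrivals C = A" "blocklength C = n"
      "\<And>m. m \<in> messages C \<Longrightarrow> msg_prob W C m (\<lambda>t y r. \<not> on_target C n L (\<xi> * A) m t y r)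
        \<le> probe_err + 3 * window_err + A * 2 ^ B / G + 2 * (\<zeta> / 8) + Ecard / (\<xi> * A)"
      "\<And>m j. m \<in> messages C \<Longrightarrow> j \<in> {1..n} \<Longrightarrow> codeword C m j \<in> set_pmf P"
      "\<And>m. m \<in> messages C \<Longrightarrow> (\<Sum>j=1..n. k (codeword C m j)) \<le> 2 * L * k x0 + (real n - 2 * L) * mean P k + \<gamma> * B"
      using random_code[OF B1 inputs z m1 m2 m3 \<delta>] by blast
    have tot: "probe_err + 3 * window_err + A * 2 ^ B / G + 2 * (\<zeta> / 8) + Ecard / (\<xi> * A) \<le> \<zeta>"
      using probe_err elim(1) window_err AG Ez \<zeta> unfolding E1_def by linarith
    have cst: "2 * L * k x0 + (real n - 2 * L) * mean P k + \<gamma> * B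
        \<le> (2 * \<eta> * B + 2) * k x0 + (r * (1 + \<eta>) * B + 1) * mean P k + \<eta> * B"
    proof (intro add_mono mult_mono)
      show "0 \<le> mean P k" using kpos by simp
    qed (use L bn nL kpos \<eta> \<gamma> r in auto)
    have "slack_code \<eta> \<xi> \<zeta> B C L"
      unfolding slack_code_def C(3-5)
    proof (intro conjI ballI)
      show "valid_code W C" "adaptive_code C" by (fact C)+
      show "A = nat \<lceil>2 powr (\<beta> * real B)\<rceil>" by (simp add: A_def D_def)
      show "r * (1 + \<eta>) * real B \<le> real n" using bn n by simp
      show "real n \<le> (r * (1 + \<eta>) + 2 * \<eta>) * real B + 3" by (rule n_up)
      show "real L \<le> \<eta> * real B + 1" by (rule L)
      show "L \<le> n" using Ln by simp
    next
      fix m :: nat assume "m \<in> {1..2 ^ B}"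
      then have m: "m \<in> messages C" by (simp add: C(3))
      from C(6)[OF m] tot show "msg_prob W C m (\<lambda>t y r. \<not> on_target C n L (\<xi> * A) m t y r) \<le> \<zeta>" by linarith
      show "codeword C m j \<in> set_pmf P" if "j \<in> {1..n}" for j by (rule C(7)[OF m that])
      from C(8)[OF m] cst show "(\<Sum>j=1..n. k (codeword C m j))
        \<le> (2 * \<eta> * real B + 2) * k x0 + (r * (1 + \<eta>) * real B + 1) * mean P k + \<eta> * real B" by linarith
    qed simp
    then show ?case by blast
  qed
qed

end

section \<open>Cost, delay and sampling frequency of the codes\<close>

lemma msg_prob_Or: "msg_prob W C m (\<lambda>t y r. E t y r \<or> E' t y r) \<le> msg_prob W C m E + msg_prob W C m E'"
proof -
  have "Pr p {(y, r). E t y r \<or> E' t y r} \<le> Pr p {(y, r). E t y r} + Pr p {(y, r). E' t y r}"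
    for p t
  proof -
    have "{(y, r). E t y r \<or> E' t y r} = {(y, r). E t y r} \<union> {(y, r). E' t y r}" by auto
    then show ?thesis by (simp only: prob_Un_le)
  qed
  then show ?thesis
    unfolding msg_prob_def add_divide_distrib[symmetric] sum.distrib[symmetric]
    by (intro divide_right_mono sum_mono) auto
qed

text \<open>All tolerances are merged into one, ready for \<open>diagonalize\<close>. The sampling
  frequency is required to vanish, so one sequence of codes serves every \<rho>.\<close>

definition near_code :: "('a::finite, 'y::finite) channel \<Rightarrow> real \<Rightarrow> real \<Rightarrow> real \<Rightarrow> real \<Rightarrow> nat \<Rightarrow> ('a, 'y) code \<Rightarrow> bool" where
  "near_code W \<beta> v r \<eta> B C \<longleftrightarrow> valid_code W C \<and> adaptive_code C \<and> bits C = B \<and>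
     arrivals C = nat \<lceil>2 powr (\<beta> * real B)\<rceil> \<and> error_prob W C \<le> \<eta> \<and>
     ennreal v - ennreal \<eta> \<le> of_nat B / code_cost W C \<and> sampling_frequency W C \<eta> \<le> \<eta> \<and>
     log 2 (real_of_int (delay W C \<eta>)) / real B \<le> \<eta> \<and>
     \<bar>real_of_int (delay W C \<eta>) - r * real B\<bar> \<le> \<eta> * real B"

text \<open>The sampling frequency divides by the decision time, which is small after an early
  arrival; uniformity of the arrival makes such arrivals rare.\<close>

lemma msg_prob_early:
  fixes W :: "('a::finite, 'y::finite) channel"
  assumes "valid_code W C" "0 \<le> \<delta>"
  shows "msg_prob W C m (\<lambda>t y r. real t < \<delta> * real (arrivals C)) \<le> \<delta>"
proof -
  let ?A = "arrivals C" and ?I = "{t \<in> {1..arrivals C}. real t < \<delta> * real (arrivals C)}"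
  have A: "0 < real ?A" using arrivals_pos[OF assms(1)] by simp
  have "(\<Sum>t=1..?A. Pr (pair_pmf (output_pmf W C m t) (receiver C)) {(y, r). real t < \<delta> * real ?A})
      \<le> (\<Sum>t=1..?A. indicator ?I t)"
  proof (rule sum_mono)
    fix t assume t: "t \<in> {1..?A}"
    show "Pr (pair_pmf (output_pmf W C m t) (receiver C)) {(y, r). real t < \<delta> * real ?A} \<le> indicator ?I t"
    proof (cases "real t < \<delta> * real ?A")
      case True
      then have "indicator ?I t = (1::real)" using t by simp
      then show ?thesis by simp
    qed auto
  qed
  also have "\<dots> = card ?I" by (simp add: indicator_def sum.If_cases Int_def)
  also have "\<dots> \<le> \<delta> * ?A"
  proof -
    have "?I \<subseteq> {1..nat \<lfloor>\<delta> * ?A\<rfloor>}"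
    proof
      fix t assume "t \<in> ?I"
      then have "1 \<le> t" "real t \<le> \<delta> * ?A" by auto
      then show "t \<in> {1..nat \<lfloor>\<delta> * ?A\<rfloor>}" by (simp add: le_nat_floor)
    qed
    then have "card ?I \<le> card {1..nat \<lfloor>\<delta> * ?A\<rfloor>}" by (intro card_mono) auto
    then have "real (card ?I) \<le> real (nat \<lfloor>\<delta> * ?A\<rfloor>)" by simp
    also have "\<dots> \<le> \<delta> * ?A" using assms(2) A by (intro of_nat_floor) simp
    finally show ?thesis .
  qed
  finally show ?thesis using A by (simp add: msg_prob_def divide_le_eq)
qed

lemma (in test_setting) near_codes:
  assumes k: "\<And>x. k x = enn2real (symbol_cost W x)"
    and e: "expected_cost W P = ennreal e" "0 < e" and v: "0 < v" "r = 1 / (v * e)"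
    and \<eta>: "0 < \<eta>" "\<eta> < 1 / 4"
  shows "\<forall>\<^sub>F B in sequentially. \<exists>C. near_code W \<beta> v r \<eta> B C"
proof -
  define k0 where "k0 = k x0"
  \<comment> \<open>Chosen so that (v - \<eta>) (1 / v + \<eta>2) = 1 - \<eta> \<eta>2: a cost of at
    most (1 / v + \<eta>2) B then gives rate at least v - \<eta>.\<close>
  define \<eta>2 where "\<eta>2 = \<eta> / v\<^sup>2"
  \<comment> \<open>The three bounds serve \<open>slack_codes\<close>, the cost and the delay, in
    this order; each of the last two leaves half of its tolerance for rounding.\<close>
  define s where "s = min r (min (\<eta>2 / (2 * (2 * k0 + 1 / v + 1))) (\<eta> / (2 * (r + 2))))"
  have k0: "0 \<le> k0" using cost by (simp add: k0_def)
  have \<eta>2: "0 < \<eta>2" using \<eta> v by (simp add: \<eta>2_def)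
  have pos: "0 < 2 * k0 + 1 / v + 1" "0 < r + 2" using k0 v r by (auto intro: add_nonneg_pos)
  have s: "0 < s" "s \<le> r" using r \<eta> \<eta>2 pos by (simp_all add: s_def)
  have "s \<le> \<eta>2 / (2 * (2 * k0 + 1 / v + 1))" "s \<le> \<eta> / (2 * (r + 2))" by (simp_all add: s_def)
  then have s': "s * (2 * k0 + 1 / v + 1) \<le> \<eta>2 / 2" "s * (r + 2) \<le> \<eta> / 2"
    using pos by (simp_all add: field_simps)
  have fin: "symbol_cost W x = ennreal (k x)" if x: "x \<in> set_pmf P" for x
  proof -
    have "(\<integral>\<^sup>+ x. symbol_cost W x \<partial>measure_pmf P) \<noteq> \<infinity>" using e by (simp add: expected_cost_def)
    then have "AE x in P. symbol_cost W x \<noteq> \<infinity>" by (intro nn_integral_noteq_infinite) auto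
    then have "symbol_cost W x \<noteq> \<top>" using x by (simp add: AE_measure_pmf_iff)
    then show ?thesis by (simp add: k ennreal_enn2real_if)
  qed
  have ek: "mean P k = e"
  proof -
    have "ennreal (mean P k) = (\<integral>\<^sup>+ x. ennreal (k x) \<partial>measure_pmf P)"
      using cost by (intro nn_integral_eq_integral[symmetric] integrable_measure_pmf_finite) auto
    also have "\<dots> = ennreal e"
      unfolding e(1)[symmetric] expected_cost_def using fin
      by (intro nn_integral_cong_AE) (auto simp: AE_measure_pmf_iff)
    finally show ?thesis using e cost by simp
  qed
  have re: "r * e = 1 / v" using v e by simp
  have r\<eta>: "0 < r + \<eta>" using r \<eta> by simp
  have "((\<lambda>B. log 2 ((r + \<eta>) * real B) / real B) \<longlongrightarrow> 0) sequentially" using r\<eta> by real_asymp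
  then have "\<forall>\<^sub>F B in sequentially. log 2 ((r + \<eta>) * real B) / real B < \<eta>"
    using \<eta> by (intro order_tendstoD(2)) auto
  moreover have "\<forall>\<^sub>F B in sequentially. 2 * k0 + e \<le> \<eta>2 / 2 * real B" using \<eta>2 by real_asymp
  moreover have "\<forall>\<^sub>F B in sequentially. 3 \<le> \<eta> / 2 * real B" using \<eta> by real_asymp
  moreover have "\<forall>\<^sub>F B in sequentially. (1::nat) \<le> B" by (rule eventually_ge_at_top)
  \<comment> \<open>Half of the failure budget goes to arrivals before
    \<open>\<eta> / 2 * A\<close>. For later arrivals, \<open>\<eta> * (\<eta> / 2) * A\<close>
    samples are at most \<open>\<eta>\<close> times the decision time.\<close>
  moreover have "0 < \<eta> * (\<eta> / 2)" "0 < \<eta> / 2" "\<eta> / 2 \<le> 1" using \<eta> by simp_all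
  note slack_codes[OF s this]
  ultimately show ?thesis
  proof eventually_elim
    case (elim B)
    then obtain C n2 where "slack_code s (\<eta> * (\<eta> / 2)) (\<eta> / 2) B C n2" by blast
    note sc = this[unfolded slack_code_def]
    let ?n = "blocklength C" and ?A = "arrivals C"
    let ?bad = "\<lambda>m t y r. \<not> on_target C ?n n2 (\<eta> * (\<eta> / 2) * real ?A) m t y r"
    have val: "valid_code W C" and bits: "bits C = B" and n2: "n2 \<le> ?n" using sc by simp_all
    have bad: "msg_prob W C m (?bad m) \<le> \<eta> / 2" if "m \<in> messages C" for m using sc that by blast
    have B: "0 < real B" using elim by simp
    have one: "1 \<in> messages C" by simp
    have good: "1 - \<eta> / 2 \<le> msg_prob W C m E" if m: "m \<in> messages C"
      and E: "\<And>t y r. t \<in> {1..?A} \<Longrightarrow> \<not> ?bad m t y r \<Longrightarrow> E t y r" for m E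
    proof -
      have "msg_prob W C m (\<lambda>t y r. True) \<le> msg_prob W C m (\<lambda>t y r. ?bad m t y r \<or> E t y r)"
        using E by (intro msg_prob_mono[OF val]) blast
      also have "\<dots> \<le> msg_prob W C m (?bad m) + msg_prob W C m E" by (rule msg_prob_Or)
      finally show ?thesis using bad[OF m] msg_prob_True[OF val] by simp
    qed
    have err: "error_prob W C \<le> \<eta>"
    proof -
      have "msg_prob W C m (\<lambda>t y r. decoder C (observed r y) \<noteq> m) \<le> \<eta>" if m: "m \<in> messages C" for m
      proof -
        have "msg_prob W C m (\<lambda>t y r. decoder C (observed r y) \<noteq> m) \<le> msg_prob W C m (?bad m)"
          by (intro msg_prob_mono[OF val]) blast
        then show ?thesis using bad[OF m] \<eta> by linarith
      qed
      then show ?thesis unfolding error_prob_def by auto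
    qed
    have \<eta>1: "0 < \<eta>" "\<eta> < 1" using \<eta> by auto
    have up: "delay W C \<eta> \<le> int ?n"
    proof (rule delay_props(2)[OF val \<eta>1])
      have "1 - \<eta> \<le> msg_prob W C m (decided_within (int ?n))" if m: "m \<in> messages C" for m
      proof -
        have "1 - \<eta> / 2 \<le> msg_prob W C m (decided_within (int ?n))"
          by (rule good[OF m]) auto
        then show ?thesis using \<eta> by simp
      qed
      then show "1 - \<eta> \<le> (MIN m\<in>messages C. msg_prob W C m (decided_within (int ?n)))"
        by auto
    qed
    \<comment> \<open>With a smaller delay the receiver would decide, with probability at least 1 -
      \<eta>, more than \<open>n2\<close> units before time \<open>t + n\<close>; that is a failure
      of probability at most \<eta> / 2.\<close>
    have low: "int ?n - int n2 < delay W C \<eta>"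
    proof (rule ccontr)
      assume *: "\<not> ?thesis"
      have "1 - \<eta> \<le> msg_prob W C 1 (decided_within (delay W C \<eta>))"
        using delay_props(1)[OF val \<eta>1] one by auto
      also have "\<dots> \<le> msg_prob W C 1 (?bad 1)"
        by (rule msg_prob_mono[OF val]) (use * in linarith)
      also have "\<dots> \<le> \<eta> / 2" by (rule bad[OF one])
      finally show False using \<eta> by simp
    qed
    have d_up: "real_of_int (delay W C \<eta>) \<le> (r + \<eta>) * B"
    proof -
      have "real_of_int (delay W C \<eta>) \<le> real ?n" using up by linarith
      also have "\<dots> \<le> (r * (1 + s) + 2 * s) * B + 3" using sc by blast
      also have "(r * (1 + s) + 2 * s) * B = r * B + (s * (r + 2)) * B" by (simp add: algebra_simps)
      also have "(s * (r + 2)) * B \<le> (\<eta> / 2) * B" using s'(2) B by (intro mult_right_mono) auto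
      finally show ?thesis using elim(3) by (simp add: algebra_simps)
    qed
    have d_low: "(r - \<eta>) * B \<le> real_of_int (delay W C \<eta>)"
    proof -
      have "r * B \<le> r * (1 + s) * B" using r s B by (intro mult_right_mono) auto
      also have "\<dots> \<le> real ?n" using sc by blast
      finally have 1: "r * B \<le> real ?n" .
      have "s * 1 \<le> s * (r + 2)" using s r by (intro mult_left_mono) auto
      then have "s * B \<le> \<eta> / 2 * B" using s'(2) B by (intro mult_right_mono) auto
      moreover have "real n2 \<le> s * B + 1" using sc by blast
      ultimately have "real n2 \<le> \<eta> * B" using elim(3) by linarith
      moreover have "real ?n - real n2 \<le> real_of_int (delay W C \<eta>)" using low by linarith
      ultimately show ?thesis using 1 by (simp add: left_diff_distrib)
    qed
    have d1: "1 \<le> real_of_int (delay W C \<eta>)" using low n2 by linarith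
    have lg: "log 2 (real_of_int (delay W C \<eta>)) / B \<le> \<eta>"
    proof -
      have "log 2 (real_of_int (delay W C \<eta>)) \<le> log 2 ((r + \<eta>) * B)"
        using d1 d_up by simp
      then have "log 2 (real_of_int (delay W C \<eta>)) / B \<le> log 2 ((r + \<eta>) * B) / B"
        using B by (intro divide_right_mono) auto
      then show ?thesis using elim(1) by linarith
    qed
    have freq: "sampling_frequency W C \<eta> \<le> \<eta>"
      unfolding sampling_frequency_def
    proof (rule cInf_lower)
      have "1 - \<eta> \<le> msg_prob W C m (\<lambda>t y r. real (num_samples r y) / real (decision_time r y) \<le> \<eta>)" (is "_ \<le> msg_prob W C m ?E")
        if m: "m \<in> messages C" for m
      proof -
        have "1 - \<eta> / 2 \<le> msg_prob W C m (\<lambda>t y r. real t < \<eta> / 2 * real ?A \<or> ?E t y r)"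
        proof (rule good[OF m])
          fix t y r assume t: "t \<in> {1..?A}" and g: "\<not> ?bad m t y r"
          show "real t < \<eta> / 2 * real ?A \<or> ?E t y r"
          proof (rule disjCI)
            assume "\<not> ?E t y r"
            show "real t < \<eta> / 2 * real ?A"
            proof (rule ccontr)
              assume *: "\<not> ?thesis"
              have dt: "real t \<le> real (decision_time r y)" using g n2 by linarith
              have "real (num_samples r y) \<le> \<eta> * (\<eta> / 2 * real ?A)" using g by simp
              also have "\<dots> \<le> \<eta> * real t" using * \<eta> by (intro mult_left_mono) auto
              also have "\<dots> \<le> \<eta> * real (decision_time r y)" using dt \<eta> by (intro mult_left_mono) auto
              finally have "?E t y r" using dt t by (simp add: divide_le_eq)
              then show False using \<open>\<not> ?E t y r\<close> by blast
            qed
          qed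
        qed
        also have "\<dots> \<le> msg_prob W C m (\<lambda>t y r. real t < \<eta> / 2 * real ?A) + msg_prob W C m ?E"
          by (rule msg_prob_Or)
        also have "msg_prob W C m (\<lambda>t y r. real t < \<eta> / 2 * real ?A) \<le> \<eta> / 2"
          using \<eta> by (intro msg_prob_early[OF val]) simp
        finally show ?thesis by simp
      qed
      then show "\<eta> \<in> {q. 0 \<le> q \<and> 1 - \<eta> \<le> (MIN m\<in>messages C. msg_prob W C m
          (\<lambda>t y r. real (num_samples r y) / real (decision_time r y) \<le> q))}"
        using \<eta> by auto
    qed (auto intro!: bdd_belowI[of _ 0])
    have rate: "ennreal v - ennreal \<eta> \<le> of_nat B / code_cost W C"
    proof -
      define Kb where "Kb = (1 / v + \<eta>2) * B"
      have Kb: "0 < Kb" using v \<eta>2 B by (simp add: Kb_def add_pos_pos)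
      have "(\<Sum>i=1..?n. symbol_cost W (codeword C m i)) \<le> ennreal Kb" if m: "m \<in> messages C" for m
      proof -
        have "codeword C m i \<in> set_pmf P" if "i \<in> {1..?n}" for i using sc m that by blast
        then have "(\<Sum>i=1..?n. symbol_cost W (codeword C m i)) = (\<Sum>i=1..?n. ennreal (k (codeword C m i)))"
          using fin by (intro sum.cong) auto
        also have "\<dots> = ennreal (\<Sum>i=1..?n. k (codeword C m i))"
          using cost(2) by (intro sum_ennreal) auto
        also have "\<dots> \<le> ennreal Kb"
        proof (rule ennreal_leI)
          have "(\<Sum>i=1..?n. k (codeword C m i)) \<le> (2 * s * B + 2) * k0 + (r * (1 + s) * B + 1) * e + s * B"
            using sc m unfolding ek k0_def by blast
          also have "\<dots> = (r * e) * B + (s * (2 * k0 + r * e + 1)) * B + (2 * k0 + e)"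
            by (simp add: algebra_simps)
          also have "\<dots> = 1 / v * B + (s * (2 * k0 + 1 / v + 1)) * B + (2 * k0 + e)" unfolding re ..
          also have "(s * (2 * k0 + 1 / v + 1)) * B \<le> \<eta>2 / 2 * B" using s'(1) B by (intro mult_right_mono) auto
          finally show "(\<Sum>i=1..?n. k (codeword C m i)) \<le> Kb"
            using elim(2) by (simp add: Kb_def algebra_simps)
        qed
        finally show ?thesis .
      qed
      then have "code_cost W C \<le> ennreal Kb" unfolding code_cost_def by auto
      then have "of_nat B / ennreal Kb \<le> of_nat B / code_cost W C" by (rule divide_left_mono_ennreal)
      moreover have "of_nat B / ennreal Kb = ennreal (1 / (1 / v + \<eta>2))"
        using Kb B by (simp add: Kb_def ennreal_of_nat_eq_real_of_nat divide_ennreal)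
      moreover have "v - \<eta> \<le> 1 / (1 / v + \<eta>2)"
      proof -
        have "(v - \<eta>) * (1 / v + \<eta>2) = 1 - \<eta> * \<eta>2"
          using v by (simp add: \<eta>2_def power2_eq_square field_simps)
        also have "\<dots> \<le> 1" using \<eta> \<eta>2 by simp
        finally show ?thesis using v \<eta>2 by (subst pos_le_divide_eq) (auto intro: add_pos_pos)
      qed
      ultimately show ?thesis
        using \<eta> by (metis ennreal_leI ennreal_minus less_imp_le order_trans)
    qed
    have "\<bar>real_of_int (delay W C \<eta>) - r * real B\<bar> \<le> \<eta> * real B"
      using d_up d_low by (simp add: abs_le_iff algebra_simps)
    then have "near_code W \<beta> v r \<eta> B C"
      unfolding near_code_def using sc err rate freq lg by blast
    then show ?case by blast
  qed
qed

text \<open>\<open>K B\<close> is the largest \<open>k \<le> B\<close> whose statement holds from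
  \<open>B\<close> on; it tends to infinity since each statement holds eventually. The summand 5
  keeps all tolerances below the 1/4 required in \<open>near_codes\<close>.\<close>

lemma diagonalize:
  fixes \<Phi> :: "real \<Rightarrow> nat \<Rightarrow> 'c \<Rightarrow> bool"
  assumes ev: "\<And>k::nat. \<forall>\<^sub>F B in sequentially. \<exists>C. \<Phi> (1 / (real k + 5)) B C"
  obtains \<epsilon> :: "nat \<Rightarrow> real" where "\<And>B. 0 < \<epsilon> B" "\<epsilon> \<longlonglongrightarrow> 0" "\<forall>\<^sub>F B in sequentially. \<exists>C. \<Phi> (\<epsilon> B) B C"
proof -
  define S where "S k B \<longleftrightarrow> (\<forall>B'\<ge>B. \<exists>C. \<Phi> (1 / (real k + 5)) B' C)" for k B :: nat
  define K where "K B = Max {k. k \<le> B \<and> (k = 0 \<or> S k B)}" for B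
  have fin: "finite {k. k \<le> B \<and> (k = 0 \<or> S k B)}" for B by simp
  have K_in: "K B \<in> {k. k \<le> B \<and> (k = 0 \<or> S k B)}" for B
    unfolding K_def by (rule Max_in[OF fin]) auto
  have K_ge: "\<forall>\<^sub>F B in sequentially. k \<le> K B" for k
  proof -
    obtain N where N: "S k N" using ev[of k] unfolding S_def eventually_sequentially by blast
    have "k \<le> K B" if "max N k \<le> B" for B
      unfolding K_def using that N by (intro Max_ge[OF fin]) (auto simp: S_def)
    then show ?thesis unfolding eventually_sequentially by blast
  qed
  then have K_top: "filterlim K sequentially sequentially" by (simp add: filterlim_at_top)
  show ?thesis
  proof (rule that[of "\<lambda>B. 1 / (real (K B) + 5)"])
    have "(\<lambda>k. 1 / (real k + 5)) \<longlonglongrightarrow> 0" by real_asymp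
    then show "(\<lambda>B. 1 / (real (K B) + 5)) \<longlonglongrightarrow> 0" by (rule filterlim_compose[OF _ K_top])
    have "\<forall>\<^sub>F B in sequentially. 1 \<le> K B" by (rule K_ge)
    then show "\<forall>\<^sub>F B in sequentially. \<exists>C. \<Phi> (1 / (real (K B) + 5)) B C"
    proof eventually_elim
      case (elim B)
      then have "S (K B) B" using K_in[of B] by auto
      then show ?case unfolding S_def by blast
    qed
  qed (simp add: add_nonneg_pos)
qed

section \<open>The capacity\<close>

lemma rate_bound_finite:
  fixes W :: "('a::finite, 'y::finite) channel"
  assumes ch: "async_channel W" and P: "set_pmf P \<subseteq> inputs W"
  shows "rate_bound W \<beta> P \<noteq> \<top>"
proof -
  have "ennreal (mutual_info W P) / expected_cost W P \<noteq> \<top>"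
  proof (cases "0 < mutual_info W P")
    case True
    then show ?thesis
      using expected_cost_pos[OF ch P True] by (auto simp: ennreal_divide_eq_top_iff)
  next
    case False
    then show ?thesis by (simp add: ennreal_neg)
  qed
  then show ?thesis
    unfolding rate_bound_def by (metis min.cobounded1 top_unique)
qed

lemma test_setting_exists:
  fixes W :: "('a::finite, 'y::finite) channel" and P :: "'a pmf"
  assumes P: "set_pmf P \<subseteq> inputs W" and \<beta>: "\<beta> > 0" and I: "0 < mutual_info W P" and r: "0 < r"
    and rI: "1 \<le> r * mutual_info W P"
    and rD: "set_pmf (output_law W P) \<subseteq> set_pmf (trans W (idle W)) \<Longrightarrow>
       1 + \<beta> \<le> r * (mutual_info W P + kl (output_law W P) (trans W (idle W)))"
  obtains x0 y0 g h c0 where "test_setting W P x0 y0 g h c0 (\<lambda>x. enn2real (symbol_cost W x)) \<beta> r"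
proof -
  let ?k = "\<lambda>x. enn2real (symbol_cost W x)"
  obtain x0 y0 where x0: "x0 \<in> set_pmf P" "pmf (trans W (idle W)) y0 < pmf (trans W x0) y0"
    using distinguishing_letter[OF I] by blast
  have J: "(1 + \<beta>) / r \<le> mutual_info W P + kl (output_law W P) (trans W (idle W))"
    if "set_pmf (output_law W P) \<subseteq> set_pmf (trans W (idle W))"
    using rD[OF that] r by (simp add: divide_le_eq mult.commute)
  obtain g :: "'a \<Rightarrow> 'y \<Rightarrow> real" where g: "\<And>x y. 0 \<le> g x y"
    "\<And>x. mean (trans W (idle W)) (g x) \<le> 1"
    "\<And>x y. y \<in> set_pmf (trans W x) \<Longrightarrow> 0 < g x y"
    "(1 + \<beta>) / r \<le> mean P (mean_log W g)"
    using noise_ratio[OF J] by blast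
  define h where "h x y = pmf (trans W x) y / pmf (output_law W P) y" for x y
  note h = message_ratio[where W = W and P = P, folded h_def]
  \<comment> \<open>Finite alphabets make a crude sum a common bound for all logarithms and costs;
    the summand 1 makes it positive.\<close>
  define c0 where "c0 = 1 + (\<Sum>x\<in>UNIV. \<Sum>y\<in>UNIV. \<bar>log 2 (g x y)\<bar>) + (\<Sum>x\<in>UNIV. \<Sum>y\<in>UNIV. \<bar>log 2 (h x y)\<bar>)
    + (\<Sum>x\<in>UNIV. \<bar>?k x\<bar>)"
  have double: "\<bar>f x y\<bar> \<le> (\<Sum>x\<in>UNIV. \<Sum>y\<in>UNIV. \<bar>f x y\<bar>)" for f :: "'a \<Rightarrow> 'y \<Rightarrow> real" and x y
  proof -
    have "\<bar>f x y\<bar> \<le> (\<Sum>y\<in>UNIV. \<bar>f x y\<bar>)" by (rule member_le_sum) auto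
    also have "\<dots> \<le> (\<Sum>x\<in>UNIV. \<Sum>y\<in>UNIV. \<bar>f x y\<bar>)"
      by (rule member_le_sum[where f = "\<lambda>x. \<Sum>y\<in>UNIV. \<bar>f x y\<bar>"]) (auto intro: sum_nonneg)
    finally show ?thesis .
  qed
  have single: "\<bar>?k x\<bar> \<le> (\<Sum>x\<in>UNIV. \<bar>?k x\<bar>)" for x by (rule member_le_sum) auto
  have nn: "0 \<le> (\<Sum>x\<in>UNIV. \<Sum>y\<in>UNIV. \<bar>log 2 (g x y)\<bar>)" "0 \<le> (\<Sum>x\<in>UNIV. \<Sum>y\<in>UNIV. \<bar>log 2 (h x y)\<bar>)"
    "0 \<le> (\<Sum>x\<in>UNIV. \<bar>?k x\<bar>)" by (auto intro!: sum_nonneg)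
  show ?thesis
  proof (rule that[of x0 y0 g h c0], unfold_locales)
    show "set_pmf P \<subseteq> inputs W" "x0 \<in> set_pmf P" "pmf (trans W (idle W)) y0 < pmf (trans W x0) y0"
      "0 < \<beta>" "0 < r" by fact+
    show "0 \<le> g x y" "0 \<le> h x y" for x y by (rule g(1), rule h(1))
    show "0 < c0" unfolding c0_def using nn by linarith
    show "mean (trans W (idle W)) (g x) \<le> 1" for x by (rule g(2))
    show "mean P (\<lambda>x. h x y) \<le> 1" for y by (rule h(2))
    show "0 < g x y \<and> 0 < h x y \<and> \<bar>log 2 (g x y)\<bar> \<le> c0 \<and> \<bar>log 2 (h x y)\<bar> \<le> c0"
      if "x \<in> set_pmf P" "y \<in> set_pmf (trans W x)" for x y
    proof (intro conjI)
      show "0 < g x y" by (rule g(3)[OF that(2)])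
      show "0 < h x y" by (rule h(3)[OF that])
      show "\<bar>log 2 (g x y)\<bar> \<le> c0" unfolding c0_def using double[of "\<lambda>x y. log 2 (g x y)" x y] nn by linarith
      show "\<bar>log 2 (h x y)\<bar> \<le> c0" unfolding c0_def using double[of "\<lambda>x y. log 2 (h x y)" x y] nn by linarith
    qed
    show "\<bar>?k x\<bar> \<le> c0" for x unfolding c0_def using single[of x] nn by linarith
    show "0 \<le> ?k x" for x by simp
    show "1 + \<beta> \<le> r * mean P (mean_log W g)"
      using g(4) r by (simp add: divide_le_eq mult.commute)
    show "1 \<le> r * mean P (mean_log W h)"
      unfolding h(4) by (rule rI)
  qed
qed

theorem achievability:
  fixes W :: "('a::finite, 'y::finite) channel"
  assumes ch: "async_channel W" and P: "set_pmf P \<subseteq> inputs W" and \<beta>: "\<beta> > 0"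
    and v: "rate_bound W \<beta> P = ennreal v" "v > 0"
  obtains \<C> \<epsilon> e where "\<And>B. adaptive_code (\<C> B)" "\<And>\<rho>. \<rho> > 0 \<Longrightarrow> achieves W \<beta> \<rho> (ennreal v) \<C> \<epsilon>"
    "expected_cost W P = ennreal e" "e > 0"
    "(\<lambda>B. real_of_int (delay W (\<C> B) (\<epsilon> B))) \<sim>[sequentially] (\<lambda>B. 1 / (v * e) * real B)"
proof -
  obtain e where e: "expected_cost W P = ennreal e" "0 < e" and vI: "v * e \<le> mutual_info W P" and I: "0 < mutual_info W P"
    and vD: "set_pmf (output_law W P) \<subseteq> set_pmf (trans W (idle W)) \<Longrightarrow>
       v * e * (1 + \<beta>) \<le> mutual_info W P + kl (output_law W P) (trans W (idle W))"
    using rate_bound_positive[OF ch P \<beta> v] by blast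
  \<comment> \<open>\<open>v\<close> bits per unit cost at cost \<open>e\<close> per letter are
    \<open>v * e\<close> bits per letter; \<open>r\<close> is the inverse, so \<open>r * B\<close>
    is the reference length of \<open>P\<close>.\<close>
  define r where "r = 1 / (v * e)"
  have ve: "0 < v * e" and r: "0 < r" using v e by (simp_all add: r_def)
  have rI: "1 \<le> r * mutual_info W P" using vI ve by (simp add: r_def le_divide_eq)
  have rD: "1 + \<beta> \<le> r * (mutual_info W P + kl (output_law W P) (trans W (idle W)))"
    if "set_pmf (output_law W P) \<subseteq> set_pmf (trans W (idle W))"
    using vD[OF that] ve by (simp add: r_def le_divide_eq mult.commute)
  obtain x0 y0 g h c0 where "test_setting W P x0 y0 g h c0 (\<lambda>x. enn2real (symbol_cost W x)) \<beta> r"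
    using test_setting_exists[OF P \<beta> I r rI rD] by blast
  then interpret test_setting W P x0 y0 g h c0 "\<lambda>x. enn2real (symbol_cost W x)" \<beta> r .
  have ev: "\<forall>\<^sub>F B in sequentially. \<exists>C. near_code W \<beta> v r (1 / (real k + 5)) B C" for k :: nat
    by (rule near_codes[OF refl e v(2) r_def]) (auto simp: field_simps)
  obtain \<epsilon> where \<epsilon>: "\<And>B. 0 < \<epsilon> B" "\<epsilon> \<longlonglongrightarrow> 0" "\<forall>\<^sub>F B in sequentially. \<exists>C. near_code W \<beta> v r (\<epsilon> B) B C"
    using diagonalize[where \<Phi> = "near_code W \<beta> v r", OF ev] by blast
  \<comment> \<open>A placeholder for the finitely many \<open>B\<close> without a suitable code:
    every member of the sequence must have an adaptive sampler, although validity is asked only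
    eventually.\<close>
  define C0 :: "('a, 'y) code" where "C0 = \<lparr>bits = 0, arrivals = 0, blocklength = 0, codeword = (\<lambda>_ _. undefined),
    start_time = (\<lambda>_ _. 0), receiver = return_pmf (\<lambda>_. [], \<lambda>_. True), decoder = (\<lambda>_. 0)\<rparr>"
  define \<C> where "\<C> B = (if \<exists>C. near_code W \<beta> v r (\<epsilon> B) B C then SOME C. near_code W \<beta> v r (\<epsilon> B) B C else C0)" for B
  have near: "near_code W \<beta> v r (\<epsilon> B) B (\<C> B)" if "\<exists>C. near_code W \<beta> v r (\<epsilon> B) B C" for B
    using someI_ex[OF that] that by (simp add: \<C>_def)
  have evn: "\<forall>\<^sub>F B in sequentially. near_code W \<beta> v r (\<epsilon> B) B (\<C> B)"
    using \<epsilon>(3) by eventually_elim (rule near)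
  show ?thesis
  proof (rule that[of \<C> \<epsilon> e])
    show "adaptive_code (\<C> B)" for B
    proof (cases "\<exists>C. near_code W \<beta> v r (\<epsilon> B) B C")
      case True
      then show ?thesis using near[OF True] by (simp add: near_code_def)
    next
      case False
      then show ?thesis by (simp add: \<C>_def C0_def adaptive_code_def adaptive_sampler_def)
    qed
    show "achieves W \<beta> \<rho> (ennreal v) \<C> \<epsilon>" if "\<rho> > 0" for \<rho>
      unfolding achieves_def
    proof (intro conjI allI \<epsilon>(1,2))
      show "\<forall>\<^sub>F B in sequentially.
        valid_code W (\<C> B) \<and> bits (\<C> B) = B \<and>
        arrivals (\<C> B) = nat \<lceil>2 powr (\<beta> * real B)\<rceil> \<and>
        error_prob W (\<C> B) \<le> \<epsilon> B \<and>
        of_nat B / code_cost W (\<C> B) \<ge> ennreal v - ennreal (\<epsilon> B) \<and>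
        sampling_frequency W (\<C> B) (\<epsilon> B) \<le> \<rho> + \<epsilon> B \<and>
        log 2 (real_of_int (delay W (\<C> B) (\<epsilon> B))) / real B \<le> \<epsilon> B"
        using evn by eventually_elim (use that in \<open>auto simp: near_code_def\<close>)
    qed
    show "expected_cost W P = ennreal e" "e > 0" by (fact e)+
    show "(\<lambda>B. real_of_int (delay W (\<C> B) (\<epsilon> B))) \<sim>[sequentially] (\<lambda>B. 1 / (v * e) * real B)"
      unfolding r_def[symmetric]
    proof (rule asymp_equivI')
      have "(\<lambda>B. real_of_int (delay W (\<C> B) (\<epsilon> B)) / (r * real B) - 1) \<longlonglongrightarrow> 0"
      proof (rule Lim_null_comparison)
        show "(\<lambda>B. \<epsilon> B / r) \<longlonglongrightarrow> 0" using tendsto_divide[OF \<epsilon>(2) tendsto_const, of r] r by simp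
        have "\<forall>\<^sub>F B in sequentially. (1::nat) \<le> B" by (rule eventually_ge_at_top)
        with evn show "\<forall>\<^sub>F B in sequentially. norm (real_of_int (delay W (\<C> B) (\<epsilon> B)) / (r * real B) - 1) \<le> \<epsilon> B / r"
        proof eventually_elim
          case (elim B)
          let ?d = "real_of_int (delay W (\<C> B) (\<epsilon> B))"
          have rB: "0 < r * real B" using r elim(2) by simp
          have "?d / (r * real B) - 1 = (?d - r * real B) / (r * real B)"
            using r elim(2) by (simp add: diff_divide_distrib)
          then have "norm (?d / (r * real B) - 1) = \<bar>?d - r * real B\<bar> / (r * real B)"
            using rB by (simp add: abs_divide)
          also have "\<dots> \<le> (\<epsilon> B * real B) / (r * real B)"
            using elim(1) rB by (intro divide_right_mono) (auto simp: near_code_def)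
          also have "\<dots> = \<epsilon> B / r" using elim(2) by simp
          finally show ?case .
        qed
      qed
      then show "(\<lambda>B. real_of_int (delay W (\<C> B) (\<epsilon> B)) / (r * real B)) \<longlonglongrightarrow> 1"
        using LIM_zero_iff by blast
    qed
  qed
qed

lemma max_rate_le_adaptive_capacity:
  fixes W :: "('a::finite, 'y::finite) channel"
  assumes ch: "async_channel W" and \<beta>: "\<beta> > 0" and \<rho>: "\<rho> > 0"
  shows "max_rate W \<beta> \<le> adaptive_capacity W \<beta> \<rho>"
  unfolding max_rate_def
proof (rule SUP_least)
  fix P assume "P \<in> {P. set_pmf P \<subseteq> inputs W}"
  then have P: "set_pmf P \<subseteq> inputs W" by simp
  show "rate_bound W \<beta> P \<le> adaptive_capacity W \<beta> \<rho>"
  proof (cases "rate_bound W \<beta> P = 0")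
    case False
    then obtain v where v: "rate_bound W \<beta> P = ennreal v" "v > 0"
      using rate_bound_finite[OF ch P, of \<beta>] by (cases "rate_bound W \<beta> P") auto
    from achievability[OF ch P \<beta> v] obtain \<C> \<epsilon> where "\<And>B. adaptive_code (\<C> B)" "achieves W \<beta> \<rho> (ennreal v) \<C> \<epsilon>"
      using \<rho> by metis
    then show ?thesis
      unfolding v(1) adaptive_capacity_def restricted_capacity_def by (intro Sup_upper) blast
  qed simp
qed

lemma capacity_eq_max_rate:
  fixes W :: "('a::finite, 'y::finite) channel"
  assumes "async_channel W" "\<beta> > 0"
  shows "capacity W \<beta> 1 = max_rate W \<beta>"
proof (rule antisym)
  show "max_rate W \<beta> \<le> capacity W \<beta> 1"
    using max_rate_le_adaptive_capacity[OF assms, of 1] adaptive_capacity_le[of W \<beta> 1] by simp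
qed (rule capacity_le_max_rate[OF assms])

text \<open>The minimising input might vary with \<open>B\<close>. Since
  \<open>ref_length_at\<close> is linear in \<open>B\<close>, a minimiser for \<open>B = 1\<close>
  serves all \<open>B\<close>, and a single input law yields the whole code sequence.\<close>

lemma ref_length_eq:
  fixes W :: "('a::finite, 'y::finite) channel"
  assumes ch: "async_channel W" and \<beta>: "\<beta> > 0" and wd: "ref_length_well_defined W \<beta>"
  obtains P where "set_pmf P \<subseteq> inputs W" "rate_bound W \<beta> P = capacity W \<beta> 1"
    "\<And>B. ref_length W \<beta> B = of_nat B / (capacity W \<beta> 1 * expected_cost W P)"
proof -
  obtain P where P: "P \<in> optimal_inputs W \<beta>" "ref_length W \<beta> 1 = ref_length_at W \<beta> 1 P"
    using wd unfolding ref_length_well_defined_def by blast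
  have in_P: "set_pmf P \<subseteq> inputs W" and best: "\<And>P'. set_pmf P' \<subseteq> inputs W \<Longrightarrow> rate_bound W \<beta> P' \<le> rate_bound W \<beta> P"
    using P(1) unfolding optimal_inputs_def is_arg_max_def by (auto simp: not_less)
  have "max_rate W \<beta> = rate_bound W \<beta> P"
    unfolding max_rate_def using in_P best by (intro antisym SUP_least SUP_upper) auto
  then have cap: "rate_bound W \<beta> P = capacity W \<beta> 1" using capacity_eq_max_rate[OF ch \<beta>] by simp
  have scale: "ref_length_at W \<beta> B P' = of_nat B * ref_length_at W \<beta> 1 P'" for B P'
    unfolding ref_length_at_def by (simp add: ennreal_times_divide)
  have "ref_length W \<beta> B = ref_length_at W \<beta> B P" for B
    unfolding ref_length_def
  proof (rule antisym)
    show "(INF P\<in>optimal_inputs W \<beta>. ref_length_at W \<beta> B P) \<le> ref_length_at W \<beta> B P"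
      using P(1) by (rule INF_lower)
    show "ref_length_at W \<beta> B P \<le> (INF P\<in>optimal_inputs W \<beta>. ref_length_at W \<beta> B P)"
    proof (rule INF_greatest)
      fix P' assume "P' \<in> optimal_inputs W \<beta>"
      then have "ref_length W \<beta> 1 \<le> ref_length_at W \<beta> 1 P'" unfolding ref_length_def by (rule INF_lower)
      then show "ref_length_at W \<beta> B P \<le> ref_length_at W \<beta> B P'"
        unfolding scale[of B] P(2) by (rule mult_left_mono) simp
    qed
  qed
  then show ?thesis using that[OF in_P cap] by (simp add: ref_length_at_def)
qed

theorem theorem3:
  fixes W :: "('a::finite, 'y::finite) channel" and \<beta> \<rho> :: real
  assumes "async_channel W" and "\<beta> > 0" and "\<rho> > 0"
  shows "adaptive_capacity W \<beta> \<rho> = capacity W \<beta> 1 \<and>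
    (ref_length_well_defined W \<beta> \<longrightarrow>
      (\<exists>\<C> \<epsilon>. (\<forall>B. adaptive_code (\<C> B)) \<and>
         achieves W \<beta> \<rho> (capacity W \<beta> 1) \<C> \<epsilon> \<and>
         (\<lambda>B. real_of_int (delay W (\<C> B) (\<epsilon> B))) \<sim>[sequentially]
           (\<lambda>B. enn2real (ref_length W \<beta> B))))"
proof (intro conjI impI)
  show "adaptive_capacity W \<beta> \<rho> = capacity W \<beta> 1"
    using max_rate_le_adaptive_capacity[OF assms] adaptive_capacity_le[of W \<beta> \<rho>] capacity_eq_max_rate[OF assms(1,2)]
    by (intro antisym) auto
  assume wd: "ref_length_well_defined W \<beta>"
  obtain P where P: "set_pmf P \<subseteq> inputs W" "rate_bound W \<beta> P = capacity W \<beta> 1"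
    "\<And>B. ref_length W \<beta> B = of_nat B / (capacity W \<beta> 1 * expected_cost W P)"
    using ref_length_eq[OF assms(1,2) wd] by blast
  obtain v where v: "capacity W \<beta> 1 = ennreal v" "v > 0"
    using wd unfolding ref_length_well_defined_def by (cases "capacity W \<beta> 1") auto
  obtain \<C> \<epsilon> e where C: "\<And>B. adaptive_code (\<C> B)" "\<And>\<rho>. \<rho> > 0 \<Longrightarrow> achieves W \<beta> \<rho> (ennreal v) \<C> \<epsilon>"
    "expected_cost W P = ennreal e" "e > 0"
    "(\<lambda>B. real_of_int (delay W (\<C> B) (\<epsilon> B))) \<sim>[sequentially] (\<lambda>B. 1 / (v * e) * real B)"
    using achievability[OF assms(1) P(1) assms(2) P(2)[unfolded v(1)] v(2)] by blast
  have "enn2real (ref_length W \<beta> B) = 1 / (v * e) * real B" for B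
  proof -
    have "ref_length W \<beta> B = ennreal (real B) / ennreal (v * e)"
      unfolding P(3) v(1) C(3) using v C(4) by (simp add: ennreal_mult' ennreal_of_nat_eq_real_of_nat)
    also have "\<dots> = ennreal (1 / (v * e) * real B)"
      using v C(4) by (simp add: divide_ennreal)
    finally show ?thesis using v C(4) by simp
  qed
  then show "\<exists>\<C> \<epsilon>. (\<forall>B. adaptive_code (\<C> B)) \<and> achieves W \<beta> \<rho> (capacity W \<beta> 1) \<C> \<epsilon> \<and>
      (\<lambda>B. real_of_int (delay W (\<C> B) (\<epsilon> B))) \<sim>[sequentially] (\<lambda>B. enn2real (ref_length W \<beta> B))"
    using C(1,5) C(2)[OF assms(3)] v(1) by (intro exI[of _ \<C>] exI[of _ \<epsilon>]) simp
qed

end
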